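(* Let $\tau>0$, $p\ge1$, $a_j\in\mathbb R\setminus\{-k\tau-l: k,l\in\mathbb Z_{\ge0}\}$ and $b_j>0$ for $j=1,\dots,p$, and assume $0<\sum_{j=1}^p(b_j-a_j)<2\tau$. Let $$f(x)=\sum_{n\ge0}\frac{[a_1,\dots,a_p;\tau]_n}{[b_1,\dots,b_p;\tau]_n}x^n$$ (generalized Kilbas-Saigo function, an entire function). Then for $x>0$ $$f(-x)=C\times K^{p+1,1}_{p+2,p+2}\Big(\begin{matrix} 1,1,b_1,\dots,b_p \\ {a_1},\dots,a_p,1+\tau,1+\tau \end{matrix}\Big\vert x;\tau\Big),\qquad C:=(2\pi)^{1-\tau}\prod_{j=1}^p\frac{G(b_j;\tau)}{G(a_j;\tau)}.$$
   Context: Barnes double gamma function. For $\tau\in\mathbb C\setminus(-\infty,0]$ let $\psi=\Gamma'/\Gamma$, let $\gamma_E=-\psi(1)$, $$C(\tau)=\lim_{k\to\infty}\Big[\sum_{j=1}^{k-1}\psi(j\tau)+\tfrac12\psi(k\tau)-\tfrac1\tau\ln\frac{\Gamma(k\tau)}{\sqrt{2\pi}}\Big],\quad D(\tau)=\lim_{k\to\infty}\Big[\sum_{j=1}^{k-1}\psi'(j\tau)+\tfrac12\psi'(k\tau)-\tfrac1\tau\psi(k\tau)\Big],$$ $a(\tau)=\gamma_E\tau+\frac{\tau}{2}\ln(2\pi\tau)+\frac12\ln\tau-\tau C(\tau)$, $b(\tau)=-\frac{\pi^2\tau^2}{6}-\tau\ln\tau-\tau^2D(\tau)$, and $$G(z;\tau)=\frac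 z\tau e^{a(\tau)\frac z\tau+b(\tau)\frac{z^2}{2\tau^2}}\prod_{k,l\ge0,\,(k,l)\ne(0,0)}\Big(1+\frac z{k\tau+l}\Big)e^{-\frac z{k\tau+l}+\frac{z^2}{2(k\tau+l)^2}} .$$ It is entire in $z$ (with zeros at $-k\tau-l$, $k,l\ge0$), and satisfies $G(1;\tau)=1$, $G(z+1;\tau)=\Gamma(z/\tau)G(z;\tau)$, $G(z+\tau;\tau)=(2\pi)^{\frac{\tau-1}2}\tau^{-z+\frac12}\Gamma(z)G(z;\tau)$. Pochhammer-type symbol: $[a;\tau]_z=G(a+z;\tau)/G(a;\tau)$, so $[a;\tau]_n=\prod_{k=0}^{n-1}\Gamma((a+k)/\tau)$ for integers $n\ge0$; $[a_1,\dots,a_p;\tau]_n=\prod_{j=1}^p[a_j;\tau]_n$. $K$-function (the case needed here). For integers $0\le M\le P$, $0\le L\le P$, upper parameters ${\bf A}\in\mathbb C^P$ and lower parameters ${\bf B}\in\mathbb C^P$, with $M+L=P$, put $$\mathcal G(s)=\frac{\prod_{j=1}^MG(B_j-s;\tau)\prod_{j=1}^LG(1+\tau-A_j+s;\tau)}{\prod_{j=M+1}^PG(1+\tau-B_j+s;\tau)\prod_{j=L+1}^PG(A_j-s;\tau)},$$ $\Lambda^+=\{A_j+l\tau+k: L+1\le j\le P,\ l,k\ge0\}$, $\Lambda^-=\{B_j-l\tau-k: M+1\le j\le P,\ l,k\ge1\}$ ($l,k$ integers), $\mu=\sum_{j=1}^LA_j-\sum_{j=L+1}^PA_j+\sum_{j=1}^MB_j-\sum_{j=M+1}^PB_j$.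 If $\Lambda^+\cap\Lambda^-=\emptyset$ and $\mathrm{Re}(\mu)\ne0$, then for $x>0$ $$K^{M,L}_{P,P}\Big(\begin{matrix} {\bf A} \\ {\bf B} \end{matrix}\Big\vert x;\tau\Big)=\frac1{2\pi i}\int_{\mathcal L_{\theta^-,\theta^+}}\mathcal G(s)x^{-s}\,ds,$$ where $\mathcal L_{\theta^-,\theta^+}$ is a simple contour dividing the plane into two domains, one containing $\Lambda^+$ and all large positive numbers and the other containing $\Lambda^-$, oriented so that $\Lambda^-$ is on the left, and coinciding for large $|s|$ with rays $c_\pm+re^{i\theta^\pm}$ in the upper/lower half-planes; $\theta^+\in(0,\pi)$, $\theta^-\in(-\pi,0)$ are any angles with $\mathrm{Re}(\mu s)>0$ on $\arg s=\theta^\pm$ (the value does not depend on the choice). For instance, if $\mu<0$ one takes $\theta^\pm=\pm(\pi-\epsilon)$, $\epsilon\in(0,\pi/2)$. *)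

theory Defs
  imports "HOL-Analysis.Analysis"
begin

section \<open>The Barnes double gamma function\<close>

text \<open>
  \<open>ln_Gamma\<close> is the branch of \<open>ln \<circ> \<Gamma>\<close> that is holomorphic off the non-positive reals and
  real on the positive reals.  \<open>Digamma\<close> and \<open>Polygamma 1\<close> are \<open>\<psi>\<close> and \<open>\<psi>'\<close>, and
  \<open>euler_mascheroni\<close> is \<open>- \<psi>(1)\<close> by \<open>Digamma_1\<close>.
\<close>

definition barnes_C :: "complex \<Rightarrow> complex" where
  "barnes_C \<tau> = lim (\<lambda>k::nat.
     (\<Sum>j=1..<k. Digamma (of_nat j * \<tau>)) + Digamma (of_nat k * \<tau>) / 2
       - 1 / \<tau> * (ln_Gamma (of_nat k * \<tau>) - of_real (ln (sqrt (2 * pi)))))"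

definition barnes_D :: "complex \<Rightarrow> complex" where
  "barnes_D \<tau> = lim (\<lambda>k::nat.
     (\<Sum>j=1..<k. Polygamma 1 (of_nat j * \<tau>)) + Polygamma 1 (of_nat k * \<tau>) / 2
       - 1 / \<tau> * Digamma (of_nat k * \<tau>))"

definition barnes_a :: "complex \<Rightarrow> complex" where
  "barnes_a \<tau> = euler_mascheroni * \<tau> + \<tau> / 2 * ln (2 * of_real pi * \<tau>) + ln \<tau> / 2
     - \<tau> * barnes_C \<tau>"

definition barnes_b :: "complex \<Rightarrow> complex" where
  "barnes_b \<tau> = - (of_real pi ^ 2 * \<tau> ^ 2 / 6) - \<tau> * ln \<tau> - \<tau> ^ 2 * barnes_D \<tau>"

text \<open>
  The double product is absolutely convergent; it is taken as the unordered product over the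
  index set, i.e. the limit of the finite partial products along \<open>finite_subsets_at_top\<close>
  (the multiplicative analogue of \<open>infsum\<close>).
\<close>

definition barnes_G :: "complex \<Rightarrow> complex \<Rightarrow> complex" where
  "barnes_G \<tau> z =
     z / \<tau> * exp (barnes_a \<tau> * (z / \<tau>) + barnes_b \<tau> * (z ^ 2 / (2 * \<tau> ^ 2))) *
     Lim (finite_subsets_at_top (UNIV - {(0, 0)}))
       (\<lambda>F. \<Prod>(k::nat, l::nat)\<in>F.
          (1 + z / (of_nat k * \<tau> + of_nat l)) *
          exp (- (z / (of_nat k * \<tau> + of_nat l)) + z ^ 2 / (2 * (of_nat k * \<tau> + of_nat l) ^ 2)))"

definition barnes_pochhammer :: "complex \<Rightarrow> complex \<Rightarrow> complex \<Rightarrow> complex" where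
  "barnes_pochhammer \<tau> a z = barnes_G \<tau> (a + z) / barnes_G \<tau> a"

definition barnes_pochhammers :: "complex \<Rightarrow> complex list \<Rightarrow> nat \<Rightarrow> complex" where
  "barnes_pochhammers \<tau> as n = (\<Prod>a\<leftarrow>as. barnes_pochhammer \<tau> a (of_nat n))"


section \<open>The generalized Kilbas-Saigo function\<close>

definition kilbas_saigo_coeff :: "complex \<Rightarrow> complex list \<Rightarrow> complex list \<Rightarrow> nat \<Rightarrow> complex" where
  "kilbas_saigo_coeff \<tau> as bs n = barnes_pochhammers \<tau> as n / barnes_pochhammers \<tau> bs n"

definition kilbas_saigo :: "complex \<Rightarrow> complex list \<Rightarrow> complex list \<Rightarrow> complex \<Rightarrow> complex" where
  "kilbas_saigo \<tau> as bs x = (\<Sum>n. kilbas_saigo_coeff \<tau> as bs n * x ^ n)"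


section \<open>The K-function\<close>

text \<open>
  Upper parameters \<open>A\<^sub>1, \<dots>, A\<^sub>P\<close> and lower parameters \<open>B\<^sub>1, \<dots>, B\<^sub>P\<close> are lists \<open>A\<close>, \<open>B\<close>, so that
  \<open>take M B\<close> holds the \<open>B\<^sub>j\<close> with \<open>j \<le> M\<close> and \<open>drop M B\<close> those with \<open>j > M\<close>, and likewise for
  \<open>A\<close> and \<open>L\<close>.
\<close>

definition K_integrand ::
    "complex \<Rightarrow> nat \<Rightarrow> nat \<Rightarrow> complex list \<Rightarrow> complex list \<Rightarrow> complex \<Rightarrow> complex" where
  "K_integrand \<tau> M L A B s =
     ((\<Prod>b\<leftarrow>take M B. barnes_G \<tau> (b - s)) * (\<Prod>a\<leftarrow>take L A. barnes_G \<tau> (1 + \<tau> - a + s))) /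
     ((\<Prod>b\<leftarrow>drop M B. barnes_G \<tau> (1 + \<tau> - b + s)) * (\<Prod>a\<leftarrow>drop L A. barnes_G \<tau> (a - s)))"

definition K_poles_plus :: "complex \<Rightarrow> nat \<Rightarrow> complex list \<Rightarrow> complex set" where
  "K_poles_plus \<tau> L A = {a + of_nat l * \<tau> + of_nat k | a l k. a \<in> set (drop L A)}"

definition K_poles_minus :: "complex \<Rightarrow> nat \<Rightarrow> complex list \<Rightarrow> complex set" where
  "K_poles_minus \<tau> M B =
     {b - of_nat l * \<tau> - of_nat k | b l k. b \<in> set (drop M B) \<and> 1 \<le> l \<and> 1 \<le> k}"

definition K_mu :: "nat \<Rightarrow> nat \<Rightarrow> complex list \<Rightarrow> complex list \<Rightarrow> complex" where
  "K_mu M L A B =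
     sum_list (take L A) - sum_list (drop L A) + sum_list (take M B) - sum_list (drop M B)"

text \<open>
  Contours are parametrised by the whole real line; up to reparametrisation the two infinite
  ends are rays of unit speed.  The parameter runs from the ray of angle \<open>\<theta>m\<close> in the lower
  half-plane to the ray of angle \<open>\<theta>p\<close> in the upper half-plane.  Since the large positive numbers lie
  in the component \<open>U\<close>, this direction is the one for which \<open>V\<close>, hence \<open>\<Lambda>m\<close>, is on the left.
\<close>

definition K_contour ::
    "complex set \<Rightarrow> complex set \<Rightarrow> complex \<Rightarrow> (real \<Rightarrow> complex) \<Rightarrow> bool" where
  "K_contour \<Lambda>p \<Lambda>m \<mu> \<gamma> \<longleftrightarrow>
     \<gamma> piecewise_C1_differentiable_on UNIV \<and> inj \<gamma> \<and>
     (\<exists>\<theta>p \<theta>m cp cm R.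
        0 < \<theta>p \<and> \<theta>p < pi \<and> - pi < \<theta>m \<and> \<theta>m < 0 \<and>
        Re (\<mu> * cis \<theta>p) > 0 \<and> Re (\<mu> * cis \<theta>m) > 0 \<and>
        (\<forall>t\<ge>R. \<gamma> t = cp + of_real t * cis \<theta>p) \<and>
        (\<forall>t\<ge>R. \<gamma> (- t) = cm + of_real t * cis \<theta>m)) \<and>
     (\<exists>U V. open U \<and> connected U \<and> U \<noteq> {} \<and> open V \<and> connected V \<and> V \<noteq> {} \<and>
        U \<inter> V = {} \<and> U \<union> V = - range \<gamma> \<and>
        \<Lambda>p \<subseteq> U \<and> (\<exists>N::real. \<forall>x\<ge>N. of_real x \<in> U) \<and> \<Lambda>m \<subseteq> V)"

text \<open>
  \<open>has_K_value \<tau> M L A B x v\<close>: the parameters are admissible, and along every admissible contour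
  (of which there is at least one) the defining integral converges with value \<open>v\<close>.
  Uniqueness of \<open>v\<close> is immediate.
\<close>

definition has_K_value ::
    "complex \<Rightarrow> nat \<Rightarrow> nat \<Rightarrow> complex list \<Rightarrow> complex list \<Rightarrow> real \<Rightarrow> complex \<Rightarrow> bool" where
  "has_K_value \<tau> M L A B x v \<longleftrightarrow>
     length B = length A \<and> M + L = length A \<and>
     K_poles_plus \<tau> L A \<inter> K_poles_minus \<tau> M B = {} \<and> Re (K_mu M L A B) \<noteq> 0 \<and>
     (\<exists>\<gamma>. K_contour (K_poles_plus \<tau> L A) (K_poles_minus \<tau> M B) (K_mu M L A B) \<gamma>) \<and>
     (\<forall>\<gamma>. K_contour (K_poles_plus \<tau> L A) (K_poles_minus \<tau> M B) (K_mu M L A B) \<gamma> \<longrightarrow>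
        ((\<lambda>t. K_integrand \<tau> M L A B (\<gamma> t) * of_real x powr (- \<gamma> t) *
              vector_derivative \<gamma> (at t))
           has_integral (2 * of_real pi * \<i> * v)) UNIV)"

definition K_function ::
    "complex \<Rightarrow> nat \<Rightarrow> nat \<Rightarrow> complex list \<Rightarrow> complex list \<Rightarrow> real \<Rightarrow> complex" where
  "K_function \<tau> M L A B x = (THE v. has_K_value \<tau> M L A B x v)"

end

theory Submission
  imports Defs "HOL-Complex_Analysis.Complex_Analysis"
begin

text \<open>
  By the shift equation of \<open>G\<close> in \<open>\<tau>\<close> and the reflection formula of \<open>\<Gamma>\<close>, the integrand collapses to
  \<open>(2 \<pi>)\<^sup>\<tau>\<^sup>-\<^sup>1 \<pi> / sin (\<pi> s) \<cdot> Q (- s) x\<^sup>-\<^sup>s\<close> with \<open>Q z = \<Prod>\<^sub>j G (a\<^sub>j + z) / G (b\<^sub>j + z)\<close>.  Its only poles on the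
  left of the contour are the integers \<open>-n\<close>, and the residues there are the terms of the
  Kilbas-Saigo series.  The contour is closed by vertical segments on the lines \<open>Re s = - N - 1/2\<close>.

  Everything rests on the superexponential decay of \<open>Q\<close> in sectors \<open>Re z \<ge> \<eta> \<bar>z\<bar>\<close>: the second
  derivative of \<open>log Q\<close> is a sum over the lattice \<open>k \<tau> + l\<close>, whose terms agree up to \<open>O (\<bar>z\<bar>\<^sup>-\<^sup>4)\<close> with
  a mixed second difference of \<open>-\<delta> / (\<tau> z)\<close>, \<open>\<delta> = \<Sum>\<^sub>j (b\<^sub>j - a\<^sub>j)\<close>; the sum telescopes, and integrating
  twice along rays gives \<open>log \<bar>Q z\<bar> \<le> - (\<delta> / \<tau>) Re z log \<bar>z\<bar> + O (\<bar>z\<bar>)\<close>.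

  The shift equation itself comes from writing the double product as a product of Gamma functions,
  one per row; the limits defining \<open>C\<close> and \<open>D\<close> cancel the exponential factors, and the asymptotics of
  \<open>\<Gamma> (k \<tau> + z) / \<Gamma> (k \<tau>)\<close> that is needed is the convergence of the product to a nonzero value.
\<close>

section \<open>The double product\<close>

text \<open>The decay of \<open>Q\<close> is confined to sectors: the gain Re z log |z| fades
  towards the imaginary directions. It is enough because \<open>K_mu\<close> is a negative real
  number, so that admissible rays point strictly to the left, and because the closing segment
  between two such rays at abscissa -X has length O(X) and stays in one fixed sector. Quotients are
  easier to handle than \<open>barnes_G\<close>: numerator and denominator have equally many
  factors, so the quadratic parts of the logarithms drop out of the second derivative, and linear
  terms only enter the O(|z|). The estimates are made on finite boxes of lattice points and then
  passed to the limit.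

  The other obstacle is topological. The bounded part of an admissible contour is arbitrary; it is
  only known to separate the plane into two connected open sets. Winding numbers are therefore
  transported along paths inside one of these sets, after moving the closing line to the left of the
  path, to a point where they can be read off: far to the right, or inside an explicit quadrilateral
  between two closing lines.\<close>

definition barnes_lattice :: "real \<Rightarrow> nat \<times> nat \<Rightarrow> real" where
  "barnes_lattice \<tau> i = real (fst i) * \<tau> + real (snd i)"

text \<open>The Weierstrass primary factor of genus 2 at -u. Genus 2 is forced by the lattice: the
  inverse cubes of k \<tau> + l are summable, the inverse squares are not.\<close>

definition barnes_factor :: "complex \<Rightarrow> complex" where
  "barnes_factor u = (1 + u) * exp (- u + u ^ 2 / 2)"

definition barnes_log :: "complex \<Rightarrow> complex" where
  "barnes_log u = Ln (1 + u) - u + u ^ 2 / 2"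

definition barnes_P :: "real \<Rightarrow> complex \<Rightarrow> complex" where
  "barnes_P \<tau> z = Lim (finite_subsets_at_top (UNIV - {(0, 0)}))
     (\<lambda>F. \<Prod>i\<in>F. barnes_factor (z / of_real (barnes_lattice \<tau> i)))"

lemma barnes_factor_eq_0_iff: "barnes_factor u = 0 \<longleftrightarrow> u = -1"
  by (auto simp: barnes_factor_def add_eq_0_iff)

lemma barnes_G_eq_P:
  "barnes_G (of_real \<tau>) z = z / of_real \<tau> *
     exp (barnes_a (of_real \<tau>) * (z / of_real \<tau>) + barnes_b (of_real \<tau>) * (z ^ 2 / (2 * of_real \<tau> ^ 2))) *
     barnes_P \<tau> z"
proof -
  have "(\<lambda>(k::nat, l::nat).
          (1 + z / (of_nat k * complex_of_real \<tau> + of_nat l)) *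
          exp (- (z / (of_nat k * of_real \<tau> + of_nat l)) + z ^ 2 / (2 * (of_nat k * of_real \<tau> + of_nat l) ^ 2)))
     = (\<lambda>i. barnes_factor (z / of_real (barnes_lattice \<tau> i)))"
    by (auto simp: fun_eq_iff barnes_factor_def barnes_lattice_def power_divide field_simps)
  thus ?thesis
    unfolding barnes_G_def barnes_P_def by simp
qed

lemma exp_barnes_log:
  assumes "u \<noteq> -1"
  shows "exp (barnes_log u) = barnes_factor u"
proof -
  have "1 + u \<noteq> 0" using assms by (metis add.commute add.inverse_inverse add_eq_0_iff)
  hence "exp (Ln (1 + u) + (- u + u ^ 2 / 2)) = barnes_factor u"
    by (simp add: barnes_factor_def exp_add)
  thus ?thesis by (simp add: barnes_log_def algebra_simps)
qed

text \<open>The derivative of \<open>barnes_log\<close> is v^2 / (1 + v), and on the segment from 0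
  to u the real part of 1 + v is at least 1/2. The mean value inequality then costs one further
  factor |u|.\<close>

lemma norm_barnes_log_le:
  assumes "Re u \<ge> -1/2"
  shows "norm (barnes_log u) \<le> 2 * norm u ^ 3"
proof -
  have seg: "norm v \<le> norm u \<and> Re v \<ge> -1/2" if v: "v \<in> closed_segment 0 u" for v
  proof -
    from v obtain t where t: "0 \<le> t" "t \<le> 1" "v = t *\<^sub>R u"
      by (auto simp: closed_segment_def)
    have "t * norm u \<le> 1 * norm u" using t by (intro mult_right_mono) auto
    moreover have "t * Re u \<ge> -1/2"
    proof (cases "Re u \<ge> 0")
      case False
      hence "t * Re u \<ge> 1 * Re u" using t by (intro mult_right_mono_neg) auto
      thus ?thesis using assms by simp
    next
      case True
      hence "t * Re u \<ge> 0" using t by simp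
      thus ?thesis by simp
    qed
    ultimately show ?thesis using t by simp
  qed
  have "norm (barnes_log u - barnes_log 0) \<le> (2 * norm u ^ 2) * norm (u - 0)"
  proof (rule field_differentiable_bound[of "closed_segment 0 u" _ "\<lambda>v. v ^ 2 / (1 + v)"])
    fix v assume v: "v \<in> closed_segment 0 u"
    have "Re (1 + v) \<ge> 1/2" using seg[OF v] by simp
    hence nz: "1 + v \<notin> \<real>\<^sub>\<le>\<^sub>0" "1 + v \<noteq> 0" "norm (1 + v) \<ge> 1/2"
      using complex_Re_le_cmod[of "1+v"] by (auto simp: complex_nonpos_Reals_iff simp del: complex_Re_le_cmod)
    show "(barnes_log has_field_derivative v ^ 2 / (1 + v)) (at v within closed_segment 0 u)"
      unfolding barnes_log_def
      by (rule derivative_eq_intros refl nz | simp add: nz field_simps power2_eq_square)+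
    have "norm (v ^ 2 / (1 + v)) \<le> norm u ^ 2 / (1/2)"
      unfolding norm_divide norm_power using seg[OF v] nz by (intro frac_le power_mono) auto
    thus "cmod (v ^ 2 / (1 + v)) \<le> 2 * norm u ^ 2" by simp
  qed auto
  thus ?thesis by (simp add: barnes_log_def power3_eq_cube power2_eq_square)
qed

section \<open>Convergence and zeros of the double product\<close>

text \<open>A majorant of product form reduces double sums to single ones. The exponent 5/4 exceeds
  1, and two copies of it fit under the exponent 3 needed for the product; under the exponent 4 of
  the growth estimate they leave 3/2 to spare.\<close>

lemma summable_on_double_powr:
  "(\<lambda>i::nat\<times>nat. (1 + real (fst i)) powr (-5/4) * (1 + real (snd i)) powr (-5/4)) summable_on A"
proof (rule summable_on_subset_banach)
  have s: "(\<lambda>n::nat. (1 + real n) powr (-5/4)) summable_on UNIV"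
  proof (rule norm_summable_imp_summable_on)
    have "summable (\<lambda>n. real n powr (-5/4))"
      by (subst summable_real_powr_iff) auto
    hence "summable (\<lambda>n. real (Suc n) powr (-5/4))"
      by (subst summable_Suc_iff)
    thus "summable (\<lambda>n. norm ((1 + real n) powr (-5/4)))"
      by (simp add: add.commute)
  qed
  have "(\<lambda>(k::nat,l::nat). (1 + real k) powr (-5/4) * (1 + real l) powr (-5/4)) summable_on (UNIV \<times> UNIV)"
    by (rule summable_on_SigmaI[where g = "\<lambda>k. (1 + real k) powr (-5/4) * (\<Sum>\<^sub>\<infinity>l::nat. (1 + real l) powr (-5/4))"])
       (use s in \<open>auto intro!: has_sum_cmult_right has_sum_infsum summable_on_cmult_left\<close>)
  thus "(\<lambda>i::nat\<times>nat. (1 + real (fst i)) powr (-5/4) * (1 + real (snd i)) powr (-5/4)) summable_on UNIV"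
    by (simp add: case_prod_unfold)
qed auto

locale barnes_double_gamma =
  fixes \<tau> :: real
  assumes \<tau>: "\<tau> > 0"
begin

abbreviation "T \<equiv> complex_of_real \<tau>"
abbreviation "lat \<equiv> barnes_lattice \<tau>"

lemma barnes_lattice_pos: "i \<noteq> (0, 0) \<Longrightarrow> lat i > 0"
  using \<tau> by (cases i) (auto simp: barnes_lattice_def intro: add_pos_nonneg add_nonneg_pos)

lemma barnes_lattice_nonneg: "lat i \<ge> 0"
  using \<tau> by (auto simp: barnes_lattice_def)

lemma barnes_lattice_ge: "lat (k, l) \<ge> min 1 \<tau> * (real k + real l)"
proof -
  have "min 1 \<tau> * real k \<le> \<tau> * real k" "min 1 \<tau> * real l \<le> 1 * real l"
    by (intro mult_right_mono; simp)+
  thus ?thesis by (simp add: barnes_lattice_def algebra_simps)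
qed

lemma barnes_lattice_ge': 
  assumes "i \<noteq> (0, 0)"
  shows "lat i \<ge> min 1 \<tau> / 2 * (1 + real (fst i) + real (snd i))"
proof -
  obtain k l where i: "i = (k, l)" by (cases i)
  have "k + l \<ge> 1" using assms i by (cases k) auto
  hence kl: "real k + real l \<ge> 1" by (metis of_nat_1 of_nat_add of_nat_mono)
  have "min 1 \<tau> / 2 * (1 + real k + real l) \<le> min 1 \<tau> / 2 * (2 * (real k + real l))"
    using kl \<tau> by (intro mult_left_mono) auto
  also have "\<dots> = min 1 \<tau> * (real k + real l)" by simp
  finally show ?thesis using barnes_lattice_ge[of k l] i by simp
qed

lemma finite_barnes_lattice_le: "finite {i. lat i \<le> R}"
proof (rule finite_subset)
  define c where "c = min 1 \<tau>"
  have c: "c > 0" using \<tau> by (simp add: c_def)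
  show "{i. lat i \<le> R} \<subseteq> {..nat \<lceil>R / c\<rceil>} \<times> {..nat \<lceil>R / c\<rceil>}"
  proof
    fix i assume "i \<in> {i. lat i \<le> R}"
    then obtain k l where i: "i = (k, l)" "lat (k, l) \<le> R" by (cases i) auto
    have "c * (real k + real l) \<le> R" using barnes_lattice_ge[of k l] i by (simp add: c_def)
    hence "real k + real l \<le> R / c" using c by (simp add: field_simps)
    hence "real k \<le> R / c" "real l \<le> R / c" by linarith+
    hence "k \<le> nat \<lceil>R / c\<rceil>" "l \<le> nat \<lceil>R / c\<rceil>" by linarith+
    thus "i \<in> {..nat \<lceil>R / c\<rceil>} \<times> {..nat \<lceil>R / c\<rceil>}" using i by simp
  qed
qed auto

text \<open>Both 1 + k and 1 + l are at most m = 1 + k + l, and the lattice value is at least a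
  constant times m; now m^(5/2) \<le> m^3.\<close>

lemma inverse_cube_barnes_lattice_le:
  assumes "i \<noteq> (0, 0)"
  shows "1 / lat i ^ 3 \<le>
    1 / (min 1 \<tau> / 2) ^ 3 * ((1 + real (fst i)) powr (-5/4) * (1 + real (snd i)) powr (-5/4))"
proof -
  define c where "c = min 1 \<tau> / 2"
  have c: "c > 0" using \<tau> by (simp add: c_def)
  define x y where "x = 1 + real (fst i)" and "y = 1 + real (snd i)"
  define m where "m = 1 + real (fst i) + real (snd i)"
  have xy: "x \<ge> 1" "y \<ge> 1" "m \<ge> x" "m \<ge> y" by (auto simp: x_def y_def m_def)
  have "x powr (5/4) * y powr (5/4) \<le> m powr (5/4) * m powr (5/4)"
    using xy by (intro mult_mono powr_mono2) auto
  also have "\<dots> = m powr (5/2)" by (simp flip: powr_add)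
  also have "\<dots> \<le> m powr 3" using xy by (intro powr_mono) auto
  also have "\<dots> = m ^ 3" using xy by (simp add: powr_numeral)
  finally have 1: "x powr (5/4) * y powr (5/4) \<le> m ^ 3" .
  have "c * m \<le> lat i" using barnes_lattice_ge'[OF assms] by (simp add: c_def m_def)
  hence "(c * m) ^ 3 \<le> lat i ^ 3" using c xy by (intro power_mono) auto
  hence "c ^ 3 * (x powr (5/4) * y powr (5/4)) \<le> lat i ^ 3"
    using 1 c by (smt (verit, best) mult_left_mono power_mult_distrib zero_less_power)
  moreover have "0 < c ^ 3 * (x powr (5/4) * y powr (5/4))" using c xy by auto
  ultimately have "1 / lat i ^ 3 \<le> 1 / (c ^ 3 * (x powr (5/4) * y powr (5/4)))"
    by (intro divide_left_mono mult_pos_pos barnes_lattice_pos[OF assms] zero_less_power c) (use xy in auto)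
  also have "\<dots> = 1 / c ^ 3 * (x powr (-5/4) * y powr (-5/4))"
    by (simp add: powr_minus_divide)
  finally show ?thesis by (simp add: c_def x_def y_def)
qed

lemma summable_on_inverse_cube_barnes_lattice:
  "(\<lambda>i. 1 / lat i ^ 3) summable_on (UNIV - {(0, 0)})"
proof (rule summable_on_comparison_test)
  show "(\<lambda>i. 1 / (min 1 \<tau> / 2) ^ 3 * ((1 + real (fst i)) powr (-5/4) * (1 + real (snd i)) powr (-5/4)))
     summable_on (UNIV - {(0, 0)})"
    by (intro summable_on_cmult_right summable_on_double_powr)
qed (use inverse_cube_barnes_lattice_le barnes_lattice_nonneg in auto)

text \<open>On a disc of radius R only finitely many lattice values are at most 2 R. For all others
  |z / w| < 1/2, the principal logarithm is available, and the M-test applies. The form "finite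
  product times an exponential" yields holomorphy and the zero set at once.\<close>

lemma barnes_P_local:
  assumes R: "R > 0"
  defines "J \<equiv> {i. i \<noteq> (0,0) \<and> lat i \<le> 2 * R}"
  shows "finite J \<and> (\<exists>h. h holomorphic_on ball 0 R \<and> (\<forall>z. norm z < R \<longrightarrow>
     ((\<lambda>F. \<Prod>i\<in>F. barnes_factor (z / of_real (lat i))) \<longlongrightarrow>
        (\<Prod>i\<in>J. barnes_factor (z / of_real (lat i))) * exp (h z)) (finite_subsets_at_top (UNIV - {(0, 0)}))))"
proof -
  define I :: "(nat \<times> nat) set" where "I = UNIV - {(0,0)}"
  define w where "w = (\<lambda>i. complex_of_real (lat i))"
  have J: "finite J" "J \<subseteq> I"
    unfolding J_def I_def by (auto intro: finite_subset[OF _ finite_barnes_lattice_le[of "2*R"]])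
  \<comment> \<open>Setting the logarithm to 0 on \<open>J\<close> lets the sums run over all of
    \<open>I\<close>, while the exceptional factors, whose logarithm may not exist, stay outside the
    exponential.\<close>
  define g where "g = (\<lambda>i z. if i \<in> J then 0 else barnes_log (z / w i))"
  define h where "h = (\<lambda>z. \<Sum>\<^sub>\<infinity>i\<in>I. g i z)"
  have far: "Re (z / w i) > -1/2" "norm (z / w i) < 1" if "i \<in> I - J" "norm z \<le> R" for i z
  proof -
    have "lat i > 2 * R" using that by (auto simp: J_def I_def)
    hence "norm (z / w i) < 1/2"
      using that R by (simp add: w_def norm_divide divide_simps) 
    thus "Re (z / w i) > -1/2" "norm (z / w i) < 1" using abs_Re_le_cmod[of "z / w i"] by linarith+
  qed
  have gle: "norm (g i z) \<le> 2 * R ^ 3 * (1 / lat i ^ 3)" if "i \<in> I" "norm z \<le> R" for i z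
  proof (cases "i \<in> J")
    case True
    thus ?thesis using R barnes_lattice_nonneg by (auto simp: g_def)
  next
    case False
    have "norm (g i z) \<le> 2 * norm (z / w i) ^ 3"
      using False norm_barnes_log_le[of "z / w i"] far[of i z] that by (simp add: g_def)
    also have "\<dots> = 2 * norm z ^ 3 * (1 / lat i ^ 3)"
      using barnes_lattice_nonneg[of i] by (simp add: w_def norm_divide power_divide)
    also have "\<dots> \<le> 2 * R ^ 3 * (1 / lat i ^ 3)"
      using that barnes_lattice_nonneg[of i] by (intro mult_right_mono mult_left_mono power_mono) auto
    finally show ?thesis .
  qed
  have sumM: "(\<lambda>i. 2 * R ^ 3 * (1 / lat i ^ 3)) summable_on I"
    unfolding I_def by (intro summable_on_cmult_right summable_on_inverse_cube_barnes_lattice)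
  have ul: "uniform_limit (cball 0 R) (\<lambda>F z. \<Sum>i\<in>F. g i z) h (finite_subsets_at_top I)"
    unfolding h_def by (rule Weierstrass_m_test_general[OF _ sumM]) (use gle in auto)
  have ghol: "g i holomorphic_on cball 0 R" if "i \<in> I" for i
  proof (cases "i \<in> J")
    case False
    have "(\<lambda>z. barnes_log (z / w i)) holomorphic_on cball 0 R"
    proof -
      have "w i \<noteq> 0" using that barnes_lattice_pos[of i] by (auto simp: w_def I_def)
      moreover have "1 + z / w i \<notin> \<real>\<^sub>\<le>\<^sub>0" if "z \<in> cball 0 R" for z
        using far[of i z] that False \<open>i \<in> I\<close> by (auto simp: complex_nonpos_Reals_iff)
      ultimately show ?thesis
        unfolding barnes_log_def by (intro holomorphic_intros) auto
    qed
    thus ?thesis using False by (simp add: g_def)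
  qed (simp add: g_def)
  have "eventually (\<lambda>F. continuous_on (cball 0 R) (\<lambda>z. \<Sum>i\<in>F. g i z) \<and> (\<lambda>z. \<Sum>i\<in>F. g i z) holomorphic_on ball 0 R)
      (finite_subsets_at_top I)"
    unfolding eventually_finite_subsets_at_top
  proof (intro exI[of _ "{}"] conjI allI impI)
    fix F assume F: "finite F \<and> {} \<subseteq> F \<and> F \<subseteq> I"
    have "(\<lambda>z. \<Sum>i\<in>F. g i z) holomorphic_on cball 0 R"
      using F ghol by (intro holomorphic_on_sum) auto
    thus "continuous_on (cball 0 R) (\<lambda>z. \<Sum>i\<in>F. g i z)" "(\<lambda>z. \<Sum>i\<in>F. g i z) holomorphic_on ball 0 R"
      using holomorphic_on_imp_continuous_on holomorphic_on_subset ball_subset_cball by blast+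
  qed auto
  from holomorphic_uniform_limit[OF this ul] have hhol: "h holomorphic_on ball 0 R"
    by auto
  have lim: "((\<lambda>F. \<Prod>i\<in>F. barnes_factor (z / w i)) \<longlongrightarrow>
        (\<Prod>i\<in>J. barnes_factor (z / w i)) * exp (h z)) (finite_subsets_at_top I)" if z: "norm z < R" for z
  proof -
    have "((\<lambda>F. \<Sum>i\<in>F. g i z) \<longlongrightarrow> h z) (finite_subsets_at_top I)"
      using tendsto_uniform_limitI[OF ul] z by auto
    hence "((\<lambda>F. (\<Prod>i\<in>J. barnes_factor (z / w i)) * exp (\<Sum>i\<in>F. g i z)) \<longlongrightarrow> 
           (\<Prod>i\<in>J. barnes_factor (z / w i)) * exp (h z)) (finite_subsets_at_top I)"
      by (intro tendsto_intros)
    moreover have "eventually (\<lambda>F. (\<Prod>i\<in>F. barnes_factor (z / w i)) = 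
         (\<Prod>i\<in>J. barnes_factor (z / w i)) * exp (\<Sum>i\<in>F. g i z)) (finite_subsets_at_top I)"
      unfolding eventually_finite_subsets_at_top
    proof (intro exI[of _ J] conjI J allI impI)
      fix F assume F: "finite F \<and> J \<subseteq> F \<and> F \<subseteq> I"
      have "exp (\<Sum>i\<in>F. g i z) = (\<Prod>i\<in>F. exp (g i z))" using F by (simp add: exp_sum)
      also have "\<dots> = (\<Prod>i\<in>F - J. barnes_factor (z / w i))"
      proof (rule prod.mono_neutral_cong_right)
        fix i assume i: "i \<in> F - J"
        hence "z / w i \<noteq> -1" using far[of i z] F z by auto
        thus "exp (g i z) = barnes_factor (z / w i)" using i by (simp add: g_def exp_barnes_log)
      qed (use F in \<open>auto simp: g_def\<close>)
      finally have "(\<Prod>i\<in>J. barnes_factor (z / w i)) * exp (\<Sum>i\<in>F. g i z) =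
          (\<Prod>i\<in>F - J. barnes_factor (z / w i)) * (\<Prod>i\<in>J. barnes_factor (z / w i))" by simp
      also have "\<dots> = (\<Prod>i\<in>F. barnes_factor (z / w i))"
        using F J by (metis prod.subset_diff)
      finally show "(\<Prod>i\<in>F. barnes_factor (z / w i)) = (\<Prod>i\<in>J. barnes_factor (z / w i)) * exp (\<Sum>i\<in>F. g i z)" by simp
    qed
    ultimately show ?thesis by (rule Lim_transform_eventually[OF _ eventually_mono]) auto
  qed
  have "h holomorphic_on ball 0 R \<and> (\<forall>z. norm z < R \<longrightarrow>
     ((\<lambda>F. \<Prod>i\<in>F. barnes_factor (z / of_real (lat i))) \<longlongrightarrow>
        (\<Prod>i\<in>J. barnes_factor (z / of_real (lat i))) * exp (h z)) (finite_subsets_at_top (UNIV - {(0, 0)})))"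
    using hhol lim unfolding w_def I_def by blast
  with J(1) show ?thesis by blast
qed

lemma barnes_P_eqI:
  assumes "((\<lambda>F. \<Prod>i\<in>F. barnes_factor (z / of_real (lat i))) \<longlongrightarrow> c) (finite_subsets_at_top (UNIV - {(0, 0)}))"
  shows "barnes_P \<tau> z = c"
  unfolding barnes_P_def by (rule tendsto_Lim[OF _ assms]) simp

lemma tendsto_barnes_P:
  "((\<lambda>F. \<Prod>i\<in>F. barnes_factor (z / of_real (lat i))) \<longlongrightarrow> barnes_P \<tau> z)
     (finite_subsets_at_top (UNIV - {(0, 0)}))"
proof -
  have R: "norm z + 1 > 0" by (smt (verit) norm_ge_zero)
  define J where "J = {i. i \<noteq> (0,0) \<and> lat i \<le> 2 * (norm z + 1)}"
  obtain h where *: "\<And>z'. norm z' < norm z + 1 \<Longrightarrow> ((\<lambda>F. \<Prod>i\<in>F. barnes_factor (z' / of_real (lat i))) \<longlongrightarrow>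
        (\<Prod>i\<in>J. barnes_factor (z' / of_real (lat i))) * exp (h z')) (finite_subsets_at_top (UNIV - {(0, 0)}))"
    using barnes_P_local[OF R] unfolding J_def by blast
  have "((\<lambda>F. \<Prod>i\<in>F. barnes_factor (z / of_real (lat i))) \<longlongrightarrow>
        (\<Prod>i\<in>J. barnes_factor (z / of_real (lat i))) * exp (h z)) (finite_subsets_at_top (UNIV - {(0, 0)}))"
    by (rule *) simp
  with barnes_P_eqI[OF this] show ?thesis by simp
qed

lemma barnes_P_eq_0_iff: "barnes_P \<tau> z = 0 \<longleftrightarrow> (\<exists>i. i \<noteq> (0,0) \<and> z = - of_real (lat i))"
  and holomorphic_on_barnes_P: "barnes_P \<tau> holomorphic_on A"
proof -
  define J where "J = (\<lambda>R. {i. i \<noteq> (0,0) \<and> lat i \<le> 2 * R})"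
  have local_form: "finite (J R) \<and> barnes_P \<tau> holomorphic_on ball 0 R \<and>
      (\<exists>h. \<forall>z. norm z < R \<longrightarrow> barnes_P \<tau> z = (\<Prod>i\<in>J R. barnes_factor (z / of_real (lat i))) * exp (h z))"
    if R: "R > 0" for R
  proof -
    obtain h where h: "h holomorphic_on ball 0 R"
      and *: "\<And>z. norm z < R \<Longrightarrow> ((\<lambda>F. \<Prod>i\<in>F. barnes_factor (z / of_real (lat i))) \<longlongrightarrow>
        (\<Prod>i\<in>J R. barnes_factor (z / of_real (lat i))) * exp (h z)) (finite_subsets_at_top (UNIV - {(0, 0)}))"
      and J: "finite (J R)"
      using barnes_P_local[OF R] unfolding J_def by blast
    have eq: "barnes_P \<tau> z = (\<Prod>i\<in>J R. barnes_factor (z / of_real (lat i))) * exp (h z)" if "norm z < R" for z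
      using barnes_P_eqI[OF *[OF that]] .
    have nz: "complex_of_real (lat i) \<noteq> 0" if "i \<in> J R" for i
      using barnes_lattice_pos[of i] that by (auto simp: J_def)
    have "(\<lambda>z. (\<Prod>i\<in>J R. barnes_factor (z / of_real (lat i))) * exp (h z)) holomorphic_on ball 0 R"
      unfolding barnes_factor_def by (intro holomorphic_intros h nz) auto
    hence "barnes_P \<tau> holomorphic_on ball 0 R"
      by (rule holomorphic_transform) (simp add: eq)
    with eq J show ?thesis by blast
  qed
  show "barnes_P \<tau> z = 0 \<longleftrightarrow> (\<exists>i. i \<noteq> (0,0) \<and> z = - of_real (lat i))"
  proof -
    define R where "R = norm z + 1"
    have R: "R > 0" "norm z < R" by (auto simp: R_def intro: add_nonneg_pos)
    obtain h where h: "barnes_P \<tau> z = (\<Prod>i\<in>J R. barnes_factor (z / of_real (lat i))) * exp (h z)" and J: "finite (J R)"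
      using local_form[OF R(1)] R(2) by blast
    have e: "z / of_real x = -1 \<longleftrightarrow> z = - of_real x" if "x > 0" for x :: real
      using that by (simp add: divide_eq_eq)
    have "barnes_P \<tau> z = 0 \<longleftrightarrow> (\<exists>i\<in>J R. z / of_real (lat i) = -1)"
      using J by (simp add: h barnes_factor_eq_0_iff)
    also have "\<dots> \<longleftrightarrow> (\<exists>i\<in>J R. z = - of_real (lat i))"
      by (intro bex_cong refl e barnes_lattice_pos) (auto simp: J_def)
    also have "\<dots> \<longleftrightarrow> (\<exists>i. i \<noteq> (0,0) \<and> z = - of_real (lat i))"
    proof -
      have "lat i \<le> 2 * R" if "z = - of_real (lat i)" for i
        using that R barnes_lattice_nonneg[of i] by (simp add: R_def)
      thus ?thesis by (auto simp: J_def)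
    qed
    finally show ?thesis .
  qed
  have "barnes_P \<tau> analytic_on {z}" for z
  proof -
    have "norm z + 1 > 0" by (intro add_nonneg_pos) auto
    thus ?thesis unfolding analytic_at
      using local_form[of "norm z + 1"] by (intro exI[of _ "ball 0 (norm z + 1)"]) auto
  qed
  hence "barnes_P \<tau> analytic_on UNIV" by (subst analytic_on_analytic_at) auto
  thus "barnes_P \<tau> holomorphic_on A" by (meson analytic_imp_holomorphic holomorphic_on_subset subset_UNIV)
qed

lemma barnes_G_eq_0_iff: "barnes_G T z = 0 \<longleftrightarrow> (\<exists>i. z = - of_real (lat i))"
proof -
  have "lat (0,0) = 0" by (simp add: barnes_lattice_def)
  hence "(\<exists>i. z = - of_real (lat i)) \<longleftrightarrow> z = 0 \<or> (\<exists>i. i \<noteq> (0,0) \<and> z = - of_real (lat i))"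
    by (metis neg_equal_0_iff_equal of_real_0)
  thus ?thesis using \<tau> by (auto simp: barnes_G_eq_P barnes_P_eq_0_iff)
qed

lemma holomorphic_barnes_G: "barnes_G T holomorphic_on A"
  unfolding barnes_G_eq_P[abs_def] using \<tau> by (intro holomorphic_intros holomorphic_on_barnes_P) auto

lemma holomorphic_barnes_G_compose [holomorphic_intros]:
  "f holomorphic_on A \<Longrightarrow> (\<lambda>z. barnes_G T (f z)) holomorphic_on A"
  using holomorphic_on_compose_gen[OF _ holomorphic_barnes_G[of UNIV]] by (auto simp: o_def)

end

section \<open>The shift by \<open>\<tau>\<close>\<close>

text \<open>Unordered convergence dominates every order of multiplication: a box containing a
  suitable finite set has its product within e/2 of \<open>P\<close>, and this bound survives the
  inner limit in M. It serves to evaluate the double product row by row.\<close>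

lemma tendsto_prod_iterated:
  fixes f :: "'i \<Rightarrow> complex"
  assumes f: "((\<lambda>F. \<Prod>i\<in>F. f i) \<longlongrightarrow> P) (finite_subsets_at_top I)"
    and B: "\<And>N M. finite (B N M)" "\<And>N M. B N M \<subseteq> I"
    and exh: "\<And>F. finite F \<Longrightarrow> F \<subseteq> I \<Longrightarrow> \<exists>N0. \<forall>N\<ge>N0. \<exists>M0. \<forall>M\<ge>M0. F \<subseteq> B N (M::nat)"
    and L: "\<And>N. (\<lambda>M. \<Prod>i\<in>B N M. f i) \<longlonglongrightarrow> L N"
  shows "L \<longlonglongrightarrow> P"
proof (rule LIMSEQ_I)
  fix e :: real assume e: "e > 0"
  have "eventually (\<lambda>F. dist (\<Prod>i\<in>F. f i) P < e / 2) (finite_subsets_at_top I)"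
    using f e by (intro tendstoD) auto
  then obtain F0 where "finite F0 \<and> F0 \<subseteq> I \<and>
      (\<forall>F. finite F \<and> F0 \<subseteq> F \<and> F \<subseteq> I \<longrightarrow> dist (\<Prod>i\<in>F. f i) P < e / 2)"
    unfolding eventually_finite_subsets_at_top by (elim exE conjE) (rule that, intro conjI)
  hence F0: "finite F0" "F0 \<subseteq> I"
    and *: "\<And>F. finite F \<Longrightarrow> F0 \<subseteq> F \<Longrightarrow> F \<subseteq> I \<Longrightarrow> dist (\<Prod>i\<in>F. f i) P < e / 2"
    by auto
  from exh[OF F0] obtain N0 where N0: "\<And>N. N \<ge> N0 \<Longrightarrow> \<exists>M0. \<forall>M\<ge>M0. F0 \<subseteq> B N M" by blast
  show "\<exists>no. \<forall>n\<ge>no. norm (L n - P) < e"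
  proof (intro exI[of _ N0] allI impI)
    fix N assume "N \<ge> N0"
    then obtain M0 where M0: "\<And>M. M \<ge> M0 \<Longrightarrow> F0 \<subseteq> B N M" using N0 by blast
    have "norm (L N - P) \<le> e / 2"
    proof (rule tendsto_upperbound)
      show "(\<lambda>M. norm ((\<Prod>i\<in>B N M. f i) - P)) \<longlonglongrightarrow> norm (L N - P)"
        by (intro tendsto_intros L)
      show "eventually (\<lambda>M. norm ((\<Prod>i\<in>B N M. f i) - P) \<le> e / 2) sequentially"
        using eventually_ge_at_top[of M0]
      proof eventually_elim
        case (elim M)
        show ?case using *[OF B(1) M0[OF elim] B(2)] by (simp add: dist_norm)
      qed
    qed auto
    thus "norm (L N - P) < e" using e by simp
  qed
qed

text \<open>The value of the product of primary factors over the row x, x + 1, x + 2, ...: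
  \<open>Digamma x\<close> is the regularised sum of the inverses, up to sign, and
  \<open>Polygamma 1 x\<close> the sum of the inverse squares. With \<open>rGamma\<close> the value
  is also right, namely 0, when some factor vanishes.\<close>

definition barnes_row :: "complex \<Rightarrow> complex \<Rightarrow> complex" where
  "barnes_row x z = rGamma (x + z) * Gamma x * exp (z * Digamma x + z ^ 2 / 2 * Polygamma 1 x)"

text \<open>The factors 1 + z / (x + l) multiply to a quotient of two Gauss products for
  \<open>rGamma\<close>; the power of M left over compensates the divergence of the sum of inverses
  in the exponential.\<close>

lemma tendsto_barnes_row:
  fixes x z :: complex
  assumes x: "x \<notin> \<int>\<^sub>\<le>\<^sub>0"
  shows "(\<lambda>M. \<Prod>l<M. barnes_factor (z / (x + of_nat l))) \<longlonglongrightarrow> barnes_row x z"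
proof -
  have x0: "x \<noteq> 0" using x by auto
  have xl: "x + of_nat l \<noteq> 0" for l using x by (auto dest: plus_of_nat_eq_0_imp)
  have s2: "(\<lambda>l. inverse ((x + of_nat l) ^ 2)) sums Polygamma 1 x"
    using Polygamma_converges'[OF x0, of 2] by (simp add: Polygamma_def numeral_2_eq_2 summable_sums)
  \<comment> \<open>An index mismatch: \<open>rGamma_series\<close> at M has M + 1 Pochhammer
    factors but uses log M, whereas the limit for \<open>Digamma\<close> with M + 1 summands uses
    log (M + 1).\<close>
  have l0: "(\<lambda>M. ln (real M) - ln (real (Suc M))) \<longlonglongrightarrow> 0"
  proof (rule Lim_transform_eventually)
    show "(\<lambda>M. ln (real M / real (Suc M))) \<longlonglongrightarrow> 0"
      using tendsto_ln[OF LIMSEQ_n_over_Suc_n] by simp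
    show "eventually (\<lambda>M. ln (real M / real (Suc M)) = ln (real M) - ln (real (Suc M))) sequentially"
      using eventually_gt_at_top[of 0] by eventually_elim (simp add: ln_div)
  qed
  define R where "R = (\<lambda>M. rGamma_series (x + z) M / rGamma_series x M *
      exp (z * of_real (ln (real M) - ln (real (Suc M))) +
           z * (of_real (ln (real (Suc M))) - (\<Sum>l<Suc M. inverse (x + of_nat l))) +
           z ^ 2 / 2 * (\<Sum>l<Suc M. inverse ((x + of_nat l) ^ 2))))"
  have "R \<longlonglongrightarrow> rGamma (x + z) / rGamma x * exp (z * of_real 0 + z * Digamma x + z ^ 2 / 2 * Polygamma 1 x)"
    unfolding R_def
  proof (intro tendsto_intros rGamma_series_LIMSEQ l0)
    show "(\<lambda>M. of_real (ln (real (Suc M))) - (\<Sum>l<Suc M. inverse (x + of_nat l))) \<longlonglongrightarrow> Digamma x"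
      by (rule LIMSEQ_Suc[OF Digamma_LIMSEQ[OF x0]])
    show "(\<lambda>M. \<Sum>l<Suc M. inverse ((x + of_nat l) ^ 2)) \<longlonglongrightarrow> Polygamma 1 x"
      using LIMSEQ_Suc[OF s2[unfolded sums_def]] .
  qed (use x in \<open>auto simp: rGamma_eq_zero_iff\<close>)
  also have "rGamma (x + z) / rGamma x * exp (z * of_real 0 + z * Digamma x + z ^ 2 / 2 * Polygamma 1 x) = barnes_row x z"
    by (simp add: barnes_row_def Gamma_def field_simps)
  finally have R: "R \<longlonglongrightarrow> barnes_row x z" .
  have "(\<Prod>l<Suc M. barnes_factor (z / (x + of_nat l))) = R M" for M
  proof -
    have "(\<Prod>l<Suc M. 1 + z / (x + of_nat l)) = (\<Prod>l<Suc M. (x + z + of_nat l) / (x + of_nat l))"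
      using xl by (intro prod.cong) (auto simp: field_simps)
    also have "\<dots> = pochhammer (x + z) (Suc M) / pochhammer x (Suc M)"
      by (simp add: pochhammer_prod prod_dividef atLeast0LessThan)
    also have "\<dots> = rGamma_series (x + z) M / rGamma_series x M * exp (z * of_real (ln (real M)))"
      by (simp add: rGamma_series_def exp_add ring_distribs)
    finally have 1: "(\<Prod>l<Suc M. 1 + z / (x + of_nat l)) = \<dots>" .
    have "(\<Prod>l<Suc M. exp (- (z / (x + of_nat l)) + (z / (x + of_nat l)) ^ 2 / 2)) =
         exp (\<Sum>l<Suc M. - (z / (x + of_nat l)) + (z / (x + of_nat l)) ^ 2 / 2)"
      by (simp only: exp_sum finite_lessThan)
    also have "(\<Sum>l<Suc M. - (z / (x + of_nat l)) + (z / (x + of_nat l)) ^ 2 / 2) =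
        - z * (\<Sum>l<Suc M. inverse (x + of_nat l)) + z ^ 2 / 2 * (\<Sum>l<Suc M. inverse ((x + of_nat l) ^ 2))"
      unfolding sum_distrib_left sum.distrib [symmetric]
      by (intro sum.cong refl) (simp add: field_simps power_divide power_mult_distrib)
    finally have 2: "(\<Prod>l<Suc M. exp (- (z / (x + of_nat l)) + (z / (x + of_nat l)) ^ 2 / 2)) = exp \<dots>" .
    have "(\<Prod>l<Suc M. barnes_factor (z / (x + of_nat l))) = 
       (\<Prod>l<Suc M. 1 + z / (x + of_nat l)) * (\<Prod>l<Suc M. exp (- (z / (x + of_nat l)) + (z / (x + of_nat l)) ^ 2 / 2))"
      unfolding barnes_factor_def prod.distrib ..
    also have "\<dots> = R M"
      unfolding 1 2 R_def mult.assoc exp_add [symmetric] by (simp add: algebra_simps)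
    finally show ?thesis .
  qed
  hence "(\<lambda>M. \<Prod>l<Suc M. barnes_factor (z / (x + of_nat l))) \<longlonglongrightarrow> barnes_row x z"
    using R by simp
  thus ?thesis by (rule LIMSEQ_imp_Suc)
qed

section \<open>The limits defining C and D\<close>

text \<open>By the functional equation the increment of \<psi> over [x - 1, x] is 1 / (x - 1); by
  the mean value theorem it is a value of \<psi>' in that interval, and \<psi>' decreases.\<close>

lemma Polygamma_1_at_top: "((\<lambda>x::real. Polygamma 1 x) \<longlongrightarrow> 0) at_top"
proof (rule tendsto_sandwich)
  show "eventually (\<lambda>x::real. 0 \<le> Polygamma 1 x) at_top"
    using eventually_gt_at_top[of 0]
  proof eventually_elim
    case (elim x)
    hence "x \<notin> \<int>\<^sub>\<le>\<^sub>0" by (auto elim!: nonpos_Ints_cases)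
    thus ?case using Polygamma_real_odd_pos[of x 1] by simp
  qed
  show "eventually (\<lambda>x::real. Polygamma 1 x \<le> 1 / (x - 1)) at_top"
    using eventually_gt_at_top[of 1]
  proof eventually_elim
    case (elim x)
    have "\<exists>\<xi>. x - 1 < \<xi> \<and> \<xi> < x \<and> Digamma x - Digamma (x - 1) = (x - (x - 1)) * Polygamma (Suc 0) \<xi>"
      using elim by (intro MVT2 derivative_intros) (auto elim!: nonpos_Ints_cases)
    then obtain \<xi> where \<xi>: "x - 1 < \<xi>" "\<xi> < x" "Digamma x - Digamma (x - 1) = Polygamma 1 \<xi>" by auto
    have "Digamma x = Digamma (x - 1) + 1 / (x - 1)"
      using Digamma_plus1[of "x - 1"] elim by simp
    moreover have "Polygamma 1 \<xi> > Polygamma 1 x"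
      using \<xi> elim by (intro Polygamma_real_strict_antimono) auto
    ultimately show ?case using \<xi> by simp
  qed
  show "((\<lambda>x::real. 1 / (x - 1)) \<longlongrightarrow> 0) at_top"
    by (rule real_tendsto_divide_at_top[OF tendsto_const])
       (use filterlim_tendsto_add_at_top[OF tendsto_const[of "-1"] filterlim_ident] in \<open>simp add: algebra_simps\<close>)
qed auto

lemma Polygamma_1_antimono: "0 < x \<Longrightarrow> x \<le> y \<Longrightarrow> Polygamma 1 y \<le> Polygamma 1 (x::real)"
  using Polygamma_real_strict_antimono[of x y 1] by (cases "x = y") auto

text \<open>The error of the trapezoidal rule for \<open>\<psi>\<close> and for \<open>\<psi>'\<close> is bounded by a multiple of the decrement of
  \<open>\<psi>'\<close>, which telescopes.\<close>

lemma trapezoid_Digamma: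
  fixes x h :: real
  assumes "x > 0" "h > 0"
  shows "\<bar>(Digamma x + Digamma (x + h)) / 2 - (ln_Gamma (x + h) - ln_Gamma x) / h\<bar>
     \<le> h * (Polygamma 1 x - Polygamma 1 (x + h))"
proof -
  define \<phi> where "\<phi> = (\<lambda>t. ln_Gamma (x + t) - ln_Gamma x - t * (Digamma x + Digamma (x + t)) / 2)"
  define \<phi>' where "\<phi>' = (\<lambda>t. (Digamma (x + t) - Digamma x - t * Polygamma 1 (x + t)) / 2)"
  have "\<exists>t. 0 < t \<and> t < h \<and> \<phi> h - \<phi> 0 = (h - 0) * \<phi>' t"
  proof (rule MVT2)
    fix t assume t: "0 \<le> t" "t \<le> h"
    have "x + t > 0" "x + t \<notin> \<int>\<^sub>\<le>\<^sub>0" using assms t by (auto elim!: nonpos_Ints_cases)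
    thus "(\<phi> has_field_derivative \<phi>' t) (at t)"
      unfolding \<phi>_def \<phi>'_def
      by (auto intro!: derivative_eq_intros simp: field_simps)
  qed (use assms in auto)
  then obtain t where t: "0 < t" "t < h" "\<phi> h - \<phi> 0 = h * \<phi>' t" by auto
  have "\<exists>\<xi>. x < \<xi> \<and> \<xi> < x + t \<and> Digamma (x + t) - Digamma x = ((x + t) - x) * Polygamma (Suc 0) \<xi>"
    using assms t by (intro MVT2 derivative_intros) (auto elim!: nonpos_Ints_cases)
  then obtain \<xi> where \<xi>: "x < \<xi>" "\<xi> < x + t" "Digamma (x + t) - Digamma x = t * Polygamma 1 \<xi>" by auto
  have "\<phi>' t = t * ((Polygamma 1 \<xi> - Polygamma 1 (x + t)) / 2)"
    unfolding \<phi>'_def \<xi>(3) by (simp add: algebra_simps)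
  moreover have le: "Polygamma 1 \<xi> \<le> Polygamma 1 x" "Polygamma 1 (x + t) \<ge> Polygamma 1 (x + h)" 
     "Polygamma 1 \<xi> \<ge> Polygamma 1 (x + t)"
    by (rule Polygamma_1_antimono; use \<xi> t assms in simp)+
  moreover have "t * (Polygamma 1 \<xi> - Polygamma 1 (x + t)) \<le> h * (Polygamma 1 x - Polygamma 1 (x + h))"
    by (rule mult_mono) (use t le in linarith)+
  moreover have "t * (Polygamma 1 \<xi> - Polygamma 1 (x + t)) \<ge> 0"
    by (rule mult_nonneg_nonneg) (use t le in linarith)+
  ultimately have "\<bar>\<phi>' t\<bar> \<le> h * (Polygamma 1 x - Polygamma 1 (x + h))"
    by simp
  moreover have "(Digamma x + Digamma (x + h)) / 2 - (ln_Gamma (x + h) - ln_Gamma x) / h = - (\<phi> h - \<phi> 0) / h"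
    using assms by (simp add: \<phi>_def field_simps)
  ultimately show ?thesis using assms t by simp
qed

lemma trapezoid_Polygamma_1:
  fixes x h :: real
  assumes "x > 0" "h > 0"
  shows "\<bar>(Polygamma 1 x + Polygamma 1 (x + h)) / 2 - (Digamma (x + h) - Digamma x) / h\<bar>
     \<le> Polygamma 1 x - Polygamma 1 (x + h)"
proof -
  have "\<exists>\<xi>. x < \<xi> \<and> \<xi> < x + h \<and> Digamma (x + h) - Digamma x = ((x + h) - x) * Polygamma (Suc 0) \<xi>"
    using assms by (intro MVT2 derivative_intros) (auto elim!: nonpos_Ints_cases)
  then obtain \<xi> where \<xi>: "x < \<xi>" "\<xi> < x + h" "(Digamma (x + h) - Digamma x) / h = Polygamma 1 \<xi>" 
    using assms by auto
  moreover have "Polygamma 1 \<xi> \<le> Polygamma 1 x" "Polygamma 1 \<xi> \<ge> Polygamma 1 (x + h)" 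
    by (rule Polygamma_1_antimono; use \<xi> assms in simp)+
  moreover have "q \<le> r \<Longrightarrow> r \<le> p \<Longrightarrow> \<bar>(p + q) / 2 - r\<bar> \<le> p - q" for p q r :: real
    by (auto simp: abs_if field_simps)
  ultimately show ?thesis unfolding \<xi>(3) by blast
qed

lemma convergent_of_telescoping_bound:
  fixes c p :: "nat \<Rightarrow> real"
  assumes le: "\<And>k. \<bar>c (Suc k) - c k\<bar> \<le> K * (p k - p (Suc k))" and p: "p \<longlonglongrightarrow> q"
  shows "convergent c"
proof -
  have "summable (\<lambda>k. K * (p k - p (Suc k)))"
    using telescope_summable'[OF p] by (intro summable_mult)
  hence "summable (\<lambda>k. c (Suc k) - c k)"
    by (rule summable_comparison_test[rotated]) (use le in auto)
  hence "convergent (\<lambda>n. \<Sum>k<n. c (Suc k) - c k)" by (simp add: summable_iff_convergent)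
  hence "convergent (\<lambda>n. (c n - c 0) + c 0)"
    unfolding sum_lessThan_telescope by (intro convergent_add convergent_const)
  thus ?thesis by simp
qed

context barnes_double_gamma
begin

lemma tendsto_Polygamma_1_multiples: "(\<lambda>k. Polygamma 1 (real k * \<tau>)) \<longlonglongrightarrow> 0"
  by (rule filterlim_compose[OF Polygamma_1_at_top]) (use filterlim_tendsto_pos_mult_at_top[OF tendsto_const \<tau> filterlim_real_sequentially] in \<open>simp add: mult.commute\<close>)

text \<open>As \<open>lim\<close> is only meaningful for a convergent sequence, convergence has to
  be shown before the constant can be used. The increment of the sequence is the error of the
  trapezoidal rule for \<psi> on an interval of length \<tau>.\<close>

lemma tendsto_barnes_C:
  "(\<lambda>k. (\<Sum>j=1..<k. Digamma (of_nat j * T)) + Digamma (of_nat k * T) / 2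
       - 1 / T * (ln_Gamma (of_nat k * T) - of_real (ln (sqrt (2 * pi))))) \<longlonglongrightarrow> barnes_C T"
proof -
  let ?f = "\<lambda>k. (\<Sum>j=1..<k. Digamma (of_nat j * T)) + Digamma (of_nat k * T) / 2
       - 1 / T * (ln_Gamma (of_nat k * T) - of_real (ln (sqrt (2 * pi))))"
  define c where "c = (\<lambda>k. (\<Sum>j=1..<k. Digamma (real j * \<tau>)) + Digamma (real k * \<tau>) / 2
       - 1 / \<tau> * (ln_Gamma (real k * \<tau>) - ln (sqrt (2 * pi))))"
  \<comment> \<open>The shift by one keeps the term k = 0 away, where the argument k \<tau> is a
    pole of \<psi>.\<close>
  have "convergent (\<lambda>k. c (Suc k))"
  proof (rule convergent_of_telescoping_bound[OF _ LIMSEQ_Suc[OF tendsto_Polygamma_1_multiples]])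
    fix k
    have e: "real (Suc (Suc k)) * \<tau> = real (Suc k) * \<tau> + \<tau>" by (simp add: algebra_simps)
    have "c (Suc (Suc k)) - c (Suc k) = (Digamma (real (Suc k) * \<tau>) + Digamma (real (Suc (Suc k)) * \<tau>)) / 2
        - (ln_Gamma (real (Suc (Suc k)) * \<tau>) - ln_Gamma (real (Suc k) * \<tau>)) / \<tau>"
      unfolding c_def using \<tau> by (simp add: diff_divide_distrib add_divide_distrib del: of_nat_Suc)
    thus "\<bar>c (Suc (Suc k)) - c (Suc k)\<bar> \<le> \<tau> * (Polygamma 1 (real (Suc k) * \<tau>) - Polygamma 1 (real (Suc (Suc k)) * \<tau>))"
      unfolding e using trapezoid_Digamma[of "real (Suc k) * \<tau>" \<tau>] \<tau> by (simp del: of_nat_Suc)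
  qed
  hence "convergent c" by (subst (asm) convergent_Suc_iff)
  then obtain L where L: "c \<longlonglongrightarrow> L" by (auto simp: convergent_def)
  have e: "of_nat j * T = of_real (real j * \<tau>)" for j by simp
  have fk: "?f k = of_real (c k)" if "k \<ge> 1" for k
    unfolding e using \<tau> that
    by (simp add: c_def Polygamma_of_real ln_Gamma_complex_of_real del: of_real_mult)
  have "eventually (\<lambda>k. of_real (c k) = ?f k) sequentially"
    using eventually_ge_at_top[of "1::nat"] by eventually_elim (rule fk [symmetric])
  with tendsto_of_real[OF L] have lim: "?f \<longlonglongrightarrow> of_real L" by (rule Lim_transform_eventually)
  have "barnes_C T = of_real L"
    unfolding barnes_C_def by (rule limI[OF lim])
  thus ?thesis using lim by (simp only:)
qed

lemma tendsto_barnes_D: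
  "(\<lambda>k. (\<Sum>j=1..<k. Polygamma 1 (of_nat j * T)) + Polygamma 1 (of_nat k * T) / 2
       - 1 / T * Digamma (of_nat k * T)) \<longlonglongrightarrow> barnes_D T"
proof -
  let ?f = "\<lambda>k. (\<Sum>j=1..<k. Polygamma 1 (of_nat j * T)) + Polygamma 1 (of_nat k * T) / 2
       - 1 / T * Digamma (of_nat k * T)"
  define c where "c = (\<lambda>k. (\<Sum>j=1..<k. Polygamma 1 (real j * \<tau>)) + Polygamma 1 (real k * \<tau>) / 2
       - 1 / \<tau> * Digamma (real k * \<tau>))"
  have "convergent (\<lambda>k. c (Suc k))"
  proof (rule convergent_of_telescoping_bound[OF _ LIMSEQ_Suc[OF tendsto_Polygamma_1_multiples]])
    fix k
    have e: "real (Suc (Suc k)) * \<tau> = real (Suc k) * \<tau> + \<tau>" by (simp add: algebra_simps)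
    have "c (Suc (Suc k)) - c (Suc k) = (Polygamma 1 (real (Suc k) * \<tau>) + Polygamma 1 (real (Suc (Suc k)) * \<tau>)) / 2
        - (Digamma (real (Suc (Suc k)) * \<tau>) - Digamma (real (Suc k) * \<tau>)) / \<tau>"
      unfolding c_def using \<tau> by (simp add: diff_divide_distrib add_divide_distrib del: of_nat_Suc)
    thus "\<bar>c (Suc (Suc k)) - c (Suc k)\<bar> \<le> 1 * (Polygamma 1 (real (Suc k) * \<tau>) - Polygamma 1 (real (Suc (Suc k)) * \<tau>))"
      unfolding e using trapezoid_Polygamma_1[of "real (Suc k) * \<tau>" \<tau>] \<tau> by (simp del: of_nat_Suc)
  qed
  hence "convergent c" by (subst (asm) convergent_Suc_iff)
  then obtain L where L: "c \<longlonglongrightarrow> L" by (auto simp: convergent_def)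
  have e: "of_nat j * T = of_real (real j * \<tau>)" for j by simp
  have fk: "?f k = of_real (c k)" if "k \<ge> 1" for k
    unfolding e using \<tau> that
    by (simp add: c_def Polygamma_of_real del: of_real_mult)
  have "eventually (\<lambda>k. of_real (c k) = ?f k) sequentially"
    using eventually_ge_at_top[of "1::nat"] by eventually_elim (rule fk [symmetric])
  with tendsto_of_real[OF L] have lim: "?f \<longlonglongrightarrow> of_real L" by (rule Lim_transform_eventually)
  have "barnes_D T = of_real L"
    unfolding barnes_D_def by (rule limI[OF lim])
  thus ?thesis using lim by (simp only:)
qed

section \<open>The shift equation from the rows\<close>

text \<open>The row k = 0 lacks the point l = 0; what is left of it, 1, 2, 3, ..., is a full row
  starting at x = 1. The boxes send l to infinity before k.\<close>

lemma tendsto_barnes_rows: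
  "(\<lambda>N. barnes_row 1 z * (\<Prod>k=1..<N. barnes_row (of_nat k * T) z)) \<longlonglongrightarrow> barnes_P \<tau> z"
proof -
  define B :: "nat \<Rightarrow> nat \<Rightarrow> (nat \<times> nat) set"
    where "B = (\<lambda>N M. {0} \<times> Suc ` {..<M} \<union> {1..<N} \<times> {..<M})"
  define f where "f = (\<lambda>i. barnes_factor (z / of_real (lat i)))"
  show ?thesis
  proof (rule tendsto_prod_iterated[where f = f and B = B])
    show "((\<lambda>F. \<Prod>i\<in>F. f i) \<longlongrightarrow> barnes_P \<tau> z) (finite_subsets_at_top (UNIV - {(0, 0)}))"
      unfolding f_def by (rule tendsto_barnes_P)
    show "finite (B N M)" "B N M \<subseteq> UNIV - {(0, 0)}" for N M by (auto simp: B_def)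
    fix F :: "(nat \<times> nat) set" assume F: "finite F" "F \<subseteq> UNIV - {(0, 0)}"
    obtain m where m: "\<And>k l. (k, l) \<in> F \<Longrightarrow> k < m \<and> l < m"
    proof -
      have "finite (fst ` F \<union> snd ` F)" using F by auto
      then obtain m where "\<forall>x\<in>fst ` F \<union> snd ` F. x < m" 
        using finite_nat_set_iff_bounded by blast
      thus thesis using that[of m] by (metis UnCI fst_conv image_eqI snd_conv)
    qed
    have "F \<subseteq> B N M" if "N \<ge> m" "M \<ge> m" for N M
    proof
      fix i assume i: "i \<in> F"
      obtain k l where kl: "i = (k, l)" by (cases i)
      with m i that have "k < N" "l < M" by force+
      thus "i \<in> B N M" using kl i F by (cases k; cases l) (auto simp: B_def)
    qed
    thus "\<exists>N0. \<forall>N\<ge>N0. \<exists>M0. \<forall>M\<ge>M0. F \<subseteq> B N M" by blast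
  next
    fix N
    have "(\<Prod>i\<in>B N M. f i) = (\<Prod>l<M. barnes_factor (z / (1 + of_nat l))) *
        (\<Prod>k=1..<N. \<Prod>l<M. barnes_factor (z / (of_nat k * T + of_nat l)))" for M
    proof -
      have "(\<Prod>i\<in>B N M. f i) = (\<Prod>i\<in>{0} \<times> Suc ` {..<M}. f i) * (\<Prod>i\<in>{1..<N} \<times> {..<M}. f i)"
        unfolding B_def by (rule prod.union_disjoint) auto
      also have "(\<Prod>i\<in>{0} \<times> Suc ` {..<M}. f i) = (\<Prod>l<M. f (0, Suc l))"
        by (rule prod.reindex_bij_witness[of _ "\<lambda>l. (0, Suc l)" "\<lambda>i. snd i - 1"]) auto
      also have "(\<Prod>i\<in>{1..<N} \<times> {..<M}. f i) = (\<Prod>k=1..<N. \<Prod>l<M. f (k, l))"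
        by (simp add: prod.cartesian_product)
      finally show ?thesis by (simp add: f_def barnes_lattice_def)
    qed
    moreover have "(\<lambda>M. (\<Prod>l<M. barnes_factor (z / (1 + of_nat l))) *
        (\<Prod>k=1..<N. \<Prod>l<M. barnes_factor (z / (of_nat k * T + of_nat l)))) \<longlonglongrightarrow>
         barnes_row 1 z * (\<Prod>k=1..<N. barnes_row (of_nat k * T) z)"
    proof (intro tendsto_mult tendsto_prod tendsto_barnes_row)
      fix k assume "k \<in> {1..<N}"
      hence "real k * \<tau> > 0" using \<tau> by simp
      hence "real k * \<tau> \<notin> \<int>\<^sub>\<le>\<^sub>0" by (auto elim!: nonpos_Ints_cases)
      hence "complex_of_real (real k * \<tau>) \<notin> \<int>\<^sub>\<le>\<^sub>0" by (subst of_real_in_nonpos_Ints_iff)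
      thus "of_nat k * T \<notin> \<int>\<^sub>\<le>\<^sub>0" by simp
    qed auto
    ultimately show "(\<lambda>M. \<Prod>i\<in>B N M. f i) \<longlonglongrightarrow> barnes_row 1 z * (\<Prod>k=1..<N. barnes_row (of_nat k * T) z)"
      by simp
  qed
qed

text \<open>Consecutive partial products of a product with nonzero limit have quotient tending to 1,
  and this quotient is the newest row. It takes the place of Stirling's formula for \<Gamma> (N
  \<tau> + z) / \<Gamma> (N \<tau>).\<close>

lemma tendsto_barnes_row_multiples:
  assumes "barnes_G T z \<noteq> 0"
  shows "(\<lambda>N. barnes_row (of_nat N * T) z) \<longlonglongrightarrow> 1"
proof -
  define p where "p = (\<lambda>N. barnes_row 1 z * (\<Prod>k=1..<N. barnes_row (of_nat k * T) z))"
  have P: "barnes_P \<tau> z \<noteq> 0" using assms by (auto simp: barnes_G_eq_P)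
  have p: "p \<longlonglongrightarrow> barnes_P \<tau> z" unfolding p_def by (rule tendsto_barnes_rows)
  have "(\<lambda>N. p (Suc N) / p N) \<longlonglongrightarrow> barnes_P \<tau> z / barnes_P \<tau> z"
    by (intro tendsto_divide LIMSEQ_Suc p P)
  moreover have "eventually (\<lambda>N. p (Suc N) / p N = barnes_row (of_nat N * T) z) sequentially"
    using tendsto_imp_eventually_ne[OF p P] eventually_ge_at_top[of "1::nat"]
    by eventually_elim (auto simp: p_def)
  ultimately show ?thesis using P by (simp add: Lim_transform_eventually)
qed

text \<open>Replacing z by z + \<tau> turns the Gamma factor of row k into that of row k + 1, so the
  product of rows telescopes. The remaining sums of \<psi> (k \<tau>) and \<psi>' (k \<tau>) are
  precisely those regularised in \<open>barnes_C\<close> and \<open>barnes_D\<close>.\<close>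

lemma barnes_G_shift:
  assumes nz: "barnes_G T z \<noteq> 0"
  shows "barnes_G T (z + T) = exp ((T - 1) / 2 * of_real (ln (2 * pi)) + (1 / 2 - z) * of_real (ln \<tau>)) * Gamma z * barnes_G T z"
proof -
  have z: "z \<noteq> - of_real (lat i)" for i using nz barnes_G_eq_0_iff by blast
  \<comment> \<open>A pole of \<Gamma> at k \<tau> + z would put z at a point -k \<tau> - n, hence
    among the zeros of G.\<close>
  have zpole: "of_nat k * T + z \<notin> \<int>\<^sub>\<le>\<^sub>0" for k
  proof
    assume "of_nat k * T + z \<in> \<int>\<^sub>\<le>\<^sub>0"
    then obtain n where n: "of_nat k * T + z = - of_nat n" by (auto elim!: nonpos_Ints_cases')
    have "z = (of_nat k * T + z) - of_nat k * T" by simp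
    also have "\<dots> = - of_real (lat (k, n))"
      unfolding n by (simp add: barnes_lattice_def)
    finally have "z = - of_real (lat (k, n))" .
    thus False using z by blast
  qed
  have rz: "rGamma (of_nat k * T + z) \<noteq> 0" for k using zpole[of k] by (simp add: rGamma_eq_zero_iff)
  have z0: "z \<noteq> 0" "rGamma z \<noteq> 0" using zpole[of 0] rz[of 0] by auto
  have zT: "z + T \<noteq> 0" using zpole[of 1] by (auto simp: add.commute)
  have P: "barnes_P \<tau> z \<noteq> 0" using nz by (auto simp: barnes_G_eq_P)
  define \<psi> \<psi>' L where "\<psi> = (\<lambda>k::nat. Digamma (of_nat k * T))" and "\<psi>' = (\<lambda>k::nat. Polygamma 1 (of_nat k * T))"
    and "L = (\<lambda>k::nat. ln_Gamma (of_nat k * T))"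
  define p where "p = (\<lambda>N z. barnes_row 1 z * (\<Prod>k=1..<N. barnes_row (of_nat k * T) z))"
  have plim: "(\<lambda>N. p N z) \<longlonglongrightarrow> barnes_P \<tau> z" for z unfolding p_def by (rule tendsto_barnes_rows)
  define c where "c = (\<lambda>k. (\<Sum>j=1..<k. \<psi> j) + \<psi> k / 2 - 1 / T * (L k - of_real (ln (sqrt (2 * pi)))))"
  define d where "d = (\<lambda>k. (\<Sum>j=1..<k. \<psi>' j) + \<psi>' k / 2 - 1 / T * \<psi> k)"
  have c: "c \<longlonglongrightarrow> barnes_C T" and d: "d \<longlonglongrightarrow> barnes_D T"
    unfolding c_def d_def \<psi>_def \<psi>'_def L_def by (rule tendsto_barnes_C tendsto_barnes_D)+
  define r where "r = (\<lambda>N. barnes_row (of_nat N * T) z)"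
  have r: "r \<longlonglongrightarrow> 1" unfolding r_def by (rule tendsto_barnes_row_multiples[OF nz])
  have \<psi>'0: "\<psi>' \<longlonglongrightarrow> 0"
  proof -
    have "(\<lambda>k. complex_of_real (Polygamma 1 (real k * \<tau>))) \<longlonglongrightarrow> of_real 0"
      by (intro tendsto_of_real tendsto_Polygamma_1_multiples)
    moreover have "eventually (\<lambda>k. complex_of_real (Polygamma 1 (real k * \<tau>)) = \<psi>' k) sequentially"
      using eventually_gt_at_top[of 0]
    proof eventually_elim
      case (elim k)
      have "of_nat k * T = of_real (real k * \<tau>)" by simp
      thus ?case using elim \<tau> unfolding \<psi>'_def by (simp add: Polygamma_of_real del: of_real_mult)
    qed
    ultimately show ?thesis by (simp add: Lim_transform_eventually)
  qed
  \<comment> \<open>The exponent that survives the limit, before simplification: the terms with log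
    \<tau> and log (2 \<pi> \<tau>) come from \<open>barnes_a\<close> and \<open>barnes_b\<close>,
    and the term with the root of 2 \<pi> from the normalisation inside
    \<open>barnes_C\<close>.\<close>
  define E where "E = T / 2 * of_real (ln (2 * pi * \<tau>)) + of_real (ln \<tau>) / 2 - z * of_real (ln \<tau>) - T / 2 * of_real (ln \<tau>)
     - of_real (ln (sqrt (2 * pi)))"
  \<comment> \<open>\<open>q\<close> is the increment of z^2 / 2 under the shift by \<tau>;
    \<open>w\<close> is the increment of the exponent in front of the double product.\<close>
  define q where "q = (2 * z * T + T ^ 2) / 2"
  define w where "w = barnes_a T + barnes_b T * (2 * z + T) / (2 * T)"
  have T0: "T \<noteq> 0" using \<tau> by simp
  have lnT: "ln T = of_real (ln \<tau>)" "ln (2 * of_real pi * T) = of_real (ln (2 * pi * \<tau>))"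
    using Ln_of_real[of \<tau>] Ln_of_real[of "2 * pi * \<tau>"] \<tau> by auto
  have Gpos: "Gamma (of_nat k * T) = exp (L k)" if "k \<ge> 1" for k
  proof -
    have e: "of_nat k * T = of_real (real k * \<tau>)" by simp
    have "real k * \<tau> > 0" using that \<tau> by simp
    thus ?thesis
      unfolding L_def e by (simp only: Gamma_complex_of_real ln_Gamma_complex_of_real Gamma_real_pos_exp exp_of_real)
  qed
  \<comment> \<open>An exact identity for each finite N. Everything that depends on N, apart from
    \<open>p N z\<close>, is collected in the last bracket, which tends to 1.\<close>
  have ratio: "exp w * p N (z + T) = z / (z + T) * Gamma z * exp E * p N z *
      (r N * exp (- (z ^ 2) / 2 * \<psi>' N) * exp (T * (c N - barnes_C T) + q * (d N - barnes_D T) - q / 2 * \<psi>' N))"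
    if N: "N \<ge> 1" for N
  proof -
    \<comment> \<open>The telescoping itself: only the new last factor at N \<tau> + z and the lost
      first factor at \<tau> + z remain.\<close>
    have tele: "(\<Prod>k=1..<N. rGamma (of_nat k * T + (z + T))) = (\<Prod>k=1..<N. rGamma (of_nat k * T + z)) * rGamma (of_nat N * T + z) / rGamma (T + z)"
      using N
    proof (induction N rule: nat_induct_at_least)
      case base
      show ?case using rz[of 1] by simp
    next
      case (Suc n)
      have e: "of_nat n * T + (z + T) = of_nat (Suc n) * T + z"
        by (simp add: algebra_simps)
      have s1: "(\<Prod>k=1..<Suc n. f k) = (\<Prod>k=1..<n. f k) * f n" for f :: "nat \<Rightarrow> complex"
        using Suc.hyps by simp
      show ?case unfolding s1 Suc.IH e by (simp only: times_divide_eq_left times_divide_eq_right mult_ac)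
    qed
    have row: "barnes_row x (z + T) = rGamma (x + (z + T)) * Gamma x *
         (exp (z * Digamma x + z ^ 2 / 2 * Polygamma 1 x) * exp (T * Digamma x + q * Polygamma 1 x))" for x
    proof -
      have "(z + T) * A + (z + T) ^ 2 / 2 * B =
          (z * A + z ^ 2 / 2 * B) + (T * A + q * B)" for A B
        unfolding q_def by (simp add: power2_eq_square field_simps)
      thus ?thesis unfolding barnes_row_def exp_add [symmetric] by (simp only:)
    qed
    have "(\<Prod>k=1..<N. barnes_row (of_nat k * T) (z + T)) = 
        (\<Prod>k=1..<N. rGamma (of_nat k * T + (z + T))) * (\<Prod>k=1..<N. Gamma (of_nat k * T)) *
        (\<Prod>k=1..<N. exp (z * \<psi> k + z ^ 2 / 2 * \<psi>' k)) * (\<Prod>k=1..<N. exp (T * \<psi> k + q * \<psi>' k))"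
      unfolding row prod.distrib \<psi>_def \<psi>'_def by (simp add: mult_ac)
    also have "\<dots> = (\<Prod>k=1..<N. barnes_row (of_nat k * T) z) * rGamma (of_nat N * T + z) / rGamma (T + z) * 
         (\<Prod>k=1..<N. exp (T * \<psi> k + q * \<psi>' k))"
      unfolding tele barnes_row_def prod.distrib \<psi>_def \<psi>'_def by (simp add: mult_ac)
    also have "(\<Prod>k=1..<N. exp (T * \<psi> k + q * \<psi>' k)) = exp (T * (\<Sum>k=1..<N. \<psi> k) + q * (\<Sum>k=1..<N. \<psi>' k))"
      unfolding sum_distrib_left sum.distrib [symmetric] by (rule exp_sum [symmetric]) simp
    finally have rows: "(\<Prod>k=1..<N. barnes_row (of_nat k * T) (z + T)) =
        (\<Prod>k=1..<N. barnes_row (of_nat k * T) z) * rGamma (of_nat N * T + z) / rGamma (T + z) * 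
        exp (T * (\<Sum>k=1..<N. \<psi> k) + q * (\<Sum>k=1..<N. \<psi>' k))" .
    have g1: "rGamma (1 + (z + T)) = rGamma (T + z) / (z + T)" "rGamma (1 + z) = rGamma z / z"
      using rGamma_plus1[of "z + T"] rGamma_plus1[of z] zT z0 by (simp_all add: field_simps)
    have row1: "barnes_row 1 (z + T) = barnes_row 1 z * (z / (z + T)) * (rGamma (T + z) / rGamma z) *
        exp (T * Digamma 1 + q * Polygamma 1 1)"
    proof -
      have alg: "(a / y) * G * (e * f) = (b / z * G * e) * (z / y) * (a / b) * f" if "b \<noteq> 0" for a b y G e f
        using z0 that by (cases "y = 0") (simp_all add: field_simps)
      show ?thesis unfolding row[of 1] unfolding barnes_row_def g1 by (rule alg[OF z0(2)])
    qed
    have pN: "p N (z + T) = z / (z + T) * Gamma z * p N z * rGamma (of_nat N * T + z) *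
        exp (T * Digamma 1 + q * Polygamma 1 1 + (T * (\<Sum>k=1..<N. \<psi> k) + q * (\<Sum>k=1..<N. \<psi>' k)))"
    proof -
      have alg: "u * (z / y) * (a / b) * E1 * (P * r / a * E2) = z / y * inverse b * (u * P) * r * (E1 * E2)"
        if "a \<noteq> 0" for u y a b E1 P r E2
        using that by (simp add: divide_inverse)
      show ?thesis
        unfolding p_def row1 rows Gamma_def exp_add[of "T * Digamma 1 + q * Polygamma 1 1"]
        by (rule alg) (use rz[of 1] in simp)
    qed
    \<comment> \<open>The new last factor is traded for the row \<open>r N\<close>, which tends to
      1, times elementary exponentials.\<close>
    have rGeq: "rGamma (of_nat N * T + z) = r N * exp (- (z ^ 2) / 2 * \<psi>' N) * exp (- L N - z * \<psi> N)"
    proof -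
      have rN: "r N = rGamma (of_nat N * T + z) * exp (L N) * exp (z * \<psi> N + z ^ 2 / 2 * \<psi>' N)"
        unfolding r_def barnes_row_def Gpos[OF N] \<psi>_def \<psi>'_def ..
      have "exp (L N) * (exp (z * \<psi> N + z ^ 2 / 2 * \<psi>' N) * (exp (- (z ^ 2) / 2 * \<psi>' N) * exp (- L N - z * \<psi> N))) = 1"
        unfolding exp_add [symmetric] by (simp add: field_simps)
      thus ?thesis unfolding rN mult.assoc by simp
    qed
    have ew: "exp (w - L N - z * \<psi> N) = exp w * exp (- L N - z * \<psi> N)"
      unfolding exp_add [symmetric] by (simp add: algebra_simps)
    have "exp w * p N (z + T) = z / (z + T) * Gamma z * p N z * (r N * exp (- (z ^ 2) / 2 * \<psi>' N)) *
       exp (w - L N - z * \<psi> N + (T * Digamma 1 + q * Polygamma 1 1 + (T * (\<Sum>k=1..<N. \<psi> k) + q * (\<Sum>k=1..<N. \<psi>' k))))"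
      unfolding pN rGeq exp_add[of "w - L N - z * \<psi> N"] ew by (simp only: mult_ac)
    \<comment> \<open>All unbounded terms cancel: L N occurs with coefficients -1 and 1, and \<psi>
      N with -z - \<tau>/2 + q/\<tau> = 0. The values of \<psi> and \<psi>' at 1 remove the Euler
      constant from \<open>barnes_a\<close> and \<pi>^2/6 from \<open>barnes_b\<close>.\<close>
    also have "w - L N - z * \<psi> N + (T * Digamma 1 + q * Polygamma 1 1 + (T * (\<Sum>k=1..<N. \<psi> k) + q * (\<Sum>k=1..<N. \<psi>' k)))
       = E + (T * (c N - barnes_C T) + q * (d N - barnes_D T) - q / 2 * \<psi>' N)"
    proof -
      have p1: "Digamma (1::complex) = - euler_mascheroni" by (rule Digamma_1)
      have p2: "Polygamma 1 (1::complex) = of_real pi ^ 2 / 6"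
      proof -
        have "(\<lambda>n. complex_of_real (1 / real ((n + 1) ^ 2))) sums of_real (pi ^ 2 / 6)"
          by (rule sums_of_real[OF inverse_squares_sums])
        moreover have "complex_of_real (1 / real ((n + 1) ^ 2)) = inverse ((1 + of_nat n) ^ 2)" for n
          by (simp add: inverse_eq_divide add.commute)
        ultimately show ?thesis 
          by (simp add: Polygamma_def numeral_2_eq_2 sums_iff)
      qed
      have s1: "(\<Sum>k=1..<N. \<psi> k) = c N - \<psi> N / 2 + 1 / T * (L N - of_real (ln (sqrt (2 * pi))))"
        by (simp add: c_def)
      have s2: "(\<Sum>k=1..<N. \<psi>' k) = d N - \<psi>' N / 2 + 1 / T * \<psi> N" by (simp add: d_def)
      show ?thesis
        unfolding s1 s2 p1 p2 w_def barnes_a_def barnes_b_def lnT E_def q_def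
        using T0 by (simp add: field_simps power2_eq_square)
    qed
    finally show ?thesis by (simp add: exp_add mult_ac)
  qed
  have "(\<lambda>N. z / (z + T) * Gamma z * exp E * p N z *
      (r N * exp (- (z ^ 2) / 2 * \<psi>' N) * exp (T * (c N - barnes_C T) + q * (d N - barnes_D T) - q / 2 * \<psi>' N)))
     \<longlonglongrightarrow> z / (z + T) * Gamma z * exp E * barnes_P \<tau> z *
      (1 * exp (- (z ^ 2) / 2 * 0) * exp (T * (barnes_C T - barnes_C T) + q * (barnes_D T - barnes_D T) - q / 2 * 0))"
    by (intro tendsto_intros plim r \<psi>'0 c d)
  moreover have "eventually (\<lambda>N. z / (z + T) * Gamma z * exp E * p N z *
      (r N * exp (- (z ^ 2) / 2 * \<psi>' N) * exp (T * (c N - barnes_C T) + q * (d N - barnes_D T) - q / 2 * \<psi>' N))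
      = exp w * p N (z + T)) sequentially"
    using eventually_ge_at_top[of "1::nat"] by eventually_elim (use ratio in simp)
  ultimately have "(\<lambda>N. exp w * p N (z + T)) \<longlonglongrightarrow> z / (z + T) * Gamma z * exp E * barnes_P \<tau> z"
    by (simp add: Lim_transform_eventually)
  moreover have "(\<lambda>N. exp w * p N (z + T)) \<longlonglongrightarrow> exp w * barnes_P \<tau> (z + T)"
    by (intro tendsto_intros plim)
  ultimately have eq: "exp w * barnes_P \<tau> (z + T) = z / (z + T) * Gamma z * exp E * barnes_P \<tau> z"
    using LIMSEQ_unique by blast
  define v where "v = barnes_a T * (z / T) + barnes_b T * (z ^ 2 / (2 * T ^ 2))"
  have v: "barnes_a T * ((z + T) / T) + barnes_b T * ((z + T) ^ 2 / (2 * T ^ 2)) = v + w"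
    unfolding v_def w_def using T0 by (simp add: field_simps power2_eq_square)
  have "barnes_G T (z + T) = (z + T) / T * exp v * (exp w * barnes_P \<tau> (z + T))"
    unfolding barnes_G_eq_P v exp_add by simp
  also have "\<dots> = exp E * Gamma z * (z / T * exp v * barnes_P \<tau> z)"
    unfolding eq using zT by simp
  also have "z / T * exp v * barnes_P \<tau> z = barnes_G T z"
    unfolding barnes_G_eq_P v_def ..
  also have "E = (T - 1) / 2 * of_real (ln (2 * pi)) + (1 / 2 - z) * of_real (ln \<tau>)"
    unfolding E_def using \<tau> by (simp add: ln_mult ln_sqrt field_simps)
  finally show ?thesis .
qed

text \<open>Shift at s and at 1 - s: the exponents 1/2 - s and 1/2 - (1 - s) of \<tau> add up to 0,
  and the two Gamma factors combine by Euler's reflection formula.\<close>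

lemma barnes_G_reflection:
  assumes "barnes_G T s \<noteq> 0" "barnes_G T (1 - s) \<noteq> 0"
  shows "barnes_G T (T + s) * barnes_G T (1 + T - s) =
     of_real (2 * pi) powr (T - 1) * (of_real pi / sin (of_real pi * s)) * (barnes_G T s * barnes_G T (1 - s))"
proof -
  have e: "s + T = T + s" "1 - s + T = 1 + T - s" by simp_all
  have "barnes_G T (T + s) * barnes_G T (1 + T - s) = 
     (exp ((T - 1) / 2 * of_real (ln (2 * pi)) + (1 / 2 - s) * of_real (ln \<tau>)) * 
      exp ((T - 1) / 2 * of_real (ln (2 * pi)) + (1 / 2 - (1 - s)) * of_real (ln \<tau>))) * 
      (Gamma s * Gamma (1 - s)) * (barnes_G T s * barnes_G T (1 - s))"
    using barnes_G_shift[OF assms(1)] barnes_G_shift[OF assms(2)] unfolding e by simp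
  also have "Gamma s * Gamma (1 - s) = of_real pi / sin (of_real pi * s)"
    by (rule Gamma_reflection_complex)
  also have "exp ((T - 1) / 2 * of_real (ln (2 * pi)) + (1 / 2 - s) * of_real (ln \<tau>)) * 
      exp ((T - 1) / 2 * of_real (ln (2 * pi)) + (1 / 2 - (1 - s)) * of_real (ln \<tau>)) = of_real (2 * pi) powr (T - 1)"
  proof -
    have "(c - 1) / 2 * u + (1 / 2 - s) * v + ((c - 1) / 2 * u + (1 / 2 - (1 - s)) * v) = (c - 1) * u" for c u v :: complex
      by (simp add: field_simps)
    moreover have "ln (complex_of_real (2 * pi)) = of_real (ln (2 * pi))"
      by (rule Ln_of_real) simp
    ultimately show ?thesis unfolding exp_add [symmetric] powr_def by simp
  qed
  finally show ?thesis .
qed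

end

section \<open>Growth of quotients\<close>

lemma norm_add_of_real_ge:
  fixes q :: complex
  assumes "Re q \<ge> 0" "c \<ge> 0"
  shows "norm (q + of_real c) \<ge> norm q"
proof -
  have "(Re q)\<^sup>2 \<le> (Re q + c)\<^sup>2" using assms by (intro power_mono) auto
  thus ?thesis by (simp add: cmod_def)
qed

text \<open>The remainder is the explicit fraction c^2 (3 q + 2 c) / (q^3 (q + c)^2); since c \<ge>
  0 moves q away from the origin, it is controlled by |q| alone.\<close>

lemma inverse_square_expansion:
  fixes q :: complex
  assumes q: "Re q > 0" and c: "c \<ge> 0"
  shows "norm (1 / (q + of_real c) ^ 2 - 1 / q ^ 2 + 2 * of_real c / q ^ 3) \<le> 3 * c ^ 2 / norm q ^ 4"
proof -
  have m: "norm (q + of_real c) \<ge> norm q" by (rule norm_add_of_real_ge) (use q c in auto)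
  have nz: "q \<noteq> 0" "q + of_real c \<noteq> 0" using q c by (auto simp: complex_eq_iff)
  have n3: "norm (3 * q + 2 * of_real c) \<le> 3 * norm (q + of_real c)"
  proof -
    have "3 * q + 2 * of_real c = 2 * (q + of_real c) + q" by simp
    also have "norm \<dots> \<le> norm (2 * (q + of_real c)) + norm q" by (rule norm_triangle_ineq)
    also have "norm (2 * (q + of_real c)) = 2 * norm (q + of_real c)" by (simp only: norm_mult norm_numeral)
    finally show ?thesis using m by simp
  qed
  have "1 / (q + of_real c) ^ 2 - 1 / q ^ 2 + 2 * of_real c / q ^ 3 =
      of_real c ^ 2 * (3 * q + 2 * of_real c) / (q ^ 3 * (q + of_real c) ^ 2)"
    using nz by (simp add: divide_simps) (simp add: power2_eq_square power3_eq_cube algebra_simps)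
  also have "norm \<dots> = c ^ 2 * norm (3 * q + 2 * of_real c) / (norm q ^ 3 * norm (q + of_real c) ^ 2)"
    using c by (simp add: norm_mult norm_divide norm_power)
  also have "\<dots> \<le> c ^ 2 * (3 * norm (q + of_real c)) / (norm q ^ 3 * norm (q + of_real c) ^ 2)"
    using n3 by (intro divide_right_mono mult_left_mono) auto
  also have "\<dots> = 3 * c ^ 2 / (norm q ^ 3 * norm (q + of_real c))"
    using nz by (simp add: power2_eq_square)
  also have "\<dots> \<le> 3 * c ^ 2 / (norm q ^ 3 * norm q)"
    using nz m by (intro divide_left_mono mult_left_mono mult_pos_pos) auto
  also have "norm q ^ 3 * norm q = norm q ^ 4" by (simp add: power_numeral_reduce)
  finally show ?thesis .
qed

lemma inverse_expansion:
  fixes q :: complex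
  assumes q: "Re q > 0" and c: "c \<ge> 0"
  shows "norm (1 / (q + of_real c) - (1 / q - of_real c / q ^ 2 + of_real c ^ 2 / q ^ 3)) \<le> c ^ 3 / norm q ^ 4"
proof -
  have m: "norm (q + of_real c) \<ge> norm q" by (rule norm_add_of_real_ge) (use q c in auto)
  have nz: "q \<noteq> 0" "q + of_real c \<noteq> 0" using q c by (auto simp: complex_eq_iff)
  have "1 / (q + of_real c) - (1 / q - of_real c / q ^ 2 + of_real c ^ 2 / q ^ 3) =
      - (of_real c ^ 3 / (q ^ 3 * (q + of_real c)))"
    using nz by (simp add: divide_simps) (simp add: power2_eq_square power3_eq_cube algebra_simps)
  also have "norm \<dots> = c ^ 3 / (norm q ^ 3 * norm (q + of_real c))"
    using c by (simp add: norm_mult norm_divide norm_power)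
  also have "\<dots> \<le> c ^ 3 / (norm q ^ 3 * norm q)"
    using nz m c by (intro divide_left_mono mult_left_mono mult_pos_pos) auto
  also have "norm q ^ 3 * norm q = norm q ^ 4" by (simp add: power_numeral_reduce)
  finally show ?thesis .
qed

text \<open>The mixed second difference of 1/q in the two lattice directions 1 and \<tau>. In its
  expansion the orders 1/q and 1/q^2 cancel, and the coefficient of 1/q^3 is (1 + \<tau>)^2 - 1 -
  \<tau>^2 = 2 \<tau>.\<close>

definition mixed_difference :: "real \<Rightarrow> complex \<Rightarrow> complex" where
  "mixed_difference \<tau> q = 1 / q - 1 / (q + 1) - 1 / (q + of_real \<tau>) + 1 / (q + of_real (1 + \<tau>))"

lemma mixed_difference_expansion:
  fixes q :: complex
  assumes q: "Re q > 0" and \<tau>: "\<tau> > 0"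
  shows "norm (mixed_difference \<tau> q - 2 * of_real \<tau> / q ^ 3) \<le> (1 + \<tau> ^ 3 + (1 + \<tau>) ^ 3) / norm q ^ 4"
proof -
  define r where "r = (\<lambda>c. 1 / (q + of_real c) - (1 / q - of_real c / q ^ 2 + of_real c ^ 2 / q ^ 3))"
  have r: "norm (r c) \<le> c ^ 3 / norm q ^ 4" if "c \<ge> 0" for c
    unfolding r_def by (rule inverse_expansion[OF q that])
  have nz: "q \<noteq> 0" using q by auto
  have "mixed_difference \<tau> q - 2 * of_real \<tau> / q ^ 3 = - r 1 - r \<tau> + r (1 + \<tau>)"
    using nz unfolding mixed_difference_def r_def by (simp add: field_simps power2_eq_square)
  also have "norm \<dots> \<le> norm (r 1) + norm (r \<tau>) + norm (r (1 + \<tau>))"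
    using norm_triangle_ineq[of "- r 1 - r \<tau>" "r (1 + \<tau>)"] norm_triangle_ineq4[of "- r 1" "r \<tau>"] by simp
  also have "\<dots> \<le> 1 ^ 3 / norm q ^ 4 + \<tau> ^ 3 / norm q ^ 4 + (1 + \<tau>) ^ 3 / norm q ^ 4"
    using \<tau> by (intro add_mono r) auto
  finally show ?thesis by (simp add: add_divide_distrib)
qed

definition lattice_box :: "nat \<Rightarrow> (nat \<times> nat) set" where
  "lattice_box n = {..<n} \<times> {..<n}"

lemma finite_lattice_box [simp]: "finite (lattice_box n)"
  by (simp add: lattice_box_def)

lemma sum_lattice_box: "(\<Sum>i\<in>lattice_box n. f i) = (\<Sum>k<n. \<Sum>l<n. f (k, l))"
  by (simp add: lattice_box_def sum.cartesian_product)

context barnes_double_gamma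
begin

text \<open>Telescoping in both directions leaves the four corners of the box.\<close>

lemma sum_mixed_difference:
  "(\<Sum>i\<in>lattice_box n. mixed_difference \<tau> (q + of_real (lat i))) =
     1 / q - 1 / (q + of_nat n) - 1 / (q + of_nat n * of_real \<tau>) + 1 / (q + of_nat n + of_nat n * of_real \<tau>)"
proof -
  define v where "v = (\<lambda>k l. 1 / (q + of_nat k * complex_of_real \<tau> + of_nat l))"
  have "mixed_difference \<tau> (q + of_real (lat (k, l))) = (v k l - v (Suc k) l) - (v k (Suc l) - v (Suc k) (Suc l))" for k l
    by (simp add: mixed_difference_def v_def barnes_lattice_def algebra_simps)
  hence "(\<Sum>i\<in>lattice_box n. mixed_difference \<tau> (q + of_real (lat i))) =
     (\<Sum>k<n. \<Sum>l<n. (v k l - v (Suc k) l) - (v k (Suc l) - v (Suc k) (Suc l)))"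
    by (simp add: sum_lattice_box)
  also have "\<dots> = (\<Sum>k<n. (v k 0 - v (Suc k) 0) - (v k n - v (Suc k) n))"
    by (subst sum_lessThan_telescope') simp
  also have "\<dots> = (\<Sum>k<n. (v k 0 - v k n) - (v (Suc k) 0 - v (Suc k) n))"
    by (simp add: algebra_simps)
  also have "\<dots> = (v 0 0 - v 0 n) - (v n 0 - v n n)"
    by (subst sum_lessThan_telescope') simp
  finally show ?thesis by (simp add: v_def algebra_simps)
qed

text \<open>The fourth power is split as 5/4 + 5/4 + 3/2: the first two parts make the lattice sum
  converge, and the third leaves a negative power of |q| that is integrable along a ray.\<close>

lemma inverse_fourth_lattice_le:
  fixes q :: complex
  assumes q: "Re q \<ge> 1"
  shows "1 / norm (q + of_real (lat i)) ^ 4 \<le>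
     min 1 \<tau> powr (-5/2) * norm q powr (-3/2) * ((1 + real (fst i)) powr (-5/4) * (1 + real (snd i)) powr (-5/4))"
proof -
  define c where "c = min 1 \<tau>"
  have c: "c > 0" "c \<le> 1" using \<tau> by (auto simp: c_def)
  define x y where "x = 1 + real (fst i)" and "y = 1 + real (snd i)"
  have xy: "x \<ge> 1" "y \<ge> 1" by (auto simp: x_def y_def)
  define m where "m = norm (q + of_real (lat i))"
  have mq: "m \<ge> norm q" unfolding m_def
    by (rule norm_add_of_real_ge) (use q barnes_lattice_nonneg in auto)
  have "m \<ge> Re (q + of_real (lat i))" unfolding m_def by (rule complex_Re_le_cmod)
  also have "Re (q + of_real (lat i)) \<ge> 1 + c * (real (fst i) + real (snd i))"
    using q barnes_lattice_ge[of "fst i" "snd i"] by (simp add: c_def)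
  finally have "m \<ge> 1 + c * (real (fst i) + real (snd i))" .
  moreover have "1 + c * (real (fst i) + real (snd i)) \<ge> c * x" "1 + c * (real (fst i) + real (snd i)) \<ge> c * y"
    using c by (auto simp: x_def y_def algebra_simps intro!: add_increasing2)
  ultimately have mx: "m \<ge> c * x" "m \<ge> c * y" by linarith+
  have m1: "m \<ge> 1" and nq: "norm q \<ge> 1" using mq q complex_Re_le_cmod[of q] by linarith+
  have "(c * x) powr (5/4) * (c * y) powr (5/4) * norm q powr (3/2) \<le> m powr (5/4) * m powr (5/4) * m powr (3/2)"
    using mx mq c xy by (intro mult_mono powr_mono2) auto
  also have "\<dots> = m powr 4" by (simp flip: powr_add)
  also have "\<dots> = m ^ 4" using m1 by (simp add: powr_numeral)
  finally have "(c * x) powr (5/4) * (c * y) powr (5/4) * norm q powr (3/2) \<le> m ^ 4" .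
  moreover have "0 < (c * x) powr (5/4) * (c * y) powr (5/4) * norm q powr (3/2)"
  proof -
    have "q \<noteq> 0" "c \<noteq> 0" "x \<noteq> 0" "y \<noteq> 0" using c xy nq by auto
    thus ?thesis by simp
  qed
  ultimately have "1 / m ^ 4 \<le> 1 / ((c * x) powr (5/4) * (c * y) powr (5/4) * norm q powr (3/2))"
    by (intro divide_left_mono mult_pos_pos) auto
  also have "\<dots> = c powr (-5/4) * c powr (-5/4) * norm q powr (-3/2) * (x powr (-5/4) * y powr (-5/4))"
    using c xy by (simp add: powr_minus_divide powr_mult)
  also have "c powr (-5/4) * c powr (-5/4) = c powr (-5/2)" by (simp flip: powr_add)
  finally show ?thesis by (simp add: m_def c_def x_def y_def)
qed

section \<open>Logarithms of the partial products\<close>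

text \<open>\<open>barnes_e1\<close> and \<open>barnes_e2\<close> gather the coefficients of z and
  z^2 in the logarithm of the n-th partial product: those of the prefactor and those of the
  exponentials in the primary factors.\<close>

definition barnes_e1 :: "nat \<Rightarrow> complex" where
  "barnes_e1 n = barnes_a T / of_real \<tau> - (\<Sum>i\<in>lattice_box n - {(0, 0)}. 1 / of_real (lat i))"

definition barnes_e2 :: "nat \<Rightarrow> complex" where
  "barnes_e2 n = barnes_b T / (2 * of_real \<tau> ^ 2) + (\<Sum>i\<in>lattice_box n - {(0, 0)}. 1 / (2 * of_real (lat i) ^ 2))"

text \<open>A logarithm of \<open>barnes_G_partial n\<close> up to a constant independent of z.
  Taking Ln (z + w) instead of Ln (1 + z/w) puts the zero at the origin on the same footing as the
  others.\<close>

definition barnes_log_partial :: "nat \<Rightarrow> complex \<Rightarrow> complex" where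
  "barnes_log_partial n z = barnes_e1 n * z + barnes_e2 n * z ^ 2 + (\<Sum>i\<in>lattice_box n. Ln (z + of_real (lat i)))"

definition barnes_log_partial' :: "nat \<Rightarrow> complex \<Rightarrow> complex" where
  "barnes_log_partial' n z = barnes_e1 n + 2 * barnes_e2 n * z + (\<Sum>i\<in>lattice_box n. 1 / (z + of_real (lat i)))"

definition barnes_log_partial'' :: "nat \<Rightarrow> complex \<Rightarrow> complex" where
  "barnes_log_partial'' n z = 2 * barnes_e2 n - (\<Sum>i\<in>lattice_box n. 1 / (z + of_real (lat i)) ^ 2)"

definition barnes_G_partial :: "nat \<Rightarrow> complex \<Rightarrow> complex" where
  "barnes_G_partial n z = z / of_real \<tau> *
     exp (barnes_a T * (z / of_real \<tau>) + barnes_b T * (z ^ 2 / (2 * of_real \<tau> ^ 2))) *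
     (\<Prod>i\<in>lattice_box n - {(0, 0)}. barnes_factor (z / of_real (lat i)))"

lemma lattice_0 [simp]: "lat (0, 0) = 0"
  by (simp add: barnes_lattice_def)

lemma lattice_add_notin_nonpos_Reals:
  "Re z > 0 \<Longrightarrow> z + of_real (lat i) \<notin> \<real>\<^sub>\<le>\<^sub>0"
  "Re z > 0 \<Longrightarrow> z + of_real (lat i) \<noteq> 0"
proof -
  have *: "x \<notin> \<real>\<^sub>\<le>\<^sub>0 \<and> x \<noteq> 0" if "Re x > 0" for x
    using that by (auto simp: complex_nonpos_Reals_iff)
  assume "Re z > 0"
  hence "Re (z + of_real (lat i)) > 0"
    using barnes_lattice_nonneg[of i] by simp
  thus "z + of_real (lat i) \<notin> \<real>\<^sub>\<le>\<^sub>0" "z + of_real (lat i) \<noteq> 0"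
    using * by blast+
qed

lemma tendsto_barnes_G_partial: "(\<lambda>n. barnes_G_partial n z) \<longlonglongrightarrow> barnes_G T z"
proof -
  have "filterlim (\<lambda>n. lattice_box n - {(0, 0)}) (finite_subsets_at_top (UNIV - {(0, 0)})) sequentially"
  proof (rule filterlim_finite_subsets_at_top[THEN iffD2], intro allI impI)
    fix F :: "(nat \<times> nat) set" assume F: "finite F \<and> F \<subseteq> UNIV - {(0, 0)}"
    have "finite (fst ` F \<union> snd ` F)" using F by auto
    then obtain m where m: "\<forall>x\<in>fst ` F \<union> snd ` F. x < m"
      using finite_nat_set_iff_bounded by blast
    show "eventually (\<lambda>n. finite (lattice_box n - {(0, 0)}) \<and> F \<subseteq> lattice_box n - {(0, 0)} \<and> lattice_box n - {(0, 0)} \<subseteq> UNIV - {(0, 0)}) sequentially"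
      using eventually_ge_at_top[of m]
    proof eventually_elim
      case (elim n)
      have "i \<in> lattice_box n" if "i \<in> F" for i
      proof -
        have "fst i < m" "snd i < m" using m that by auto
        thus ?thesis using elim by (cases i) (simp add: lattice_box_def)
      qed
      thus ?case using F by auto
    qed
  qed
  from filterlim_compose[OF tendsto_barnes_P this] show ?thesis
    unfolding barnes_G_partial_def barnes_G_eq_P by (intro tendsto_intros)
qed

lemma barnes_G_partial_eq_exp:
  assumes n: "n \<ge> 1" and z: "Re z > 0"
  shows "barnes_G_partial n z = (1 / of_real \<tau> * (\<Prod>i\<in>lattice_box n - {(0, 0)}. 1 / of_real (lat i))) * exp (barnes_log_partial n z)"
proof -
  define w where "w = (\<lambda>i. complex_of_real (lat i))"
  define I where "I = lattice_box n - {(0, 0)}"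
  have [simp]: "finite I" by (simp add: I_def)
  have wnz: "w i \<noteq> 0" if "i \<in> I" for i using that barnes_lattice_pos[of i] by (auto simp: w_def I_def)
  have box: "lattice_box n = insert (0, 0) I" using n by (auto simp: I_def lattice_box_def)
  have "(\<Prod>i\<in>I. barnes_factor (z / w i)) =
     (\<Prod>i\<in>I. 1 / w i) * (\<Prod>i\<in>I. z + w i) * (\<Prod>i\<in>I. exp (- (1 / w i) * z + 1 / (2 * w i ^ 2) * z ^ 2))"
    unfolding prod.distrib [symmetric]
  proof (rule prod.cong)
    fix i assume "i \<in> I"
    hence "w i \<noteq> 0" by (rule wnz)
    thus "barnes_factor (z / w i) = 1 / w i * (z + w i) * exp (- (1 / w i) * z + 1 / (2 * w i ^ 2) * z ^ 2)"
      by (simp add: barnes_factor_def power_divide field_simps)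
  qed auto
  also have "(\<Prod>i\<in>I. exp (- (1 / w i) * z + 1 / (2 * w i ^ 2) * z ^ 2)) =
      exp (- (\<Sum>i\<in>I. 1 / w i) * z + (\<Sum>i\<in>I. 1 / (2 * w i ^ 2)) * z ^ 2)"
    by (simp only: exp_sum [symmetric] \<open>finite I\<close> sum.distrib sum_distrib_right sum_negf [symmetric])
  finally have 1: "(\<Prod>i\<in>I. barnes_factor (z / w i)) =
     (\<Prod>i\<in>I. 1 / w i) * (\<Prod>i\<in>I. z + w i) * exp (- (\<Sum>i\<in>I. 1 / w i) * z + (\<Sum>i\<in>I. 1 / (2 * w i ^ 2)) * z ^ 2)" .
  have "exp (\<Sum>i\<in>lattice_box n. Ln (z + w i)) = (\<Prod>i\<in>lattice_box n. z + w i)"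
    unfolding exp_sum[OF finite_lattice_box]
    by (intro prod.cong refl) (use lattice_add_notin_nonpos_Reals[OF z] in \<open>simp add: w_def\<close>)
  also have "\<dots> = z * (\<Prod>i\<in>I. z + w i)"
    unfolding box by (subst prod.insert) (auto simp: w_def I_def)
  finally have 2: "exp (\<Sum>i\<in>lattice_box n. Ln (z + w i)) = z * (\<Prod>i\<in>I. z + w i)" .
  have T0: "complex_of_real \<tau> \<noteq> 0" using \<tau> by simp
  have e: "barnes_a T * (z / of_real \<tau>) + barnes_b T * (z ^ 2 / (2 * of_real \<tau> ^ 2)) +
      (- (\<Sum>i\<in>I. 1 / w i) * z + (\<Sum>i\<in>I. 1 / (2 * w i ^ 2)) * z ^ 2) = barnes_e1 n * z + barnes_e2 n * z ^ 2"
    unfolding barnes_e1_def barnes_e2_def w_def I_def by (simp add: algebra_simps)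
  have "barnes_G_partial n z = z / of_real \<tau> *
     exp (barnes_a T * (z / of_real \<tau>) + barnes_b T * (z ^ 2 / (2 * of_real \<tau> ^ 2))) *
     ((\<Prod>i\<in>I. 1 / w i) * (\<Prod>i\<in>I. z + w i) * exp (- (\<Sum>i\<in>I. 1 / w i) * z + (\<Sum>i\<in>I. 1 / (2 * w i ^ 2)) * z ^ 2))"
    using 1 unfolding barnes_G_partial_def w_def I_def by simp
  also have "\<dots> = (1 / of_real \<tau> * (\<Prod>i\<in>I. 1 / w i)) * ((z * (\<Prod>i\<in>I. z + w i)) *
     exp (barnes_e1 n * z + barnes_e2 n * z ^ 2))"
    unfolding e [symmetric] exp_add by simp
  also have "(z * (\<Prod>i\<in>I. z + w i)) * exp (barnes_e1 n * z + barnes_e2 n * z ^ 2) = exp (barnes_log_partial n z)"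
    unfolding 2 [symmetric] unfolding barnes_log_partial_def w_def exp_add[of "barnes_e1 n * z + barnes_e2 n * z ^ 2"]
    by (rule mult.commute)
  finally show ?thesis by (simp only: w_def I_def)
qed

lemma has_field_derivative_barnes_log_partial:
  "Re z > 0 \<Longrightarrow> (barnes_log_partial n has_field_derivative barnes_log_partial' n z) (at z)"
  unfolding barnes_log_partial_def[abs_def] barnes_log_partial'_def
  by (auto intro!: derivative_eq_intros lattice_add_notin_nonpos_Reals sum.cong simp: divide_inverse)

lemma has_field_derivative_barnes_log_partial':
  assumes "Re z > 0"
  shows "(barnes_log_partial' n has_field_derivative barnes_log_partial'' n z) (at z)"
proof -
  have nz: "z + of_real (lat i) \<noteq> 0" for i by (rule lattice_add_notin_nonpos_Reals[OF assms])
  have "((\<lambda>z. 1 / (z + of_real (lat i))) has_field_derivative - (1 / (z + of_real (lat i)) ^ 2)) (at z)" for i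
    using nz[of i] by (auto intro!: derivative_eq_intros simp: power2_eq_square)
  hence "((\<lambda>z. \<Sum>i\<in>lattice_box n. 1 / (z + of_real (lat i))) has_field_derivative
      (\<Sum>i\<in>lattice_box n. - (1 / (z + of_real (lat i)) ^ 2))) (at z)"
    by (intro DERIV_sum)
  moreover have "((\<lambda>z. barnes_e1 n + 2 * barnes_e2 n * z) has_field_derivative 2 * barnes_e2 n) (at z)"
    by (auto intro!: derivative_eq_intros)
  ultimately have "((\<lambda>z. barnes_e1 n + 2 * barnes_e2 n * z + (\<Sum>i\<in>lattice_box n. 1 / (z + of_real (lat i)))) has_field_derivative
     2 * barnes_e2 n + (\<Sum>i\<in>lattice_box n. - (1 / (z + of_real (lat i)) ^ 2))) (at z)"
    by (intro DERIV_add)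
  thus ?thesis unfolding barnes_log_partial'_def[abs_def] barnes_log_partial''_def by (simp add: sum_negf)
qed

text \<open>The coefficient \<open>barnes_e1 n\<close> and the sum of 1 / (x + w) are not bounded
  separately. Combined for each lattice point they give x^2 / (w^2 (x + w)) \<le> x^2 / w^3, which
  is summable. The bound supplies the initial slope for the integration along rays, uniformly in
  n.\<close>

lemma norm_barnes_log_partial'_bounded:
  assumes x: "x > 0"
  obtains M where "\<And>n. n \<ge> 1 \<Longrightarrow> norm (barnes_log_partial' n (of_real x)) \<le> M"
proof -
  define S where "S = infsum (\<lambda>i. 1 / lat i ^ 3) (UNIV - {(0, 0)})"
  define c where "c = barnes_a T / of_real \<tau> + 2 * (barnes_b T / (2 * of_real \<tau> ^ 2)) * of_real x + 1 / of_real x"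
  have "norm (barnes_log_partial' n (of_real x)) \<le> norm c + x ^ 2 * S" if n: "n \<ge> 1" for n
  proof -
    define I where "I = lattice_box n - {(0, 0)}"
    have [simp]: "finite I" by (simp add: I_def)
    define w where "w = (\<lambda>i. lat i)"
    have w: "w i > 0" if "i \<in> I" for i using that barnes_lattice_pos[of i] by (auto simp: w_def I_def)
    have box: "lattice_box n = insert (0, 0) I" using n by (auto simp: I_def lattice_box_def)
    define t where "t = (\<lambda>i. - (1 / complex_of_real (w i)) + 2 * (1 / (2 * of_real (w i) ^ 2)) * of_real x + 1 / (of_real x + of_real (w i)))"
    have eq: "barnes_log_partial' n (of_real x) = c + (\<Sum>i\<in>I. t i)"
    proof -
      have "(\<Sum>i\<in>lattice_box n. 1 / (complex_of_real x + of_real (w i))) = 1 / of_real x + (\<Sum>i\<in>I. 1 / (complex_of_real x + of_real (w i)))"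
        unfolding box by (subst sum.insert) (auto simp: w_def I_def)
      thus ?thesis
        unfolding barnes_log_partial'_def barnes_e1_def barnes_e2_def c_def t_def sum.distrib sum_negf sum_distrib_left [symmetric] sum_distrib_right [symmetric]
          w_def I_def [symmetric] by (simp add: ring_distribs)
    qed
    have t: "norm (t i) \<le> x ^ 2 * (1 / w i ^ 3)" if "i \<in> I" for i
    proof -
      have wi: "w i > 0" using that by (rule w)
      have "x + w i \<noteq> 0" "w i \<noteq> 0" using wi x by auto
      hence "- (1 / w i) + 2 * (1 / (2 * w i ^ 2)) * x + 1 / (x + w i) = x ^ 2 / (w i ^ 2 * (x + w i))"
        by (simp add: divide_simps) (simp add: power2_eq_square algebra_simps)
      moreover have "t i = of_real (- (1 / w i) + 2 * (1 / (2 * w i ^ 2)) * x + 1 / (x + w i))"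
        by (simp add: t_def)
      ultimately have "norm (t i) = x ^ 2 / (w i ^ 2 * (x + w i))"
        using wi x by (simp only: norm_of_real) (simp add: abs_mult)
      also have "\<dots> \<le> x ^ 2 / (w i ^ 2 * w i)"
        using wi x by (intro divide_left_mono mult_left_mono mult_pos_pos) auto
      also have "\<dots> = x ^ 2 * (1 / w i ^ 3)"
        by (simp add: power2_eq_square power3_eq_cube)
      finally show ?thesis .
    qed
    have "norm (\<Sum>i\<in>I. t i) \<le> (\<Sum>i\<in>I. x ^ 2 * (1 / w i ^ 3))"
      by (rule sum_norm_le) (rule t)
    also have "\<dots> = x ^ 2 * (\<Sum>i\<in>I. 1 / w i ^ 3)"
      by (rule sum_distrib_left [symmetric])
    also have "\<dots> \<le> x ^ 2 * S"
      unfolding S_def w_def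
      by (intro mult_left_mono finite_sum_le_infsum summable_on_inverse_cube_barnes_lattice)
         (use barnes_lattice_nonneg in \<open>auto simp: I_def\<close>)
    finally show ?thesis unfolding eq using norm_triangle_ineq[of c "\<Sum>i\<in>I. t i"] by linarith
  qed
  thus thesis by (rule that)
qed

section \<open>The second derivative of the logarithm of a quotient\<close>

context
  fixes J :: "'i set" and A B :: "'i \<Rightarrow> real"
  assumes J: "finite J" and A: "\<And>j. j \<in> J \<Longrightarrow> A j \<ge> 1" and B: "\<And>j. j \<in> J \<Longrightarrow> B j \<ge> 1"
begin

text \<open>What a single lattice point contributes to the second derivative of the sum of log G (A
  j + y) - log G (B j + y).\<close>

definition square_kernel :: "complex \<Rightarrow> complex" where
  "square_kernel u = (\<Sum>j\<in>J. 1 / (of_real (B j) + u) ^ 2 - 1 / (of_real (A j) + u) ^ 2)"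

text \<open>Around q = u + 1 the inverse squares expand as 1/q^2 - 2 c/q^3 with c = A j - 1 or c = B
  j - 1, nonnegative by assumption. The squares cancel in pairs, and -2 \<delta> / q^3 is replaced
  by -\<delta>/\<tau> times the mixed difference, where \<delta> is the sum of the B j - A
  j.\<close>

lemma square_kernel_approx:
  obtains K where "K \<ge> 0"
    "\<And>u. Re u \<ge> 0 \<Longrightarrow> norm (square_kernel u + of_real ((\<Sum>j\<in>J. B j - A j) / \<tau>) * mixed_difference \<tau> (u + 1)) \<le> K / norm (u + 1) ^ 4"
proof -
  define \<delta> where "\<delta> = (\<Sum>j\<in>J. B j - A j)"
  define K where "K = (\<Sum>j\<in>J. 3 * (B j - 1) ^ 2 + 3 * (A j - 1) ^ 2) + \<bar>\<delta> / \<tau>\<bar> * (1 + \<tau> ^ 3 + (1 + \<tau>) ^ 3)"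
  have bnd: "norm (square_kernel u + of_real (\<delta> / \<tau>) * mixed_difference \<tau> (u + 1)) \<le> K / norm (u + 1) ^ 4" if u: "Re u \<ge> 0" for u
  proof -
    define q where "q = u + 1"
    have q: "Re q > 0" using u by (simp add: q_def)
    define s where "s = (\<lambda>c. 1 / (q + of_real c) ^ 2 - 1 / q ^ 2 + 2 * of_real c / q ^ 3)"
    define d where "d = mixed_difference \<tau> q - 2 * of_real \<tau> / q ^ 3"
    have s: "norm (s c) \<le> 3 * c ^ 2 / norm q ^ 4" if "c \<ge> 0" for c
      unfolding s_def by (rule inverse_square_expansion[OF q that])
    have d: "norm d \<le> (1 + \<tau> ^ 3 + (1 + \<tau>) ^ 3) / norm q ^ 4"
      unfolding d_def by (rule mixed_difference_expansion[OF q \<tau>])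
    have "square_kernel u = (\<Sum>j\<in>J. s (B j - 1) - s (A j - 1) - of_real (B j - A j) * (2 / q ^ 3))"
      unfolding square_kernel_def
    proof (rule sum.cong)
      fix j
      have e: "of_real (B j) + u = q + of_real (B j - 1)" "of_real (A j) + u = q + of_real (A j - 1)"
        by (simp_all add: q_def)
      show "1 / (of_real (B j) + u) ^ 2 - 1 / (of_real (A j) + u) ^ 2 = s (B j - 1) - s (A j - 1) - of_real (B j - A j) * (2 / q ^ 3)"
        unfolding e s_def by (simp add: diff_divide_distrib ring_distribs)
    qed auto
    also have "\<dots> = (\<Sum>j\<in>J. s (B j - 1) - s (A j - 1)) - of_real \<delta> * (2 / q ^ 3)"
      unfolding sum_subtractf[of "\<lambda>j. s (B j - 1) - s (A j - 1)"] by (simp only: \<delta>_def of_real_sum sum_distrib_right)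
    finally have "square_kernel u + of_real (\<delta> / \<tau>) * mixed_difference \<tau> q = (\<Sum>j\<in>J. s (B j - 1) - s (A j - 1)) + of_real (\<delta> / \<tau>) * d"
      using \<tau> by (simp add: d_def right_diff_distrib)
    also have "norm \<dots> \<le> (\<Sum>j\<in>J. norm (s (B j - 1) - s (A j - 1))) + \<bar>\<delta> / \<tau>\<bar> * norm d"
      by (intro order.trans[OF norm_triangle_ineq] add_mono norm_sum) (simp add: norm_mult norm_divide)
    also have "\<dots> \<le> (\<Sum>j\<in>J. 3 * (B j - 1) ^ 2 / norm q ^ 4 + 3 * (A j - 1) ^ 2 / norm q ^ 4) + \<bar>\<delta> / \<tau>\<bar> * ((1 + \<tau> ^ 3 + (1 + \<tau>) ^ 3) / norm q ^ 4)"
      by (intro add_mono sum_mono mult_left_mono d order.trans[OF norm_triangle_ineq4] s) (use A B in auto)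
    also have "(\<Sum>j\<in>J. 3 * (B j - 1) ^ 2 / norm q ^ 4 + 3 * (A j - 1) ^ 2 / norm q ^ 4) = 
        (\<Sum>j\<in>J. 3 * (B j - 1) ^ 2 + 3 * (A j - 1) ^ 2) / norm q ^ 4"
      by (simp only: sum_divide_distrib add_divide_distrib)
    also have "\<dots> + \<bar>\<delta> / \<tau>\<bar> * ((1 + \<tau> ^ 3 + (1 + \<tau>) ^ 3) / norm q ^ 4) = K / norm q ^ 4"
      unfolding K_def by (simp only: add_divide_distrib[of _ "\<bar>\<delta> / \<tau>\<bar> * (1 + \<tau> ^ 3 + (1 + \<tau>) ^ 3)"] times_divide_eq_right)
    finally show ?thesis by (simp add: q_def)
  qed
  have "K \<ge> 0" unfolding K_def using \<tau> by (intro add_nonneg_nonneg sum_nonneg mult_nonneg_nonneg) auto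
  with bnd show thesis using that[of K] by (auto simp: \<delta>_def)
qed

text \<open>The mixed differences telescope to 1 / (u + 1) up to the outer corners of the box, which
  cost O(1/n); the fourth-order errors are summed by \<open>inverse_fourth_lattice_le\<close>. The
  term L/n disappears only after the two integrations, when n tends to infinity.\<close>

lemma sum_square_kernel_approx:
  obtains K L where "K \<ge> 0" "L \<ge> 0"
    "\<And>u n. Re u \<ge> 0 \<Longrightarrow> n \<ge> 1 \<Longrightarrow>
       norm ((\<Sum>i\<in>lattice_box n. square_kernel (u + of_real (lat i))) + of_real ((\<Sum>j\<in>J. B j - A j) / \<tau>) / (u + 1))
         \<le> K * norm (u + 1) powr (-3/2) + L / real n"
proof -
  define \<kappa> where "\<kappa> = (\<Sum>j\<in>J. B j - A j) / \<tau>"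
  obtain K where K: "K \<ge> 0"
    and approx: "\<And>u. Re u \<ge> 0 \<Longrightarrow> norm (square_kernel u + of_real \<kappa> * mixed_difference \<tau> (u + 1)) \<le> K / norm (u + 1) ^ 4"
    using square_kernel_approx unfolding \<kappa>_def by blast
  define h :: "nat \<times> nat \<Rightarrow> real" where "h = (\<lambda>i. (1 + real (fst i)) powr (-5/4) * (1 + real (snd i)) powr (-5/4))"
  define S where "S = infsum h UNIV"
  have S: "(\<Sum>i\<in>F. h i) \<le> S" if "finite F" for F
    unfolding S_def h_def by (rule finite_sum_le_infsum[OF summable_on_double_powr that]) auto
  have S0: "S \<ge> 0" using S[of "{}"] by simp
  define K' where "K' = K * min 1 \<tau> powr (-5/2) * S"
  define L where "L = \<bar>\<kappa>\<bar> * (2 + 1 / \<tau>)"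
  have bnd: "norm ((\<Sum>i\<in>lattice_box n. square_kernel (u + of_real (lat i))) + of_real \<kappa> / (u + 1))
         \<le> K' * norm (u + 1) powr (-3/2) + L / real n" if u: "Re u \<ge> 0" and n: "n \<ge> 1" for u n
  proof -
    define w where "w = (\<lambda>i. complex_of_real (lat i))"
    have w: "Re (w i) \<ge> 0" for i using barnes_lattice_nonneg by (simp add: w_def)
    \<comment> \<open>The three corners of the box other than the origin; each has modulus at most a
      multiple of 1/n because Re u \<ge> 0.\<close>
    define E where "E = 1 / (u + 1 + of_nat n) + 1 / (u + 1 + of_nat n * of_real \<tau>) - 1 / (u + 1 + of_nat n + of_nat n * of_real \<tau>)"
    have inv_le: "norm (1 / (u + 1 + of_real x)) \<le> 1 / x" if "x > 0" for x
    proof -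
      have "x \<le> Re (u + 1 + of_real x)" using u by simp
      also have "\<dots> \<le> norm (u + 1 + of_real x)" by (rule complex_Re_le_cmod)
      finally have "1 / norm (u + 1 + of_real x) \<le> 1 / x"
        using that by (intro divide_left_mono mult_pos_pos) auto
      thus ?thesis by (simp only: norm_divide norm_one)
    qed
    have nE: "norm E \<le> 1 / real n + 1 / (real n * \<tau>) + 1 / real n"
    proof -
      have "norm E \<le> norm (1 / (u + 1 + of_real (real n))) + norm (1 / (u + 1 + of_real (real n * \<tau>))) + norm (1 / (u + 1 + of_real (real n + real n * \<tau>)))"
        unfolding E_def
        by (intro order.trans[OF norm_triangle_ineq4] add_mono norm_triangle_ineq) (simp_all add: add.assoc norm_triangle_ineq)
      also have "\<dots> \<le> 1 / real n + 1 / (real n * \<tau>) + 1 / (real n + real n * \<tau>)"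
        using n \<tau> by (intro add_mono inv_le) (auto intro: add_pos_pos)
      also have "1 / (real n + real n * \<tau>) \<le> 1 / real n"
        using n \<tau> by (intro divide_left_mono) (auto intro!: mult_pos_pos add_pos_pos)
      finally show ?thesis by simp
    qed
    have eq: "(\<Sum>i\<in>lattice_box n. square_kernel (u + w i)) + of_real \<kappa> / (u + 1) =
        (\<Sum>i\<in>lattice_box n. square_kernel (u + w i) + of_real \<kappa> * mixed_difference \<tau> (u + w i + 1)) + of_real \<kappa> * E"
    proof -
      have "(\<Sum>i\<in>lattice_box n. mixed_difference \<tau> (u + w i + 1)) = 1 / (u + 1) - E"
        using sum_mixed_difference[of "u + 1" n] unfolding E_def w_def
        by (simp add: algebra_simps)
      thus ?thesis unfolding sum.distrib sum_distrib_left [symmetric] by (simp add: right_diff_distrib)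
    qed
    define Z where "Z = K * min 1 \<tau> powr (-5/2) * norm (u + 1) powr (-3/2)"
    have "norm (square_kernel (u + w i) + of_real \<kappa> * mixed_difference \<tau> (u + w i + 1)) \<le> Z * h i" for i
    proof -
      have "norm (square_kernel (u + w i) + of_real \<kappa> * mixed_difference \<tau> (u + w i + 1)) \<le> K / norm (u + w i + 1) ^ 4"
        using u w[of i] by (intro approx) simp
      also have "\<dots> = K * (1 / norm (u + 1 + w i) ^ 4)" by (simp add: add_ac)
      also have "\<dots> \<le> K * (min 1 \<tau> powr (-5/2) * norm (u + 1) powr (-3/2) * h i)"
        unfolding h_def w_def using u by (intro mult_left_mono[OF inverse_fourth_lattice_le] K) simp
      finally show ?thesis by (simp add: Z_def mult.assoc)
    qed
    hence "norm (\<Sum>i\<in>lattice_box n. square_kernel (u + w i) + of_real \<kappa> * mixed_difference \<tau> (u + w i + 1)) \<le> (\<Sum>i\<in>lattice_box n. Z * h i)"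
      by (intro sum_norm_le)
    also have "\<dots> = Z * (\<Sum>i\<in>lattice_box n. h i)" by (rule sum_distrib_left [symmetric])
    also have "\<dots> \<le> Z * S" using K unfolding Z_def by (intro mult_left_mono S) auto
    also have "\<dots> = K' * norm (u + 1) powr (-3/2)" by (simp add: K'_def Z_def)
    finally have 1: "norm (\<Sum>i\<in>lattice_box n. square_kernel (u + w i) + of_real \<kappa> * mixed_difference \<tau> (u + w i + 1)) \<le> \<dots>" .
    have "norm (of_real \<kappa> * E) = \<bar>\<kappa>\<bar> * norm E" by (simp add: norm_mult)
    also have "\<dots> \<le> \<bar>\<kappa>\<bar> * (1 / real n + 1 / (real n * \<tau>) + 1 / real n)"
      by (intro mult_left_mono nE) auto
    also have "\<dots> = L / real n"
      using n \<tau> by (simp add: L_def field_simps)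
    finally have "norm (of_real \<kappa> * E) \<le> L / real n" .
    with 1 have "norm ((\<Sum>i\<in>lattice_box n. square_kernel (u + w i)) + of_real \<kappa> / (u + 1)) \<le> K' * norm (u + 1) powr (-3/2) + L / real n"
      unfolding eq by (intro order.trans[OF norm_triangle_ineq] add_mono)
    thus ?thesis by (simp only: w_def)
  qed
  show thesis
    by (rule that[of K' L]) (use bnd K S0 \<tau> in \<open>auto simp: K'_def L_def \<kappa>_def\<close>)
qed

section \<open>Integration along rays and the growth bound\<close>

definition log_quotient :: "nat \<Rightarrow> complex \<Rightarrow> complex" where
  "log_quotient n y = (\<Sum>j\<in>J. barnes_log_partial n (of_real (A j) + y) - barnes_log_partial n (of_real (B j) + y))"

definition log_quotient' :: "nat \<Rightarrow> complex \<Rightarrow> complex" where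
  "log_quotient' n y = (\<Sum>j\<in>J. barnes_log_partial' n (of_real (A j) + y) - barnes_log_partial' n (of_real (B j) + y))"

lemma has_field_derivative_log_quotient:
  assumes "Re y \<ge> 0"
  shows "(log_quotient n has_field_derivative log_quotient' n y) (at y)"
proof -
  have sh: "((\<lambda>y. barnes_log_partial n (of_real x + y)) has_field_derivative barnes_log_partial' n (of_real x + y)) (at y)"
    if "x \<ge> 1" for x
  proof -
    have "Re (of_real x + y) > 0" using that assms by simp
    hence "(barnes_log_partial n has_field_derivative barnes_log_partial' n (of_real x + y)) (at (y + of_real x))"
      using has_field_derivative_barnes_log_partial[of "of_real x + y" n] by (simp add: add.commute)
    hence "((\<lambda>y. barnes_log_partial n (y + of_real x)) has_field_derivative barnes_log_partial' n (of_real x + y)) (at y)"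
      by (rule iffD1[OF DERIV_shift])
    thus ?thesis by (simp add: add.commute)
  qed
  show ?thesis unfolding log_quotient_def[abs_def] log_quotient'_def
    by (intro DERIV_sum DERIV_diff sh A B)
qed

text \<open>The coefficient \<open>barnes_e2 n\<close> enters once for each A j and once for each B
  j with opposite signs, so only the lattice sum of the inverse squares is left.\<close>

lemma has_field_derivative_log_quotient':
  assumes "Re y \<ge> 0"
  shows "(log_quotient' n has_field_derivative (\<Sum>i\<in>lattice_box n. square_kernel (y + of_real (lat i)))) (at y)"
proof -
  have sh: "((\<lambda>y. barnes_log_partial' n (of_real x + y)) has_field_derivative barnes_log_partial'' n (of_real x + y)) (at y)"
    if "x \<ge> 1" for x
  proof -
    have "Re (of_real x + y) > 0" using that assms by simp
    hence "(barnes_log_partial' n has_field_derivative barnes_log_partial'' n (of_real x + y)) (at (y + of_real x))"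
      using has_field_derivative_barnes_log_partial'[of "of_real x + y" n] by (simp add: add.commute)
    hence "((\<lambda>y. barnes_log_partial' n (y + of_real x)) has_field_derivative barnes_log_partial'' n (of_real x + y)) (at y)"
      by (rule iffD1[OF DERIV_shift])
    thus ?thesis by (simp add: add.commute)
  qed
  have "(log_quotient' n has_field_derivative (\<Sum>j\<in>J. barnes_log_partial'' n (of_real (A j) + y) - barnes_log_partial'' n (of_real (B j) + y))) (at y)"
    unfolding log_quotient'_def[abs_def] by (intro DERIV_sum DERIV_diff sh A B)
  also have "(\<Sum>j\<in>J. barnes_log_partial'' n (of_real (A j) + y) - barnes_log_partial'' n (of_real (B j) + y)) =
     (\<Sum>j\<in>J. \<Sum>i\<in>lattice_box n. 1 / (of_real (B j) + (y + of_real (lat i))) ^ 2 - 1 / (of_real (A j) + (y + of_real (lat i))) ^ 2)"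
    unfolding barnes_log_partial''_def by (intro sum.cong refl) (simp add: sum_subtractf add.assoc)
  also have "\<dots> = (\<Sum>i\<in>lattice_box n. square_kernel (y + of_real (lat i)))"
    unfolding square_kernel_def by (rule sum.swap)
  finally show ?thesis .
qed

lemma exp_log_quotient:
  assumes n: "n \<ge> 1" and y: "Re y \<ge> 0"
  shows "(\<Prod>j\<in>J. barnes_G_partial n (of_real (A j) + y) / barnes_G_partial n (of_real (B j) + y)) = exp (log_quotient n y)"
proof -
  have "barnes_G_partial n (of_real (A j) + y) / barnes_G_partial n (of_real (B j) + y) =
      exp (barnes_log_partial n (of_real (A j) + y) - barnes_log_partial n (of_real (B j) + y))" if "j \<in> J" for j
  proof -
    have pos: "Re (of_real (A j) + y) > 0" "Re (of_real (B j) + y) > 0" using A[OF that] B[OF that] y by auto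
    define c where "c = 1 / of_real \<tau> * (\<Prod>i\<in>lattice_box n - {(0, 0)}. 1 / complex_of_real (lat i))"
    have "complex_of_real (lat i) \<noteq> 0" if "i \<in> lattice_box n - {(0, 0)}" for i
      using barnes_lattice_pos[of i] that by auto
    hence "c \<noteq> 0" unfolding c_def using \<tau> by simp
    thus ?thesis
      unfolding barnes_G_partial_eq_exp[OF n pos(1)] barnes_G_partial_eq_exp[OF n pos(2)] c_def [symmetric] exp_diff
      by simp
  qed
  thus ?thesis unfolding log_quotient_def exp_sum[OF J] by (rule prod.cong[OF refl])
qed

lemma norm_one_plus_ray_ge:
  assumes "norm e = 1" "Re e \<ge> 0" "r \<ge> 0"
  shows "norm (of_real r * e + 1) \<ge> (1 + r) / 2"
proof (rule power2_le_imp_le)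
  have n1: "(Re e)\<^sup>2 + (Im e)\<^sup>2 = 1" using assms(1) by (metis cmod_power2 power_one)
  have "(norm (of_real r * e + 1))\<^sup>2 = (r * Re e + 1)\<^sup>2 + (r * Im e)\<^sup>2" by (simp add: cmod_power2)
  also have "\<dots> = r\<^sup>2 * ((Re e)\<^sup>2 + (Im e)\<^sup>2) + 2 * r * Re e + 1" by (simp add: power2_eq_square algebra_simps)
  also have "\<dots> \<ge> r\<^sup>2 + 1" using n1 assms by simp
  finally have "(norm (of_real r * e + 1))\<^sup>2 \<ge> r\<^sup>2 + 1" .
  moreover have "((1 + r) / 2)\<^sup>2 \<le> r\<^sup>2 + 1"
  proof -
    have "((1 + r) / 2)\<^sup>2 \<le> (1 + r)\<^sup>2 / 4 + (1 - r)\<^sup>2 / 4" by (simp add: power_divide)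
    also have "\<dots> = (r\<^sup>2 + 1) / 2" by (simp add: power2_eq_square field_simps)
    also have "\<dots> \<le> r\<^sup>2 + 1" by simp
    finally show ?thesis .
  qed
  ultimately show "((1 + r) / 2)\<^sup>2 \<le> (norm (of_real r * e + 1))\<^sup>2" by linarith
qed auto

text \<open>Along the ray r e the second derivative carries e^2, and the main term e^2 / (r e + 1)
  differs from e / (1 + r) by e (e - 1) / ((r e + 1) (1 + r)), which is O((1 + r)^-2). This makes
  the main term an explicit function of r with the factor Re e.\<close>

lemma ray_second_derivative_le:
  assumes e: "norm e = 1" "Re e \<ge> 0" and r: "r \<ge> 0" and \<kappa>: "\<kappa> \<ge> 0" and K: "K \<ge> 0"
    and D: "norm (D + of_real \<kappa> / (of_real r * e + 1)) \<le> K * norm (of_real r * e + 1) powr (-3/2) + l"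
  shows "Re (e * e * D) \<le> - \<kappa> * Re e / (1 + r) + (4 * K + 4 * \<kappa>) * (1 + r) powr (-3/2) + l"
proof -
  define q where "q = of_real r * e + 1"
  have nq: "norm q \<ge> (1 + r) / 2" unfolding q_def by (rule norm_one_plus_ray_ge[OF e r])
  have q0: "q \<noteq> 0" using nq r by auto
  have r1: "complex_of_real (1 + r) \<noteq> 0" using r by (simp only: of_real_eq_0_iff)
  define E1 where "E1 = D + of_real \<kappa> / q"
  define E2 where "E2 = e * e / q - e / of_real (1 + r)"
  have "e * e * D = e * e * E1 - of_real \<kappa> * E2 - of_real \<kappa> * (e / of_real (1 + r))"
    unfolding E1_def E2_def by (simp add: algebra_simps)
  hence "Re (e * e * D) = Re (e * e * E1) - \<kappa> * Re E2 - \<kappa> * (Re e / (1 + r))"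
    by (simp only: minus_complex.simps Re_complex_of_real Re_divide_of_real times_complex.simps Im_complex_of_real mult_zero_left diff_zero)
  also have "\<dots> \<le> norm E1 + \<kappa> * norm E2 - \<kappa> * (Re e / (1 + r))"
  proof -
    have "Re (e * e * E1) \<le> norm (e * e * E1)" by (rule complex_Re_le_cmod)
    also have "\<dots> = norm E1" using e by (simp add: norm_mult)
    finally have 1: "Re (e * e * E1) \<le> norm E1" .
    have "- Re E2 \<le> norm E2" using abs_Re_le_cmod[of E2] by linarith
    hence "\<kappa> * (- Re E2) \<le> \<kappa> * norm E2" using \<kappa> by (intro mult_left_mono)
    thus ?thesis using 1 by simp
  qed
  finally have b0: "Re (e * e * D) \<le> norm E1 + \<kappa> * norm E2 - \<kappa> * (Re e / (1 + r))" .
  have b1: "norm E1 \<le> 4 * K * (1 + r) powr (-3/2) + l"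
  proof -
    have "norm q powr (-3/2) \<le> ((1 + r) / 2) powr (-3/2)"
      using nq r by (intro powr_mono2') auto
    also have "\<dots> = (1 + r) powr (-3/2) * 2 powr (3/2)"
      using r by (simp add: powr_divide powr_minus_divide)
    also have "\<dots> \<le> (1 + r) powr (-3/2) * 2 powr 2"
      by (intro mult_left_mono powr_mono) auto
    finally have "norm q powr (-3/2) \<le> 4 * (1 + r) powr (-3/2)" by simp
    hence "K * norm q powr (-3/2) \<le> K * (4 * (1 + r) powr (-3/2))" using K by (intro mult_left_mono)
    with D show ?thesis unfolding E1_def q_def by linarith
  qed
  have "norm E2 \<le> 4 * (1 + r) powr (-3/2)"
  proof -
    have "E2 = e * (e - 1) / (q * of_real (1 + r))"
      unfolding E2_def using q0 r1 by (simp add: field_simps) (simp add: q_def algebra_simps)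
    hence "norm E2 = norm (e - 1) / (norm q * (1 + r))"
      using e r by (simp add: norm_mult norm_divide del: of_real_add)
    also have "\<dots> \<le> 2 / ((1 + r) / 2 * (1 + r))"
    proof (intro frac_le mult_right_mono nq)
      show "norm (e - 1) \<le> 2" using norm_triangle_ineq4[of e 1] e by simp
    qed (use r in auto)
    also have "\<dots> = 4 * (1 + r) powr (-2)" using r by (simp add: powr_minus_divide powr_numeral power2_eq_square)
    also have "\<dots> \<le> 4 * (1 + r) powr (-3/2)" using r by (intro mult_left_mono powr_mono) auto
    finally show ?thesis .
  qed
  hence "\<kappa> * norm E2 \<le> \<kappa> * (4 * (1 + r) powr (-3/2))" using \<kappa> by (rule mult_left_mono)
  with b0 b1 have "Re (e * e * D) \<le> 4 * K * (1 + r) powr (-3/2) + l + \<kappa> * (4 * (1 + r) powr (-3/2)) - \<kappa> * (Re e / (1 + r))"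
    by linarith
  also have "\<dots> = - \<kappa> * Re e / (1 + r) + (4 * K + 4 * \<kappa>) * (1 + r) powr (-3/2) + l"
    by (simp add: algebra_simps)
  finally show ?thesis .
qed

text \<open>Only upper bounds are wanted, so each of the two integrations takes the form of a
  comparison function that is nonincreasing on the ray.\<close>

lemma Re_log_quotient_le:
  assumes e: "norm e = 1" "Re e \<ge> 0" and n: "n \<ge> 1" and K: "K \<ge> 0" and L: "L \<ge> 0"
    and \<kappa>: "\<kappa> = (\<Sum>j\<in>J. B j - A j) / \<tau>" "\<kappa> \<ge> 0"
    and M: "norm (log_quotient' n 0) \<le> M"
    and approx: "\<And>u. Re u \<ge> 0 \<Longrightarrow> 
       norm ((\<Sum>i\<in>lattice_box n. square_kernel (u + of_real (lat i))) + of_real \<kappa> / (u + 1))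
         \<le> K * norm (u + 1) powr (-3/2) + L"
    and R: "R \<ge> 0"
  shows "Re (log_quotient n (of_real R * e)) \<le> Re (log_quotient n 0) + (M + 8 * K + 8 * \<kappa>) * R
     - \<kappa> * Re e * ((1 + R) * ln (1 + R) - R) + L * R ^ 2 / 2"
proof -
  define K1 where "K1 = 4 * K + 4 * \<kappa>"
  have K1: "K1 \<ge> 0" using K \<kappa> by (simp add: K1_def)
  define g where "g = (\<lambda>r. Re (log_quotient n (of_real r * e)))"
  define g1 where "g1 = (\<lambda>r. Re (e * log_quotient' n (of_real r * e)))"
  define g2 where "g2 = (\<lambda>r. Re (e * e * (\<Sum>i\<in>lattice_box n. square_kernel (of_real r * e + of_real (lat i)))))"
  have Re_pos: "Re (of_real r * e) \<ge> 0" if "r \<ge> 0" for r using e that by simp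
  have ray: "((\<lambda>r. Re (f (of_real r * e))) has_real_derivative Re (e * f')) (at r)"
    if "(f has_field_derivative f') (at (of_real r * e))" for f f' r
  proof -
    have "((\<lambda>r. complex_of_real r * e) has_vector_derivative e) (at r)"
      using bounded_linear_imp_has_derivative[OF bounded_linear_scaleR_left[of e]]
      by (simp add: has_vector_derivative_def scaleR_conv_of_real)
    from field_vector_diff_chain_at[OF this, of f f'] that
    have "((\<lambda>r. f (of_real r * e)) has_vector_derivative (e * f')) (at r)"
      by (simp add: o_def)
    thus ?thesis by (rule has_field_derivative_Re)
  qed
  have g: "(g has_real_derivative g1 r) (at r)" if "r \<ge> 0" for r
    unfolding g_def g1_def by (rule ray[OF has_field_derivative_log_quotient[OF Re_pos[OF that]]])
  have g1: "(g1 has_real_derivative g2 r) (at r)" if "r \<ge> 0" for r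
  proof -
    have "((\<lambda>z. e * log_quotient' n z) has_field_derivative e * (\<Sum>i\<in>lattice_box n. square_kernel (of_real r * e + of_real (lat i)))) (at (of_real r * e))"
      by (rule DERIV_cmult[OF has_field_derivative_log_quotient'[OF Re_pos[OF that]]])
    from ray[OF this] show ?thesis unfolding g1_def g2_def by (simp add: mult.assoc)
  qed
  have g2: "g2 r \<le> - \<kappa> * Re e / (1 + r) + K1 * (1 + r) powr (-3/2) + L" if "r \<ge> 0" for r
    unfolding g2_def K1_def
    by (rule ray_second_derivative_le[OF e that \<kappa>(2) K approx[OF Re_pos[OF that]]])
  define \<psi> where "\<psi> = (\<lambda>r. g1 r + \<kappa> * Re e * ln (1 + r) + 2 * K1 * (1 + r) powr (-1/2) - L * r)"
  have \<psi>: "\<psi> r \<le> \<psi> 0" if r: "r \<ge> 0" for r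
  proof (rule DERIV_nonpos_imp_nonincreasing[OF r])
    fix x assume x: "0 \<le> x" "x \<le> r"
    have "(\<psi> has_real_derivative g2 x + \<kappa> * Re e / (1 + x) - K1 * (1 + x) powr (-3/2) - L) (at x)"
      unfolding \<psi>_def using x by (auto intro!: derivative_eq_intros g1 simp: field_simps)
    moreover have "g2 x + \<kappa> * Re e / (1 + x) - K1 * (1 + x) powr (-3/2) - L \<le> 0"
      using g2[OF x(1)] by simp
    ultimately show "\<exists>y. (\<psi> has_real_derivative y) (at x) \<and> y \<le> 0" by blast
  qed
  have \<psi>0: "\<psi> 0 \<le> M + 2 * K1"
  proof -
    have "g1 0 = Re (e * log_quotient' n 0)" unfolding g1_def by (simp only: of_real_0 mult_zero_left)
    also have "\<dots> \<le> norm (e * log_quotient' n 0)" by (rule complex_Re_le_cmod)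
    also have "\<dots> \<le> M" using M e by (simp add: norm_mult)
    finally show ?thesis by (simp add: \<psi>_def)
  qed
  have g1_le: "g1 r \<le> M + 2 * K1 - \<kappa> * Re e * ln (1 + r) + L * r" if "r \<ge> 0" for r
  proof -
    have "2 * K1 * (1 + r) powr (-1/2) \<ge> 0" using K1 by simp
    thus ?thesis using \<psi>[OF that] \<psi>0 by (simp add: \<psi>_def)
  qed
  \<comment> \<open>The function (1 + r) ln (1 + r) - r is the antiderivative of ln (1 + r) that
    vanishes at 0.\<close>
  define \<omega> where "\<omega> = (\<lambda>r. g r - (M + 2 * K1) * r + \<kappa> * Re e * ((1 + r) * ln (1 + r) - r) - L * r ^ 2 / 2)"
  have "\<omega> R \<le> \<omega> 0"
  proof (rule DERIV_nonpos_imp_nonincreasing[OF R])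
    fix x assume x: "0 \<le> x" "x \<le> R"
    have "1 + x > 0" using x by simp
    hence "((\<lambda>r. (1 + r) * ln (1 + r) - r) has_real_derivative ln (1 + x)) (at x)"
      by (auto intro!: derivative_eq_intros)
    hence "(\<omega> has_real_derivative g1 x - (M + 2 * K1) + \<kappa> * Re e * ln (1 + x) - L * x) (at x)"
      unfolding \<omega>_def using x by (auto intro!: derivative_eq_intros g)
    moreover have "g1 x - (M + 2 * K1) + \<kappa> * Re e * ln (1 + x) - L * x \<le> 0"
      using g1_le[OF x(1)] by simp
    ultimately show "\<exists>y. (\<omega> has_real_derivative y) (at x) \<and> y \<le> 0" by blast
  qed
  thus ?thesis by (simp add: \<omega>_def g_def K1_def algebra_simps)
qed

text \<open>The inequality for partial products passes to the limit in n: the values at y and at 0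
  converge, the slope bound is uniform in n, and the quadratic term L R^2 / (2 n) vanishes.\<close>

lemma barnes_quotient_growth:
  assumes pos: "(\<Sum>j\<in>J. B j - A j) \<ge> 0"
  defines "\<kappa> \<equiv> (\<Sum>j\<in>J. B j - A j) / \<tau>"
  shows "\<exists>C. \<forall>y. Re y \<ge> 0 \<longrightarrow>
    norm (\<Prod>j\<in>J. barnes_G T (of_real (A j) + y) / barnes_G T (of_real (B j) + y))
      \<le> exp (C * (1 + norm y) - \<kappa> * Re y * ln (1 + norm y))"
proof -
  have \<kappa>: "\<kappa> \<ge> 0" using pos \<tau> by (simp add: \<kappa>_def)
  define Q where "Q = (\<lambda>y. \<Prod>j\<in>J. barnes_G T (of_real (A j) + y) / barnes_G T (of_real (B j) + y))"
  have Bnz: "barnes_G T (of_real (B j) + y) \<noteq> 0" if "j \<in> J" "Re y \<ge> 0" for j y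
  proof
    assume "barnes_G T (of_real (B j) + y) = 0"
    then obtain i where "of_real (B j) + y = - of_real (lat i)" using barnes_G_eq_0_iff by blast
    hence "Re (of_real (B j) + y) = Re (- of_real (lat i))" by (rule arg_cong)
    thus False using B[OF that(1)] that(2) barnes_lattice_nonneg[of i] by simp
  qed
  have lim: "(\<lambda>n. \<Prod>j\<in>J. barnes_G_partial n (of_real (A j) + y) / barnes_G_partial n (of_real (B j) + y)) \<longlonglongrightarrow> Q y"
    if "Re y \<ge> 0" for y
    unfolding Q_def by (intro tendsto_prod tendsto_divide tendsto_barnes_G_partial Bnz that)
  obtain K L where K: "K \<ge> 0" and L: "L \<ge> 0" and approx:
    "\<And>u n. Re u \<ge> 0 \<Longrightarrow> n \<ge> 1 \<Longrightarrow>
       norm ((\<Sum>i\<in>lattice_box n. square_kernel (u + of_real (lat i))) + of_real \<kappa> / (u + 1))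
         \<le> K * norm (u + 1) powr (-3/2) + L / real n"
    using sum_square_kernel_approx unfolding \<kappa>_def by blast
  have "\<exists>M. \<forall>n\<ge>1. norm (barnes_log_partial' n (of_real x)) \<le> M" if "x \<ge> 1" for x
    using norm_barnes_log_partial'_bounded[of x] that by (metis less_le_trans zero_less_one)
  then obtain M0 where M0: "\<And>x n. x \<ge> 1 \<Longrightarrow> n \<ge> 1 \<Longrightarrow> norm (barnes_log_partial' n (of_real x)) \<le> M0 x"
    by metis
  define M where "M = (\<Sum>j\<in>J. M0 (A j) + M0 (B j))"
  have M: "norm (log_quotient' n 0) \<le> M" if "n \<ge> 1" for n
  proof -
    have "norm (log_quotient' n 0) \<le> (\<Sum>j\<in>J. norm (barnes_log_partial' n (of_real (A j)) - barnes_log_partial' n (of_real (B j))))"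
      unfolding log_quotient'_def by (simp add: norm_sum)
    also have "\<dots> \<le> M"
      unfolding M_def by (intro sum_mono order.trans[OF norm_triangle_ineq4] add_mono M0 A B that)
    finally show ?thesis .
  qed
  define M1 where "M1 = M + 8 * K + 8 * \<kappa>"
  have main: "norm (Q y) \<le> norm (Q 0) * exp ((M1 + \<kappa>) * norm y - \<kappa> * Re y * ln (1 + norm y))" if y: "Re y \<ge> 0" for y
  proof -
    define R where "R = norm y"
    define e where "e = (if y = 0 then 1 else y / of_real R)"
    have e: "norm e = 1" "Re e \<ge> 0" and yR: "y = of_real R * e" and R: "R \<ge> 0"
      using y by (auto simp: e_def R_def norm_divide)
    have Rey: "Re y = R * Re e" unfolding yR by simp
    \<comment> \<open>The part of the exponent that is free of n. The summand
      \<open>0 * R ^ 2 / 2\<close> in the next line is the limit of the L/n term.\<close>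
    define X where "X = M1 * R - \<kappa> * Re e * ((1 + R) * ln (1 + R) - R)"
    have "norm (Q y) \<le> norm (Q 0) * exp (X + 0 * R ^ 2 / 2)"
    proof (rule LIMSEQ_le)
      show "(\<lambda>n. norm (\<Prod>j\<in>J. barnes_G_partial n (of_real (A j) + y) / barnes_G_partial n (of_real (B j) + y))) \<longlonglongrightarrow> norm (Q y)"
        by (intro tendsto_norm lim y)
      show "(\<lambda>n. norm (\<Prod>j\<in>J. barnes_G_partial n (of_real (A j) + 0) / barnes_G_partial n (of_real (B j) + 0)) * exp (X + L / real n * R ^ 2 / 2))
         \<longlonglongrightarrow> norm (Q 0) * exp (X + 0 * R ^ 2 / 2)"
        by (intro tendsto_intros lim lim_const_over_n) auto
      have "norm (\<Prod>j\<in>J. barnes_G_partial n (of_real (A j) + y) / barnes_G_partial n (of_real (B j) + y)) \<le>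
          norm (\<Prod>j\<in>J. barnes_G_partial n (of_real (A j) + 0) / barnes_G_partial n (of_real (B j) + 0)) * exp (X + L / real n * R ^ 2 / 2)"
        if n: "n \<ge> 1" for n
      proof -
        have "Re (log_quotient n (of_real R * e)) \<le> Re (log_quotient n 0) + (M + 8 * K + 8 * \<kappa>) * R
            - \<kappa> * Re e * ((1 + R) * ln (1 + R) - R) + L / real n * R ^ 2 / 2"
          by (rule Re_log_quotient_le[OF e n K _ _ \<kappa> M[OF n] approx[OF _ n] R]) (use L n in \<open>auto simp: \<kappa>_def\<close>)
        hence "Re (log_quotient n y) \<le> Re (log_quotient n 0) + (X + L / real n * R ^ 2 / 2)"
          unfolding yR X_def M1_def by simp
        hence "norm (exp (log_quotient n y)) \<le> norm (exp (log_quotient n 0)) * exp (X + L / real n * R ^ 2 / 2)"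
          by (simp flip: exp_add)
        moreover have "Re 0 \<ge> 0" by simp
        ultimately show ?thesis
          unfolding exp_log_quotient[OF n y] exp_log_quotient[OF n \<open>Re 0 \<ge> 0\<close>] by simp
      qed
      thus "\<exists>N. \<forall>n\<ge>N. norm (\<Prod>j\<in>J. barnes_G_partial n (of_real (A j) + y) / barnes_G_partial n (of_real (B j) + y)) \<le>
          norm (\<Prod>j\<in>J. barnes_G_partial n (of_real (A j) + 0) / barnes_G_partial n (of_real (B j) + 0)) * exp (X + L / real n * R ^ 2 / 2)"
        by blast
    qed
    also have "X + 0 * R ^ 2 / 2 \<le> (M1 + \<kappa>) * norm y - \<kappa> * Re y * ln (1 + norm y)"
    proof -
      have "Re e \<le> 1" using complex_Re_le_cmod[of e] e by simp
      hence "\<kappa> * (Re e * R) \<le> \<kappa> * (1 * R)" using \<kappa> R by (intro mult_left_mono mult_right_mono)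
      moreover have "\<kappa> * (Re e * ln (1 + R)) \<ge> 0" using \<kappa> e R by (intro mult_nonneg_nonneg) auto
      ultimately show ?thesis unfolding X_def Rey R_def [symmetric] by (simp add: algebra_simps)
    qed
    finally show ?thesis by (simp add: mult_left_mono)
  qed
  \<comment> \<open>The logarithm absorbs the prefactor |Q 0| into the exponential; the 1 inside it
    covers the case that Q 0 vanishes.\<close>
  define C where "C = max (M1 + \<kappa>) (ln (1 + norm (Q 0)))"
  have Q0: "norm (Q 0) \<le> exp C"
  proof -
    have "norm (Q 0) \<le> exp (ln (1 + norm (Q 0)))" by (subst exp_ln) (auto intro: add_pos_nonneg)
    also have "\<dots> \<le> exp C" by (simp add: C_def)
    finally show ?thesis .
  qed
  have "norm (Q y) \<le> exp (C * (1 + norm y) - \<kappa> * Re y * ln (1 + norm y))" if y: "Re y \<ge> 0" for y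
  proof -
    have "(M1 + \<kappa>) * norm y \<le> C * norm y" by (intro mult_right_mono) (auto simp: C_def)
    hence e: "exp ((M1 + \<kappa>) * norm y - \<kappa> * Re y * ln (1 + norm y)) \<le> exp (C * norm y - \<kappa> * Re y * ln (1 + norm y))"
      by simp
    have "norm (Q y) \<le> norm (Q 0) * exp ((M1 + \<kappa>) * norm y - \<kappa> * Re y * ln (1 + norm y))" by (rule main[OF y])
    also have "\<dots> \<le> exp C * exp (C * norm y - \<kappa> * Re y * ln (1 + norm y))"
      by (rule mult_mono[OF Q0 e]) auto
    also have "\<dots> = exp (C * (1 + norm y) - \<kappa> * Re y * ln (1 + norm y))"
      unfolding exp_add [symmetric] by (simp add: ring_distribs)
    finally show ?thesis .
  qed
  hence "\<forall>y. Re y \<ge> 0 \<longrightarrow> norm (Q y) \<le> exp (C * (1 + norm y) - \<kappa> * Re y * ln (1 + norm y))"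
    by blast
  thus ?thesis unfolding Q_def by (rule exI)
qed

end

text \<open>In a sector Re z is comparable with |z|, so Re z log |z| outgrows every multiple of |z|,
  whatever the constant of the growth bound. Parameters below 1 are reached by translating z, which
  disturbs a sector only slightly far out.\<close>

lemma barnes_quotient_decay:
  fixes a b :: "'i \<Rightarrow> real"
  assumes J: "finite J" and pos: "(\<Sum>j\<in>J. b j - a j) > 0" and \<eta>: "\<eta> > 0"
  obtains \<rho> where "\<rho> > 0" "\<And>z. norm z \<ge> \<rho> \<Longrightarrow> Re z \<ge> \<eta> * norm z \<Longrightarrow>
    norm (\<Prod>j\<in>J. barnes_G T (of_real (a j) + z) / barnes_G T (of_real (b j) + z)) \<le> exp (- K * norm z)"
proof -
  \<comment> \<open>One translation that makes all parameters at least 1; it changes neither the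
    differences b j - a j nor their sum.\<close>
  define x0 where "x0 = 1 + (\<Sum>j\<in>J. \<bar>a j\<bar> + \<bar>b j\<bar>)"
  have x0: "x0 \<ge> 1" unfolding x0_def by (simp add: sum_nonneg)
  have ab: "a j + x0 \<ge> 1" "b j + x0 \<ge> 1" if "j \<in> J" for j
  proof -
    have "\<bar>a j\<bar> + \<bar>b j\<bar> \<le> (\<Sum>j\<in>J. \<bar>a j\<bar> + \<bar>b j\<bar>)" using that J by (intro member_le_sum) auto
    thus "a j + x0 \<ge> 1" "b j + x0 \<ge> 1" unfolding x0_def by linarith+
  qed
  define \<kappa> where "\<kappa> = (\<Sum>j\<in>J. b j - a j) / \<tau>"
  have \<kappa>: "\<kappa> > 0" using pos \<tau> by (simp add: \<kappa>_def)
  have sumeq: "(\<Sum>j\<in>J. (b j + x0) - (a j + x0)) = (\<Sum>j\<in>J. b j - a j)" by simp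
  obtain C where C: "\<And>y. Re y \<ge> 0 \<Longrightarrow>
    norm (\<Prod>j\<in>J. barnes_G T (of_real (a j + x0) + y) / barnes_G T (of_real (b j + x0) + y))
      \<le> exp (C * (1 + norm y) - \<kappa> * Re y * ln (1 + norm y))"
    using barnes_quotient_growth[of J "\<lambda>j. a j + x0" "\<lambda>j. b j + x0", OF J ab] pos unfolding sumeq \<kappa>_def
    by auto
  define C' where "C' = \<bar>C\<bar>"
  \<comment> \<open>The three thresholds give in turn: Re y \<ge> \<eta>/2 |z|; |y| between |z|/2
    and 2 |z|, with |z| \<ge> 2 and hence 1 + |y| \<le> 3 |z|; and a logarithm large enough to pay
    for 3 C' + |K|.\<close>
  define \<rho> where "\<rho> = max (2 * x0 / \<eta>) (max (2 * x0) (2 * exp ((3 * C' + \<bar>K\<bar>) / (\<kappa> * \<eta> / 2))))"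
  have \<rho>: "\<rho> \<ge> 2 * x0" "\<rho> \<ge> 2 * x0 / \<eta>" "\<rho> \<ge> 2 * exp ((3 * C' + \<bar>K\<bar>) / (\<kappa> * \<eta> / 2))" by (auto simp: \<rho>_def)
  show thesis
  proof (rule that[of \<rho>])
    show "\<rho> > 0" using \<rho>(1) x0 by linarith
    fix z assume z: "norm z \<ge> \<rho>" "Re z \<ge> \<eta> * norm z"
    define y where "y = z - of_real x0"
    have nz: "norm z \<ge> 2" using z \<rho>(1) x0 by linarith
    have "2 * x0 / \<eta> \<le> norm z" using z(1) \<rho>(2) by linarith
    hence "x0 \<le> \<eta> / 2 * norm z" using \<eta> by (simp add: field_simps)
    hence Rey: "Re y \<ge> \<eta> / 2 * norm z" using z(2) by (simp add: y_def field_simps)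
    hence Rey0: "Re y \<ge> 0" using \<eta> by (smt (verit) mult_nonneg_nonneg norm_ge_zero divide_nonneg_nonneg)
    have ny: "norm y \<le> 2 * norm z" "norm y \<ge> norm z / 2"
    proof -
      have "norm y \<le> norm z + x0" unfolding y_def using norm_triangle_ineq4[of z "of_real x0"] x0 by simp
      thus "norm y \<le> 2 * norm z" using z(1) \<rho>(1) x0 by linarith
      have "norm z \<le> norm y + x0" unfolding y_def using norm_triangle_ineq[of "z - of_real x0" "of_real x0"] x0 by simp
      thus "norm y \<ge> norm z / 2" using z(1) \<rho>(1) x0 by (simp add: field_simps)
    qed
    have lnz: "ln (1 + norm y) \<ge> (3 * C' + \<bar>K\<bar>) / (\<kappa> * \<eta> / 2)"
    proof -
      have "exp ((3 * C' + \<bar>K\<bar>) / (\<kappa> * \<eta> / 2)) \<le> norm z / 2" using z(1) \<rho>(3) by (simp add: field_simps)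
      also have "\<dots> \<le> 1 + norm y" using ny(2) by linarith
      finally show ?thesis by (subst ln_ge_iff) (auto intro: add_pos_nonneg)
    qed
    have "norm (\<Prod>j\<in>J. barnes_G T (of_real (a j) + z) / barnes_G T (of_real (b j) + z)) =
       norm (\<Prod>j\<in>J. barnes_G T (of_real (a j + x0) + y) / barnes_G T (of_real (b j + x0) + y))"
      by (simp add: y_def)
    also have "\<dots> \<le> exp (C * (1 + norm y) - \<kappa> * Re y * ln (1 + norm y))" by (rule C[OF Rey0])
    also have "C * (1 + norm y) - \<kappa> * Re y * ln (1 + norm y) \<le> - K * norm z"
    proof -
      have "C * (1 + norm y) \<le> C' * (3 * norm z)"
        using ny(1) nz unfolding C'_def by (intro mult_mono) auto
      moreover have "\<kappa> * Re y * ln (1 + norm y) \<ge> \<kappa> * (\<eta> / 2 * norm z) * ((3 * C' + \<bar>K\<bar>) / (\<kappa> * \<eta> / 2))"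
      proof (intro mult_mono lnz mult_left_mono Rey)
        show "0 \<le> (3 * C' + \<bar>K\<bar>) / (\<kappa> * \<eta> / 2)" using \<kappa> \<eta> by (simp add: C'_def)
      qed (use \<kappa> \<eta> Rey0 in auto)
      moreover have "\<kappa> * (\<eta> / 2 * norm z) * ((3 * C' + \<bar>K\<bar>) / (\<kappa> * \<eta> / 2)) = (3 * C' + \<bar>K\<bar>) * norm z"
        using \<kappa> \<eta> by simp
      moreover have "- \<bar>K\<bar> * norm z \<le> - K * norm z" by (intro mult_right_mono) auto
      ultimately show ?thesis by (simp add: algebra_simps)
    qed
    finally show "norm (\<Prod>j\<in>J. barnes_G T (of_real (a j) + z) / barnes_G T (of_real (b j) + z)) \<le> exp (- K * norm z)"
      by simp
  qed
qed

end

section \<open>Contours with two rays to the left\<close>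

lemma closed_of_locally_finite:
  fixes Z :: "complex set"
  assumes "\<And>r. finite (Z \<inter> ball 0 r)"
  shows "closed Z"
proof -
  have "finite (Z \<inter> ball x 1)" for x
  proof (rule finite_subset[OF _ assms])
    have "ball x 1 \<subseteq> ball 0 (norm x + 1)"
      by (subst ball_subset_ball_iff) (simp add: dist_norm)
    thus "Z \<inter> ball x 1 \<subseteq> Z \<inter> ball 0 (norm x + 1)" by blast
  qed
  hence "\<not> x islimpt Z" for x by (auto simp: islimpt_eq_infinite_ball intro!: exI[of _ 1])
  thus ?thesis by (simp add: closed_limpt)
qed

lemma finite_nonpos_integers_ball: "finite (range (\<lambda>n. - complex_of_nat n) \<inter> ball 0 r)"
proof (rule finite_subset)
  show "range (\<lambda>n. - complex_of_nat n) \<inter> ball 0 r \<subseteq> (\<lambda>n. - of_nat n) ` {..nat \<lceil>r\<rceil>}"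
  proof
    fix s assume "s \<in> range (\<lambda>n. - complex_of_nat n) \<inter> ball 0 r"
    then obtain n where n: "s = - of_nat n" "real n < r" by auto
    hence "n \<le> nat \<lceil>r\<rceil>" by linarith
    thus "s \<in> (\<lambda>n. - of_nat n) ` {..nat \<lceil>r\<rceil>}" using n by auto
  qed
qed auto

lemma valid_path_subpath_UNIV:
  fixes \<gamma> :: "real \<Rightarrow> complex"
  assumes "\<gamma> piecewise_C1_differentiable_on UNIV"
  shows "valid_path (subpath \<alpha> \<beta> \<gamma>)"
proof -
  have "(\<gamma> \<circ> (\<lambda>x. (\<beta> - \<alpha>) *\<^sub>R x + \<alpha>)) piecewise_C1_differentiable_on {0..1}"
    by (rule piecewise_C1_differentiable_affine) (rule piecewise_C1_differentiable_on_subset[OF assms], simp)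
  thus ?thesis by (simp add: valid_path_def subpath_def o_def)
qed

lemma path_image_subpath_UNIV:
  fixes \<gamma> :: "real \<Rightarrow> complex"
  assumes "\<alpha> \<le> \<beta>"
  shows "path_image (subpath \<alpha> \<beta> \<gamma>) = \<gamma> ` {\<alpha>..\<beta>}"
  using assms by (simp add: path_image_subpath closed_segment_eq_real_ivl)

text \<open>Integrals in \<open>K_contour\<close> run over a real parameter, while the residue
  theorem is about paths on [0, 1]. The bridge is an affine substitution, with the finitely many
  break points discarded.\<close>

lemma has_integral_subpath_UNIV:
  fixes \<gamma> :: "real \<Rightarrow> complex"
  assumes \<gamma>: "\<gamma> piecewise_C1_differentiable_on UNIV" and ab: "\<alpha> < \<beta>"
    and S: "open S" "f holomorphic_on S" "\<gamma> ` {\<alpha>..\<beta>} \<subseteq> S"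
  shows "((\<lambda>t. f (\<gamma> t) * vector_derivative \<gamma> (at t)) has_integral contour_integral (subpath \<alpha> \<beta> \<gamma>) f) {\<alpha>..\<beta>}"
proof -
  define g where "g = subpath \<alpha> \<beta> \<gamma>"
  have vg: "valid_path g" unfolding g_def by (rule valid_path_subpath_UNIV[OF \<gamma>])
  have "path_image g \<subseteq> S" using path_image_subpath_UNIV[of \<alpha> \<beta> \<gamma>] ab S(3) by (simp add: g_def)
  hence "f contour_integrable_on g" by (rule contour_integrable_holomorphic_simple[OF S(2,1) vg])
  hence "(f has_contour_integral contour_integral g f) g" by (rule has_contour_integral_integral)
  hence 0: "((\<lambda>x. f (g x) * vector_derivative g (at x)) has_integral contour_integral g f) (cbox 0 1)"
    by (simp add: has_contour_integral)
  \<comment> \<open>t \<mapsto> m t + c is the inverse of the affine map that defines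
    \<open>subpath\<close>.\<close>
  define m where "m = 1 / (\<beta> - \<alpha>)"
  define c where "c = - \<alpha> / (\<beta> - \<alpha>)"
  have m: "m > 0" using ab by (simp add: m_def)
  have 1: "((\<lambda>t. f (g (m * t + c)) * vector_derivative g (at (m * t + c))) has_integral (1 / m) *\<^sub>R contour_integral g f) {\<alpha>..\<beta>}"
  proof -
    have "(\<lambda>x. (1 / m) *\<^sub>R x + - ((1 / m) *\<^sub>R c)) ` cbox 0 1 = {\<alpha>..\<beta>}"
    proof -
      have eq: "(\<lambda>x. (1 / m) *\<^sub>R x + - ((1 / m) *\<^sub>R c)) = (\<lambda>x. (\<beta> - \<alpha>) * x + \<alpha>)"
        using ab by (auto simp: m_def c_def field_simps)
      show ?thesis unfolding eq using ab by (simp add: image_affinity_atLeastAtMost)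
    qed
    thus ?thesis using has_integral_affinity[OF 0, of m c] m by simp
  qed
  have 2: "((\<lambda>t. of_real m * (f (g (m * t + c)) * vector_derivative g (at (m * t + c)))) has_integral contour_integral g f) {\<alpha>..\<beta>}"
    using has_integral_mult_right[OF 1, of "of_real m"] m by (simp add: scaleR_conv_of_real)
  obtain F where F: "finite F" "\<gamma> C1_differentiable_on (UNIV - F)"
    using \<gamma> by (auto simp: piecewise_C1_differentiable_on_def)
  have mt: "(\<beta> - \<alpha>) * (m * t + c) + \<alpha> = t" for t
  proof -
    have "m * t + c = (t - \<alpha>) / (\<beta> - \<alpha>)" by (simp add: m_def c_def diff_divide_distrib)
    thus ?thesis using ab by simp
  qed
  have gm: "g (m * t + c) = \<gamma> t" for t
  proof -
    note mt[of t]
    thus ?thesis by (simp add: g_def subpath_def)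
  qed
  show ?thesis unfolding g_def [symmetric]
  proof (rule has_integral_spike_finite[OF F(1) _ 2])
    fix t assume t: "t \<in> {\<alpha>..\<beta>} - F"
    have d: "(\<gamma> has_vector_derivative vector_derivative \<gamma> (at t)) (at t)"
      using F(2) t by (auto simp: C1_differentiable_on_eq vector_derivative_works)
    note e = mt[of t]
    have "((\<lambda>x. (\<beta> - \<alpha>) * x + \<alpha>) has_vector_derivative (\<beta> - \<alpha>)) (at (m * t + c))"
      by (auto intro!: derivative_eq_intros)
    from vector_diff_chain_at[OF this, of \<gamma> "vector_derivative \<gamma> (at t)"] d e
    have "(g has_vector_derivative (\<beta> - \<alpha>) *\<^sub>R vector_derivative \<gamma> (at t)) (at (m * t + c))"
      by (simp add: g_def subpath_def o_def)
    hence "vector_derivative g (at (m * t + c)) = (\<beta> - \<alpha>) *\<^sub>R vector_derivative \<gamma> (at t)"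
      by (rule vector_derivative_at)
    thus "f (\<gamma> t) * vector_derivative \<gamma> (at t) = of_real m * (f (g (m * t + c)) * vector_derivative g (at (m * t + c)))"
      unfolding gm using ab by (simp add: m_def scaleR_conv_of_real)
  qed
qed

lemma line_has_vector_derivative:
  "((\<lambda>t. c + complex_of_real t * e) has_vector_derivative e) (at t)"
proof -
  have d: "((\<lambda>r. complex_of_real r * e) has_vector_derivative e) (at t)"
    using bounded_linear_imp_has_derivative[OF bounded_linear_scaleR_left[of e]]
    by (simp add: has_vector_derivative_def scaleR_conv_of_real)
  show ?thesis using has_vector_derivative_add[OF has_vector_derivative_const[of c] d] by simp
qed

text \<open>On a ray the parameter integral is that of a straight segment. This is what allows
  closed contours with different closing lines to be compared through a polygon.\<close>

lemma has_integral_linear_piece: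
  fixes \<gamma> :: "real \<Rightarrow> complex"
  assumes \<gamma>: "\<And>t. t \<in> {\<alpha>..\<beta>} \<Longrightarrow> \<gamma> t = c + of_real t * e" and ab: "\<alpha> < \<beta>"
    and S: "open S" "f holomorphic_on S" "\<gamma> ` {\<alpha>..\<beta>} \<subseteq> S"
  shows "((\<lambda>t. f (\<gamma> t) * vector_derivative \<gamma> (at t)) has_integral contour_integral (linepath (\<gamma> \<alpha>) (\<gamma> \<beta>)) f) {\<alpha>..\<beta>}"
proof -
  define l where "l = (\<lambda>t. c + complex_of_real t * e)"
  have dl: "(l has_vector_derivative e) (at t)" for t
    unfolding l_def by (rule line_has_vector_derivative)
  have l: "l piecewise_C1_differentiable_on UNIV"
    by (rule C1_differentiable_imp_piecewise)
       (auto simp: C1_differentiable_on_def intro!: exI[of _ "\<lambda>_. e"] dl)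
  have img: "l ` {\<alpha>..\<beta>} \<subseteq> S" using S(3) \<gamma> by (auto simp: l_def)
  have sub: "subpath \<alpha> \<beta> l = linepath (\<gamma> \<alpha>) (\<gamma> \<beta>)"
  proof -
    have "l \<alpha> = \<gamma> \<alpha>" "l \<beta> = \<gamma> \<beta>" using \<gamma> ab by (auto simp: l_def)
    moreover have "subpath \<alpha> \<beta> l = linepath (l \<alpha>) (l \<beta>)"
      by (auto simp: subpath_def linepath_def l_def fun_eq_iff scaleR_conv_of_real algebra_simps)
    ultimately show ?thesis by simp
  qed
  have 1: "((\<lambda>t. f (l t) * vector_derivative l (at t)) has_integral contour_integral (linepath (\<gamma> \<alpha>) (\<gamma> \<beta>)) f) {\<alpha>..\<beta>}"
    using has_integral_subpath_UNIV[OF l ab S(1,2) img] unfolding sub .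
  show ?thesis
  proof (rule has_integral_spike_finite[OF _ _ 1])
    show "finite {\<alpha>, \<beta>}" by simp
    \<comment> \<open>The ends are left out because \<gamma> is only known to be linear on one side
      of them.\<close>
    fix t assume t: "t \<in> {\<alpha>..\<beta>} - {\<alpha>, \<beta>}"
    hence "t \<in> {\<alpha><..<\<beta>}" by auto
    hence "(\<gamma> has_vector_derivative e) (at t)"
      by (rule has_vector_derivative_transform_within_open[OF dl[of t] open_greaterThanLessThan])
         (use \<gamma> in \<open>auto simp: l_def\<close>)
    hence "vector_derivative \<gamma> (at t) = vector_derivative l (at t)"
      using dl[of t] by (simp add: vector_derivative_at)
    thus "f (\<gamma> t) * vector_derivative \<gamma> (at t) = f (l t) * vector_derivative l (at t)"
      using \<gamma>[of t] t by (simp add: l_def)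
  qed
qed

text \<open>Each edge contributes a real part strictly between \<open>0\<close> and \<open>1/2\<close>.\<close>

lemma winding_number_quadrilateral:
  assumes "0 < Im ((b - a) * cnj (b - z))" "0 < Im ((c - b) * cnj (c - z))"
    "0 < Im ((d - c) * cnj (d - z))" "0 < Im ((a - d) * cnj (a - z))"
  shows "winding_number (linepath a b) z + winding_number (linepath b c) z +
     winding_number (linepath c d) z + winding_number (linepath d a) z = 1"
proof -
  have half: "Re (winding_number (linepath x y) z) < 1/2 \<and> z \<notin> closed_segment x y \<and> Re (winding_number (linepath x y) z) > 0"
    if pos: "0 < Im ((y - x) * cnj (y - z))" for x y
  proof -
    have "z \<notin> closed_segment x y"
    proof
      assume "z \<in> closed_segment x y"
      then obtain u where u: "z = (1 - u) *\<^sub>R x + u *\<^sub>R y" by (auto simp: closed_segment_def)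
      have "y - z = of_real (1 - u) * (y - x)" unfolding u by (simp add: scaleR_conv_of_real algebra_simps)
      hence "(y - x) * cnj (y - z) = of_real (1 - u) * ((y - x) * cnj (y - x))" by simp
      also have "\<dots> = of_real ((1 - u) * (norm (y - x))\<^sup>2)" by (simp only: of_real_mult complex_norm_square)
      finally have "Im ((y - x) * cnj (y - z)) = 0" by (simp only: Im_complex_of_real)
      thus False using pos by simp
    qed
    thus ?thesis using winding_number_lt_half_linepath[of z x y] winding_number_linepath_pos_lt[OF pos] by simp
  qed
  note h = half[OF assms(1)] half[OF assms(2)] half[OF assms(3)] half[OF assms(4)]
  define q where "q = linepath a b +++ (linepath b c +++ (linepath c d +++ linepath d a))"
  have eq: "winding_number q z = winding_number (linepath a b) z + (winding_number (linepath b c) z +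
     (winding_number (linepath c d) z + winding_number (linepath d a) z))"
    unfolding q_def using h by (simp add: winding_number_join path_image_join)
  have "winding_number q z \<in> \<int>"
    unfolding q_def using h by (intro integer_winding_number) (auto simp: path_image_join)
  then obtain k where k: "winding_number q z = of_int k" by (auto elim: Ints_cases)
  hence "Re (winding_number q z) = of_int k" by simp
  moreover have "Re (winding_number q z) > 0" "Re (winding_number q z) < 2" unfolding eq using h by auto
  ultimately have "k = 1" by linarith
  thus ?thesis using k unfolding eq by (simp add: add.assoc)
qed

lemma winding_number_quadrilateral_outside:
  assumes "convex S" "a \<in> S" "b \<in> S" "c \<in> S" "d \<in> S" "z \<notin> S"
  shows "winding_number (linepath a b) z + winding_number (linepath b c) z +
     winding_number (linepath c d) z + winding_number (linepath d a) z = 0"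
proof -
  have sub: "closed_segment a b \<subseteq> S" "closed_segment b c \<subseteq> S" "closed_segment c d \<subseteq> S" "closed_segment d a \<subseteq> S"
    using assms by (simp_all add: closed_segment_subset)
  define q where "q = linepath a b +++ (linepath b c +++ (linepath c d +++ linepath d a))"
  have nz: "z \<notin> closed_segment a b" "z \<notin> closed_segment b c" "z \<notin> closed_segment c d" "z \<notin> closed_segment d a"
    using sub assms by auto
  have eq: "winding_number q z = winding_number (linepath a b) z + (winding_number (linepath b c) z +
     (winding_number (linepath c d) z + winding_number (linepath d a) z))"
    unfolding q_def using nz by (simp add: winding_number_join path_image_join)
  have "winding_number q z = 0"
    by (rule winding_number_zero_outside[where s = S]) (use assms sub in \<open>auto simp: q_def path_image_join\<close>)
  thus ?thesis unfolding eq by (simp add: add.assoc)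
qed

lemma closed_segment_linear_piece:
  fixes \<gamma> :: "real \<Rightarrow> complex"
  assumes "\<And>t. t \<in> {\<alpha>..\<beta>} \<Longrightarrow> \<gamma> t = c + of_real t * e" "\<alpha> \<le> \<beta>"
  shows "closed_segment (\<gamma> \<alpha>) (\<gamma> \<beta>) \<subseteq> \<gamma> ` {\<alpha>..\<beta>}"
proof
  fix s assume "s \<in> closed_segment (\<gamma> \<alpha>) (\<gamma> \<beta>)"
  then obtain u where u: "0 \<le> u" "u \<le> 1" "s = (1 - u) *\<^sub>R \<gamma> \<alpha> + u *\<^sub>R \<gamma> \<beta>"
    by (auto simp: closed_segment_def)
  define t where "t = (1 - u) * \<alpha> + u * \<beta>"
  have "t \<in> closed_segment \<alpha> \<beta>" using u by (auto simp: t_def closed_segment_def)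
  hence t: "t \<in> {\<alpha>..\<beta>}" using assms(2) by (simp add: closed_segment_eq_real_ivl)
  have "s = c + of_real t * e"
    unfolding u(3) t_def using assms by (simp add: scaleR_conv_of_real algebra_simps)
  hence "s = \<gamma> t" using assms(1)[OF t] by simp
  thus "s \<in> \<gamma> ` {\<alpha>..\<beta>}" using t by (rule image_eqI)
qed

text \<open>Integrability over the line requires control of all large intervals, but the residue
  theorem provides only one sequence of them. The exponential tails make the integrals over any two
  intervals containing [-B, B] differ by at most 2 M exp (-B).\<close>

lemma has_integral_UNIV_of_exponential_tails:
  fixes F :: "real \<Rightarrow> complex"
  assumes int: "\<And>a b. F integrable_on {a..b}"
    and le: "\<And>t. \<bar>t\<bar> \<ge> T \<Longrightarrow> norm (F t) \<le> M * exp (- \<bar>t\<bar>)"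
    and u: "filterlim u at_top sequentially" and v: "filterlim v at_top sequentially"
    and lim: "(\<lambda>n::nat. integral {- u n..v n} F) \<longlonglongrightarrow> I"
  shows "(F has_integral I) UNIV"
proof -
  have M: "M \<ge> 0"
  proof -
    have "0 \<le> norm (F (max T 0))" by simp
    also have "\<dots> \<le> M * exp (- \<bar>max T 0\<bar>)" by (rule le) auto
    finally show ?thesis by (simp add: zero_le_mult_iff)
  qed
  have tail: "norm (integral {a..b} F) \<le> M * exp (-B)" if "B \<ge> max T 0" "a \<ge> B" "a \<le> b" for a b B
  proof -
    have "norm (integral {a..b} F) \<le> integral {a..b} (\<lambda>t. M * exp (-t))"
    proof (rule integral_norm_bound_integral[OF int])
      show "(\<lambda>t. M * exp (- t)) integrable_on {a..b}" by (intro integrable_continuous_real continuous_intros)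
      show "norm (F t) \<le> M * exp (- t)" if "t \<in> {a..b}" for t using le[of t] that \<open>B \<ge> max T 0\<close> \<open>a \<ge> B\<close> by auto
    qed
    also have "((\<lambda>t. M * exp (- t)) has_integral (- M * exp (-b)) - (- M * exp (-a))) {a..b}"
      using \<open>a \<le> b\<close> by (intro fundamental_theorem_of_calculus)
         (auto intro!: derivative_eq_intros simp: has_real_derivative_iff_has_vector_derivative [symmetric])
    hence "integral {a..b} (\<lambda>t. M * exp (-t)) = M * exp (-a) - M * exp (-b)"
      by (subst integral_unique) (assumption | simp)+
    also have "\<dots> \<le> M * exp (-B)"
    proof -
      have "M * exp (-a) \<le> M * exp (-B)" using that M by (intro mult_left_mono) auto
      moreover have "M * exp (-b) \<ge> 0" using M by simp
      ultimately show ?thesis by linarith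
    qed
    finally show ?thesis .
  qed
  have tail': "norm (integral {a..b} F) \<le> M * exp (-B)" if "B \<ge> max T 0" "b \<le> -B" "a \<le> b" for a b B
  proof -
    have "norm (integral {a..b} F) \<le> integral {a..b} (\<lambda>t. M * exp t)"
    proof (rule integral_norm_bound_integral[OF int])
      show "(\<lambda>t. M * exp t) integrable_on {a..b}" by (intro integrable_continuous_real continuous_intros)
      show "norm (F t) \<le> M * exp t" if "t \<in> {a..b}" for t using le[of t] that \<open>B \<ge> max T 0\<close> \<open>b \<le> -B\<close> by auto
    qed
    also have "((\<lambda>t. M * exp t) has_integral (M * exp b) - (M * exp a)) {a..b}"
      using \<open>a \<le> b\<close> by (intro fundamental_theorem_of_calculus)
         (auto intro!: derivative_eq_intros simp: has_real_derivative_iff_has_vector_derivative [symmetric])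
    hence "integral {a..b} (\<lambda>t. M * exp t) = M * exp b - M * exp a"
      by (rule integral_unique)
    also have "\<dots> \<le> M * exp (-B)"
    proof -
      have "M * exp b \<le> M * exp (-B)" using that M by (intro mult_left_mono) auto
      moreover have "M * exp a \<ge> 0" using M by simp
      ultimately show ?thesis by linarith
    qed
    finally show ?thesis .
  qed
  have diff: "norm (integral {a..b} F - integral {- x..y} F) \<le> 2 * (M * exp (-B))"
    if "B \<ge> max T 0" "a \<le> -B" "b \<ge> B" "x \<ge> B" "y \<ge> B" for a b x y B
  proof -
    have split: "integral {a..b} F = integral {a..-B} F + integral {-B..B} F + integral {B..b} F" if "a \<le> -B" "b \<ge> B" for a b
    proof -
      have "integral {a..-B} F + integral {-B..b} F = integral {a..b} F"
        using that \<open>B \<ge> max T 0\<close> by (intro Henstock_Kurzweil_Integration.integral_combine int) auto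
      moreover have "integral {-B..B} F + integral {B..b} F = integral {-B..b} F"
        using that \<open>B \<ge> max T 0\<close> by (intro Henstock_Kurzweil_Integration.integral_combine int) auto
      ultimately show ?thesis by (metis add.assoc)
    qed
    have left: "norm (integral {a..-B} F - integral {a'..-B} F) \<le> M * exp (-B)" if "a \<le> a'" "a' \<le> -B" for a a'
    proof -
      have "integral {a..a'} F + integral {a'..-B} F = integral {a..-B} F"
        using that by (intro Henstock_Kurzweil_Integration.integral_combine int) auto
      hence "integral {a..-B} F - integral {a'..-B} F = integral {a..a'} F" by (simp add: algebra_simps)
      thus ?thesis using tail'[of B a' a] that \<open>B \<ge> max T 0\<close> by simp
    qed
    have right: "norm (integral {B..b} F - integral {B..b'} F) \<le> M * exp (-B)" if "b' \<le> b" "b' \<ge> B" for b b'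
    proof -
      have "integral {B..b'} F + integral {b'..b} F = integral {B..b} F"
        using that by (intro Henstock_Kurzweil_Integration.integral_combine int) auto
      hence "integral {B..b} F - integral {B..b'} F = integral {b'..b} F" by (simp add: algebra_simps)
      thus ?thesis using tail[of B b' b] that \<open>B \<ge> max T 0\<close> by simp
    qed
    have L: "norm (integral {a..-B} F - integral {-x..-B} F) \<le> M * exp (-B)"
      using left[of a "-x"] left[of "-x" a] that by (cases "a \<le> -x") (auto simp: norm_minus_commute)
    have R: "norm (integral {B..b} F - integral {B..y} F) \<le> M * exp (-B)"
      using right[of b y] right[of y b] that by (cases "b \<le> y") (auto simp: norm_minus_commute)
    have "integral {a..b} F - integral {- x..y} F = (integral {a..-B} F - integral {-x..-B} F) + (integral {B..b} F - integral {B..y} F)"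
      using split[of a b] split[of "-x" y] that by simp
    thus ?thesis using L R norm_triangle_ineq[of "integral {a..-B} F - integral {-x..-B} F" "integral {B..b} F - integral {B..y} F"] by simp
  qed
  have main: "\<exists>B>0. \<forall>a b. ball 0 B \<subseteq> cbox a b \<longrightarrow> (\<exists>z. (F has_integral z) (cbox a b) \<and> norm (z - I) < e)"
    if e: "e > 0" for e
  proof -
    define B where "B = max (max T 1) (ln (2 * M / e + 1) + 1)"
    have B: "B \<ge> max T 0" "B > 0" by (auto simp: B_def)
    have small: "2 * (M * exp (-B)) < e"
    proof -
      have p: "2 * M / e + 1 > 0" using M e by (intro add_nonneg_pos) auto
      have "2 * M / e + 1 = exp (ln (2 * M / e + 1))" using p by simp
      also have "\<dots> \<le> exp B" by (subst exp_le_cancel_iff) (simp add: B_def)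
      finally have "2 * M / e < exp B" by simp
      thus ?thesis using e by (simp add: exp_minus field_simps)
    qed
    show "\<exists>B>0. \<forall>a b. ball 0 B \<subseteq> cbox a b \<longrightarrow> (\<exists>z. (F has_integral z) (cbox a b) \<and> norm (z - I) < e)"
    proof (intro exI[of _ B] conjI allI impI B(2))
      fix a b :: real assume sub: "ball 0 B \<subseteq> cbox a b"
      have ab: "a \<le> -B" "b \<ge> B"
      proof -
        have "closure (ball 0 B) \<subseteq> cbox a b" using sub by (intro closure_minimal) auto
        hence "cball 0 B \<subseteq> cbox a b" using B by simp
        hence "{-B..B} \<subseteq> {a..b}" by (simp add: cball_eq_atLeastAtMost cbox_interval)
        thus "a \<le> -B" "b \<ge> B" using B by auto
      qed
      have "norm (integral {a..b} F - I) \<le> 2 * (M * exp (-B))"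
      proof (rule tendsto_upperbound)
        show "(\<lambda>n. norm (integral {a..b} F - integral {- u n..v n} F)) \<longlonglongrightarrow> norm (integral {a..b} F - I)"
          by (intro tendsto_intros lim)
        show "eventually (\<lambda>n. norm (integral {a..b} F - integral {- u n..v n} F) \<le> 2 * (M * exp (-B))) sequentially"
          using u[unfolded filterlim_at_top, rule_format, of B] v[unfolded filterlim_at_top, rule_format, of B]
          by eventually_elim (rule diff[OF B(1) ab])
      qed auto
      hence "norm (integral {a..b} F - I) < e" using small by linarith
      thus "\<exists>z. (F has_integral z) (cbox a b) \<and> norm (z - I) < e"
        using integrable_integral[OF int[of a b]] by (auto simp: cbox_interval)
    qed
  qed
  show ?thesis by (subst has_integral') (use main in simp)
qed

section \<open>Where the sine is bounded below, and decay along rays\<close>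

text \<open>On these lines the modulus is cosh (\<pi> Im s): in the formula for its square the
  cosine equals -1, and y + 1/y \<ge> 2.\<close>

lemma norm_sin_pi_ge_1_half_integer:
  assumes "Re s = - (real n + 1/2)"
  shows "norm (sin (of_real pi * s)) \<ge> 1"
proof -
  define y where "y = exp (2 * Im (of_real pi * s))"
  have y: "y > 0" by (simp add: y_def)
  have "cos (2 * Re (of_real pi * s)) = cos (real (2 * n + 1) * pi)"
  proof -
    have "2 * Re (of_real pi * s) = - (real (2 * n + 1) * pi)" by (simp add: assms algebra_simps)
    thus ?thesis by (simp only: cos_minus)
  qed
  also have "\<dots> = -1" by (subst cos_npi) simp
  finally have c: "cos (2 * Re (of_real pi * s)) = -1" .
  have "norm (sin (of_real pi * s)) ^ 2 = (y + inverse y + 2) / 4"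
    unfolding norm_sin_squared c y_def by simp
  also have "\<dots> \<ge> 1"
  proof -
    have "(y - 1)\<^sup>2 \<ge> 0" by simp
    hence "y * 2 \<le> y * (y + inverse y)" using y by (simp add: power2_eq_square algebra_simps)
    hence "2 \<le> y + inverse y" using y by (simp only: mult_le_cancel_left_pos)
    thus ?thesis by simp
  qed
  finally have "1 ^ 2 \<le> norm (sin (of_real pi * s)) ^ 2" by simp
  thus ?thesis by (rule power2_le_imp_le) simp
qed

text \<open>Here 2 \<pi> |Im s| \<ge> 6, so the exponential alone is at least 6, and 6 - 2 = 4
  already gives 4 |sin|^2 \<ge> 4.\<close>

lemma norm_sin_pi_ge_1_Im:
  assumes "\<bar>Im s\<bar> \<ge> 1"
  shows "norm (sin (of_real pi * s)) \<ge> 1"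
proof -
  define t where "t = 2 * Im (of_real pi * s)"
  have "\<bar>t\<bar> = 2 * (pi * \<bar>Im s\<bar>)" by (simp add: t_def abs_mult)
  moreover have "pi * \<bar>Im s\<bar> \<ge> 3 * 1" using assms pi_gt3 by (intro mult_mono) auto
  ultimately have t6: "\<bar>t\<bar> \<ge> 6" by linarith
  have "exp \<bar>t\<bar> \<ge> 1 + \<bar>t\<bar>" by (rule exp_ge_add_one_self)
  hence "exp \<bar>t\<bar> \<ge> 6" using t6 by linarith
  moreover have "exp \<bar>t\<bar> \<le> exp t + inverse (exp t)" by (cases "t \<ge> 0") (auto simp: exp_minus)
  moreover have "4 * norm (sin (of_real pi * s)) ^ 2 = exp t + inverse (exp t) - 2 * cos (2 * Re (of_real pi * s))"
    unfolding norm_sin_squared t_def by simp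
  moreover have "cos (2 * Re (of_real pi * s)) \<le> 1" by (rule cos_le_one)
  ultimately have "1 \<le> norm (sin (of_real pi * s)) ^ 2" by linarith
  hence "1 ^ 2 \<le> norm (sin (of_real pi * s)) ^ 2" by simp
  thus ?thesis by (rule power2_le_imp_le) simp
qed

text \<open>Far out, a ray with negative cosine lies in a sector of any aperture below -cos
  \<theta>, half of which is taken; since sin \<theta> \<noteq> 0 its points leave the strip where
  the sine may be small.\<close>

lemma ray_decay:
  fixes h :: "complex \<Rightarrow> complex"
  assumes c: "cos \<theta> < 0" and s: "sin \<theta> \<noteq> 0"
    and decay: "\<And>\<eta>. \<eta> > 0 \<Longrightarrow> \<exists>\<rho>. \<forall>s. norm s \<ge> \<rho> \<longrightarrow> - Re s \<ge> \<eta> * norm s \<longrightarrow> norm (sin (of_real pi * s)) \<ge> 1 \<longrightarrow> norm (h s) \<le> exp (- norm s)"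
  obtains T where "\<And>t. t \<ge> T \<Longrightarrow> norm (h (z + of_real t * cis \<theta>)) \<le> exp (norm z) * exp (- t)"
proof -
  define \<eta> where "\<eta> = - cos \<theta> / 2"
  have \<eta>: "\<eta> > 0" "\<eta> \<le> 1" using c cos_ge_minus_one[of \<theta>] unfolding \<eta>_def by linarith+
  obtain \<rho> where \<rho>: "\<And>s. norm s \<ge> \<rho> \<Longrightarrow> - Re s \<ge> \<eta> * norm s \<Longrightarrow> norm (sin (of_real pi * s)) \<ge> 1 \<Longrightarrow> norm (h s) \<le> exp (- norm s)"
    using decay[OF \<eta>(1)] by blast
  \<comment> \<open>Beyond \<open>T\<close> the modulus exceeds \<rho>, the offset z is negligible
    in the sector inequality, t is nonnegative, and |Im s| \<ge> 1.\<close>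
  define T where "T = max (max (\<rho> + norm z) (2 * norm z / \<eta>)) (max 0 ((1 + norm z) / \<bar>sin \<theta>\<bar>))"
  show thesis
  proof (rule that[of T])
    fix t assume t: "t \<ge> T"
    have "0 \<le> T" unfolding T_def by (meson max.cobounded1 max.coboundedI2)
    hence t0: "t \<ge> 0" using t by linarith
    have t1: "t \<ge> \<rho> + norm z" and "t \<ge> 2 * norm z / \<eta>" "t \<ge> (1 + norm z) / \<bar>sin \<theta>\<bar>"
      using t by (auto simp: T_def)
    hence t2: "\<eta> * t \<ge> 2 * norm z" and t3: "t * \<bar>sin \<theta>\<bar> \<ge> 1 + norm z" using \<eta> s by (simp_all add: field_simps)
    define s where "s = z + of_real t * cis \<theta>"
    have up: "norm s \<le> norm z + t" unfolding s_def using norm_triangle_ineq[of z "of_real t * cis \<theta>"] t0 by (simp add: norm_mult)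
    have lo: "norm s \<ge> t - norm z"
      unfolding s_def using norm_triangle_ineq4[of "z + of_real t * cis \<theta>" z] t0 by (simp add: norm_mult)
    have "norm (h s) \<le> exp (- norm s)"
    proof (rule \<rho>)
      show "norm s \<ge> \<rho>" using lo t1 by linarith
      have "\<eta> * norm s \<le> \<eta> * (norm z + t)" using up \<eta> by (intro mult_left_mono) auto
      also have "\<dots> \<le> norm z + \<eta> * t" using \<eta> by (simp add: ring_distribs mult_left_le_one_le)
      also have "\<dots> \<le> 2 * (\<eta> * t) - norm z" using t2 by linarith
      also have "\<dots> \<le> - Re s"
        using abs_Re_le_cmod[of z] by (simp add: s_def \<eta>_def algebra_simps)
      finally show "\<eta> * norm s \<le> - Re s" .
      have "1 \<le> \<bar>t * sin \<theta>\<bar> - \<bar>Im z\<bar>" using t3 t0 abs_Im_le_cmod[of z] by (simp add: abs_mult)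
      also have "\<dots> \<le> \<bar>Im s\<bar>" by (simp add: s_def)
      finally show "norm (sin (of_real pi * s)) \<ge> 1" by (rule norm_sin_pi_ge_1_Im)
    qed
    also have "\<dots> \<le> exp (norm z + (- t))" using lo by simp
    finally show "norm (h (z + of_real t * cis \<theta>)) \<le> exp (norm z) * exp (- t)" unfolding s_def exp_add .
  qed
qed

text \<open>A contour whose two ends are rays into the left half-plane, closed by the vertical segment on
  the line \<open>Re s = -X\<close>; \<open>left_lo X\<close> and \<open>left_hi X\<close> are the parameters at which the lower and the upper
  ray meet that line.\<close>

locale left_contour =
  fixes \<gamma> :: "real \<Rightarrow> complex" and cp cm :: complex and \<theta>p \<theta>m R :: real
  assumes C1: "\<gamma> piecewise_C1_differentiable_on UNIV"
    and cos_p: "cos \<theta>p < 0" and cos_m: "cos \<theta>m < 0" and sin_p: "sin \<theta>p > 0" and sin_m: "sin \<theta>m < 0"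
    and ray_p: "\<And>t. t \<ge> R \<Longrightarrow> \<gamma> t = cp + of_real t * cis \<theta>p"
    and ray_m: "\<And>t. t \<ge> R \<Longrightarrow> \<gamma> (- t) = cm + of_real t * cis \<theta>m"
begin

definition left_hi :: "real \<Rightarrow> real" where "left_hi X = (- X - Re cp) / cos \<theta>p"
definition left_lo :: "real \<Rightarrow> real" where "left_lo X = (X + Re cm) / cos \<theta>m"

definition closed_contour :: "real \<Rightarrow> real \<Rightarrow> complex" where
  "closed_contour X = subpath (left_lo X) (left_hi X) \<gamma> +++ linepath (\<gamma> (left_hi X)) (\<gamma> (left_lo X))"

lemma cont: "continuous_on A \<gamma>"
  using C1 by (auto simp: piecewise_C1_differentiable_on_def intro: continuous_on_subset)

lemma left_hi_strict_mono: "X < Y \<Longrightarrow> left_hi X < left_hi Y"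
  unfolding left_hi_def using cos_p by (intro divide_strict_right_mono_neg) auto

lemma left_lo_strict_antimono: "X < Y \<Longrightarrow> left_lo Y < left_lo X"
  unfolding left_lo_def using cos_m by (intro divide_strict_right_mono_neg) auto

lemma ray_m': "t \<le> - R \<Longrightarrow> \<gamma> t = cm + of_real t * (- cis \<theta>m)"
  using ray_m[of "- t"] by simp

text \<open>X is so large that the closing segment joins points of the two rays, its upper end lying
  in the upper and its lower end in the lower half-plane, while the non-linear part of \<gamma>
  stays to the right of the line. R may be negative, hence the absolute values; the bounds 1 and -1
  force \<open>left_lo X < left_hi X\<close>.\<close>

definition far :: "real \<Rightarrow> bool" where
  "far X \<longleftrightarrow> X > 0 \<and> left_hi X \<ge> max R 1 \<and> left_lo X \<le> min (- R) (- 1) \<and> Im (\<gamma> (left_hi X)) > 0 \<and> Im (\<gamma> (left_lo X)) < 0 \<and>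
     (\<forall>t\<in>{-\<bar>R\<bar>..\<bar>R\<bar>}. Re (\<gamma> t) > - X)"

lemma filterlim_left_hi: "filterlim left_hi at_top at_top"
proof -
  have "filterlim (\<lambda>X. (- 1 / cos \<theta>p) * (Re cp + X)) at_top at_top"
    by (rule filterlim_tendsto_pos_mult_at_top[OF tendsto_const])
       (use cos_p in \<open>auto simp: divide_neg_neg intro!: filterlim_tendsto_add_at_top[OF tendsto_const] filterlim_ident\<close>)
  moreover have "(\<lambda>X. (- 1 / cos \<theta>p) * (Re cp + X)) = left_hi"
    using cos_p by (auto simp: left_hi_def fun_eq_iff divide_simps)
  ultimately show ?thesis by simp
qed

lemma filterlim_left_lo: "filterlim (\<lambda>X. - left_lo X) at_top at_top"
proof -
  have "filterlim (\<lambda>X. (- 1 / cos \<theta>m) * (Re cm + X)) at_top at_top"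
    by (rule filterlim_tendsto_pos_mult_at_top[OF tendsto_const])
       (use cos_m in \<open>auto simp: divide_neg_neg intro!: filterlim_tendsto_add_at_top[OF tendsto_const] filterlim_ident\<close>)
  moreover have "(\<lambda>X. (- 1 / cos \<theta>m) * (Re cm + X)) = (\<lambda>X. - left_lo X)"
    using cos_m by (auto simp: left_lo_def fun_eq_iff divide_simps)
  ultimately show ?thesis by simp
qed

lemma eventually_far: "eventually far at_top"
proof -
  have "compact (\<gamma> ` {-\<bar>R\<bar>..\<bar>R\<bar>})" by (intro compact_continuous_image cont) auto
  then obtain B where B: "\<And>t. t \<in> {-\<bar>R\<bar>..\<bar>R\<bar>} \<Longrightarrow> norm (\<gamma> t) \<le> B"
    by (meson bounded_iff compact_imp_bounded image_eqI)
  have 1: "eventually (\<lambda>X. left_hi X \<ge> max (max R 1) (- Im cp / sin \<theta>p + 1)) at_top"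
    using filterlim_left_hi unfolding filterlim_at_top by blast
  have 2: "eventually (\<lambda>X. - left_lo X \<ge> max (max R 1) (- Im cm / sin \<theta>m + 1)) at_top"
    using filterlim_left_lo unfolding filterlim_at_top by blast
  show ?thesis
    using 1 2 eventually_gt_at_top[of 0] eventually_gt_at_top[of B]
  proof eventually_elim
    case (elim X)
    have hi: "left_hi X \<ge> R" "left_hi X > - Im cp / sin \<theta>p" and lo: "- left_lo X \<ge> R" "- left_lo X > - Im cm / sin \<theta>m"
      using elim by auto
    have "Im (\<gamma> (left_hi X)) > 0"
      using hi(2) sin_p by (simp add: ray_p[OF hi(1)] field_simps)
    moreover have "Im (\<gamma> (left_lo X)) < 0"
    proof -
      have "\<gamma> (left_lo X) = cm + of_real (- left_lo X) * cis \<theta>m" using ray_m[OF lo(1)] by simp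
      hence "Im (\<gamma> (left_lo X)) = Im cm - left_lo X * sin \<theta>m" by simp
      moreover have "left_lo X * sin \<theta>m > Im cm" using lo(2) sin_m by (simp add: field_simps)
      ultimately show ?thesis by linarith
    qed
    moreover have "Re (\<gamma> t) > - X" if "t \<in> {-\<bar>R\<bar>..\<bar>R\<bar>}" for t
      using B[OF that] abs_Re_le_cmod[of "\<gamma> t"] elim(4) by linarith
    ultimately show ?case using elim unfolding far_def by auto
  qed
qed

lemma far_mono:
  assumes "far X" "X \<le> Y"
  shows "far Y"
proof (cases "X = Y")
  case False
  hence XY: "X < Y" using assms by simp
  have h: "left_hi X < left_hi Y" "left_lo Y < left_lo X"
    using left_hi_strict_mono left_lo_strict_antimono XY by auto
  have R: "left_hi X \<ge> R" "left_hi Y \<ge> R" "left_lo X \<le> - R" "left_lo Y \<le> - R" using assms h by (auto simp: far_def)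
  have "Im (\<gamma> (left_hi X)) \<le> Im (\<gamma> (left_hi Y))"
    using h(1) sin_p by (simp add: ray_p R)
  moreover have "Im (\<gamma> (left_lo Y)) \<le> Im (\<gamma> (left_lo X))"
    using h(2) sin_m by (simp add: ray_m' R mult_left_mono_neg)
  ultimately show ?thesis using assms h unfolding far_def by fastforce
qed (use assms in auto)

lemma farD:
  assumes "far X"
  shows "X > 0" "left_hi X \<ge> R" "left_hi X \<ge> 1" "left_lo X \<le> - R" "left_lo X \<le> -1" "left_lo X < left_hi X"
    "Im (\<gamma> (left_hi X)) > 0" "Im (\<gamma> (left_lo X)) < 0"
    "Re (\<gamma> (left_hi X)) = - X" "Re (\<gamma> (left_lo X)) = - X"
proof -
  show *: "X > 0" "left_hi X \<ge> R" "left_hi X \<ge> 1" "left_lo X \<le> - R" "left_lo X \<le> -1" "left_lo X < left_hi X"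
    "Im (\<gamma> (left_hi X)) > 0" "Im (\<gamma> (left_lo X)) < 0"
    using assms by (auto simp: far_def)
  have "Re (\<gamma> (left_hi X)) = Re cp + left_hi X * cos \<theta>p" by (simp add: ray_p[OF *(2)])
  thus "Re (\<gamma> (left_hi X)) = - X" using cos_p by (simp add: left_hi_def)
  have "Re (\<gamma> (left_lo X)) = Re cm - left_lo X * cos \<theta>m" by (simp add: ray_m'[OF *(4)])
  thus "Re (\<gamma> (left_lo X)) = - X" using cos_m by (simp add: left_lo_def)
qed

lemma Re_contour_ge:
  assumes "far X" "t \<in> {left_lo X..left_hi X}"
  shows "Re (\<gamma> t) \<ge> - X"
proof -
  consider "t \<ge> R" | "t \<le> - R" | "t \<in> {-\<bar>R\<bar>..\<bar>R\<bar>}" by fastforce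
  thus ?thesis
  proof cases
    case 1
    have "Re (\<gamma> t) = Re cp + t * cos \<theta>p" by (simp add: ray_p[OF 1])
    moreover have "t * cos \<theta>p \<ge> left_hi X * cos \<theta>p" using assms cos_p by (intro mult_right_mono_neg) auto
    moreover have "left_hi X * cos \<theta>p = - X - Re cp" using cos_p by (simp add: left_hi_def)
    ultimately show ?thesis by linarith
  next
    case 2
    have "Re (\<gamma> t) = Re cm - t * cos \<theta>m" by (simp add: ray_m'[OF 2])
    moreover have "t * cos \<theta>m \<le> left_lo X * cos \<theta>m" using assms cos_m by (intro mult_right_mono_neg) auto
    moreover have "left_lo X * cos \<theta>m = X + Re cm" using cos_m by (simp add: left_lo_def)
    ultimately show ?thesis by linarith
  next
    case 3
    thus ?thesis using assms(1) by (auto simp: far_def intro: less_imp_le)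
  qed
qed

lemma closed_contour_basics:
  assumes "far X"
  shows "valid_path (closed_contour X)" "pathfinish (closed_contour X) = pathstart (closed_contour X)"
    "path_image (closed_contour X) = \<gamma> ` {left_lo X..left_hi X} \<union> closed_segment (\<gamma> (left_hi X)) (\<gamma> (left_lo X))"
    "path_image (closed_contour X) \<subseteq> {s. Re s \<ge> - X}"
    "z \<notin> range \<gamma> \<Longrightarrow> Re z \<noteq> - X \<Longrightarrow> z \<notin> path_image (closed_contour X)"
proof -
  show "valid_path (closed_contour X)" unfolding closed_contour_def
    by (intro valid_path_join valid_path_subpath_UNIV C1 valid_path_linepath) simp
  show "pathfinish (closed_contour X) = pathstart (closed_contour X)" by (simp add: closed_contour_def)
  show img: "path_image (closed_contour X) = \<gamma> ` {left_lo X..left_hi X} \<union> closed_segment (\<gamma> (left_hi X)) (\<gamma> (left_lo X))"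
    unfolding closed_contour_def using farD(6)[OF assms]
    by (subst path_image_join) (auto simp: path_image_subpath_UNIV)
  have seg: "Re s = - X" if s: "s \<in> closed_segment (\<gamma> (left_hi X)) (\<gamma> (left_lo X))" for s
  proof -
    obtain u where u: "s = (1 - u) *\<^sub>R \<gamma> (left_hi X) + u *\<^sub>R \<gamma> (left_lo X)"
      using s unfolding closed_segment_def by blast
    show ?thesis unfolding u using farD(9,10)[OF assms] by (simp add: algebra_simps)
  qed
  show "path_image (closed_contour X) \<subseteq> {s. Re s \<ge> - X}"
    unfolding img using Re_contour_ge[OF assms] seg by fastforce
  show "z \<notin> path_image (closed_contour X)" if "z \<notin> range \<gamma>" "Re z \<noteq> - X"
    unfolding img using that seg by auto
qed

lemma contour_integral_closed_contour:
  assumes "far X" and S: "open S" "f holomorphic_on S" "range \<gamma> \<subseteq> S"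
    "closed_segment (\<gamma> (left_hi X)) (\<gamma> (left_lo X)) \<subseteq> S"
  shows "contour_integral (closed_contour X) f = integral {left_lo X..left_hi X} (\<lambda>t. f (\<gamma> t) * vector_derivative \<gamma> (at t)) +
     contour_integral (linepath (\<gamma> (left_hi X)) (\<gamma> (left_lo X))) f"
proof -
  have vp: "valid_path (subpath (left_lo X) (left_hi X) \<gamma>)" by (rule valid_path_subpath_UNIV[OF C1])
  have sub: "\<gamma> ` {left_lo X..left_hi X} \<subseteq> S" using S(3) by auto
  have "f contour_integrable_on subpath (left_lo X) (left_hi X) \<gamma>"
    by (rule contour_integrable_holomorphic_simple[OF S(2,1) vp])
       (use sub farD(6)[OF assms(1)] in \<open>simp add: path_image_subpath_UNIV\<close>)
  moreover have "f contour_integrable_on linepath (\<gamma> (left_hi X)) (\<gamma> (left_lo X))"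
    by (rule contour_integrable_holomorphic_simple[OF S(2,1)]) (use S(4) in auto)
  ultimately have "contour_integral (closed_contour X) f = contour_integral (subpath (left_lo X) (left_hi X) \<gamma>) f +
     contour_integral (linepath (\<gamma> (left_hi X)) (\<gamma> (left_lo X))) f"
    unfolding closed_contour_def using vp by simp
  also have "contour_integral (subpath (left_lo X) (left_hi X) \<gamma>) f = integral {left_lo X..left_hi X} (\<lambda>t. f (\<gamma> t) * vector_derivative \<gamma> (at t))"
    using has_integral_subpath_UNIV[OF C1 farD(6)[OF assms(1)] S(1,2) sub] by (simp add: integral_unique)
  finally show ?thesis .
qed

section \<open>Winding numbers of the closed contours\<close>

text \<open>Moving the closing line from X to Y glues on the counterclockwise quadrilateral a b c d,
  two of whose sides are pieces of the rays; its side from d to a cancels the old closing segment.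
  The computation is additivity of the integrals of 1 / (w - z).\<close>

lemma winding_number_closed_contour_step:
  assumes X: "far X" and XY: "X < Y" and z: "z \<notin> range \<gamma>" "Re z \<noteq> - X" "Re z \<noteq> - Y"
  defines "a \<equiv> \<gamma> (left_hi X)" and "b \<equiv> \<gamma> (left_hi Y)" and "c \<equiv> \<gamma> (left_lo Y)" and "d \<equiv> \<gamma> (left_lo X)"
  shows "winding_number (closed_contour Y) z = winding_number (closed_contour X) z +
    (winding_number (linepath a b) z + winding_number (linepath b c) z +
     winding_number (linepath c d) z + winding_number (linepath d a) z)"
proof -
  have Y: "far Y" using far_mono[OF X] XY by simp
  have h: "left_hi X < left_hi Y" "left_lo Y < left_lo X" using left_hi_strict_mono left_lo_strict_antimono XY by auto
  define f where "f = (\<lambda>w. 1 / (w - z))"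
  define J where "J = (\<lambda>\<alpha> \<beta>. integral {\<alpha>..\<beta>} (\<lambda>t. f (\<gamma> t) * vector_derivative \<gamma> (at t)))"
  have S: "open (- {z})" "f holomorphic_on (- {z})" "range \<gamma> \<subseteq> - {z}"
    using z(1) by (auto simp: f_def intro!: holomorphic_intros)
  have zX: "z \<notin> path_image (closed_contour X)" and zY: "z \<notin> path_image (closed_contour Y)"
    using closed_contour_basics(5)[OF X] closed_contour_basics(5)[OF Y] z by auto
  have seg: "closed_segment a d \<subseteq> - {z}" "closed_segment b c \<subseteq> - {z}"
    using zX zY closed_contour_basics(3)[OF X] closed_contour_basics(3)[OF Y] by (auto simp: a_def b_def c_def d_def)
  have cX: "contour_integral (closed_contour X) f = J (left_lo X) (left_hi X) + contour_integral (linepath a d) f"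
    using contour_integral_closed_contour[OF X S] seg by (simp add: J_def a_def d_def)
  have cY: "contour_integral (closed_contour Y) f = J (left_lo Y) (left_hi Y) + contour_integral (linepath b c) f"
    using contour_integral_closed_contour[OF Y S] seg by (simp add: J_def b_def c_def)
  have hp: "((\<lambda>t. f (\<gamma> t) * vector_derivative \<gamma> (at t)) has_integral contour_integral (linepath a b) f) {left_hi X..left_hi Y}"
    unfolding a_def b_def
  proof (rule has_integral_linear_piece[where c = cp and e = "cis \<theta>p", OF _ h(1) S(1,2)])
    show "\<gamma> ` {left_hi X..left_hi Y} \<subseteq> - {z}" using S(3) by blast
  qed (use ray_p farD(2)[OF X] in auto)
  have hm: "((\<lambda>t. f (\<gamma> t) * vector_derivative \<gamma> (at t)) has_integral contour_integral (linepath c d) f) {left_lo Y..left_lo X}"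
    unfolding c_def d_def
  proof (rule has_integral_linear_piece[where c = cm and e = "- cis \<theta>m", OF _ h(2) S(1,2)])
    show "\<gamma> ` {left_lo Y..left_lo X} \<subseteq> - {z}" using S(3) by blast
  qed (use ray_m' farD(4)[OF X] in auto)
  have int: "(\<lambda>t. f (\<gamma> t) * vector_derivative \<gamma> (at t)) integrable_on {\<alpha>..\<beta>}" if "\<alpha> < \<beta>" for \<alpha> \<beta>
    using has_integral_subpath_UNIV[OF C1 that S(1,2)] S(3) by blast
  have "J (left_lo Y) (left_hi X) + J (left_hi X) (left_hi Y) = J (left_lo Y) (left_hi Y)"
    unfolding J_def using h farD(6)[OF X] by (intro Henstock_Kurzweil_Integration.integral_combine int) auto
  moreover have "J (left_lo Y) (left_lo X) + J (left_lo X) (left_hi X) = J (left_lo Y) (left_hi X)"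
    unfolding J_def using h farD(6)[OF X] by (intro Henstock_Kurzweil_Integration.integral_combine int) auto
  moreover have "J (left_hi X) (left_hi Y) = contour_integral (linepath a b) f" "J (left_lo Y) (left_lo X) = contour_integral (linepath c d) f"
    unfolding J_def using hp hm by (auto intro: integral_unique)
  moreover have "contour_integral (linepath d a) f = - contour_integral (linepath a d) f"
    using seg by (intro contour_integral_reverse_linepath[of d a f, THEN trans]) 
      (auto simp: closed_segment_commute intro!: holomorphic_on_imp_continuous_on holomorphic_on_subset[OF S(2)])
  ultimately have eq: "contour_integral (closed_contour Y) f = contour_integral (closed_contour X) f +
     (contour_integral (linepath a b) f + contour_integral (linepath b c) f + contour_integral (linepath c d) f + contour_integral (linepath d a) f)"
    unfolding cX cY by (simp add: algebra_simps)
  have "closed_segment a b \<subseteq> \<gamma> ` {left_hi X..left_hi Y}"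
    unfolding a_def b_def
    by (rule closed_segment_linear_piece[where c = cp and e = "cis \<theta>p"]) (use ray_p farD(2)[OF X] h in auto)
  hence ab: "z \<notin> closed_segment a b" using z(1) by auto
  have "closed_segment c d \<subseteq> \<gamma> ` {left_lo Y..left_lo X}"
    unfolding c_def d_def
    by (rule closed_segment_linear_piece[where c = cm and e = "- cis \<theta>m"]) (use ray_m' farD(4)[OF X] h in auto)
  hence cd: "z \<notin> closed_segment c d" using z(1) by auto
  have bc: "z \<notin> closed_segment b c" and da: "z \<notin> closed_segment d a"
    using seg by (auto simp: closed_segment_commute)
  have W: "winding_number p z = 1 / (2 * pi * \<i>) * contour_integral p f" if "valid_path p" "z \<notin> path_image p" for p
    unfolding f_def by (rule winding_number_valid_path[OF that])
  have lp: "winding_number (linepath x y) z = 1 / (2 * pi * \<i>) * contour_integral (linepath x y) f" if "z \<notin> closed_segment x y" for x y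
    by (rule W) (use that in auto)
  show ?thesis
    unfolding W[OF closed_contour_basics(1)[OF X] zX] W[OF closed_contour_basics(1)[OF Y] zY] lp[OF ab] lp[OF bc] lp[OF cd] lp[OF da] eq
    by (simp only: ring_distribs)
qed

text \<open>The added quadrilateral lies in the half-plane Re s \<le> -X, which does not contain
  z.\<close>

lemma winding_number_closed_contour_stable:
  assumes X: "far X" and XY: "X \<le> Y" and z: "z \<notin> range \<gamma>" "Re z > - X"
  shows "winding_number (closed_contour Y) z = winding_number (closed_contour X) z"
proof (cases "X = Y")
  case False
  hence XY: "X < Y" using XY by simp
  have Y: "far Y" using far_mono[OF X] XY by simp
  have conv: "convex {s. Re s \<le> - X}" by (rule convex_halfspace_Re_le)
  show ?thesis
    using winding_number_closed_contour_step[OF X XY z(1)] z(2) XY farD(9,10)[OF X] farD(9,10)[OF Y]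
      winding_number_quadrilateral_outside[OF conv, of "\<gamma> (left_hi X)" "\<gamma> (left_hi Y)" "\<gamma> (left_lo Y)" "\<gamma> (left_lo X)" z]
    by simp
qed auto

text \<open>A component of the complement of \<gamma> may be cut by a closing segment, so the
  winding number about one fixed closed contour need not be constant on it. A path from q to r is
  compact, however: once the closing line is moved to its left, the path misses the closed
  contour.\<close>

lemma winding_number_closed_contour_connected:
  assumes S: "open S" "connected S" "S \<inter> range \<gamma> = {}" "q \<in> S" "r \<in> S"
    and X: "far X" "Re q > - X" and X': "far X'" "Re r > - X'"
  shows "winding_number (closed_contour X) q = winding_number (closed_contour X') r"
proof -
  have "path_connected S" using S by (simp add: connected_open_path_connected)
  then obtain g where g: "path g" "path_image g \<subseteq> S" "pathstart g = q" "pathfinish g = r"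
    using S unfolding path_connected_def by blast
  obtain B where B: "\<And>s. s \<in> path_image g \<Longrightarrow> norm s \<le> B"
    using compact_imp_bounded[OF compact_path_image[OF g(1)]] unfolding bounded_iff by blast
  define Y where "Y = max (max X X') (B + 1)"
  have Y: "X \<le> Y" "X' \<le> Y" "B < Y" "far Y" using far_mono[OF X(1)] by (auto simp: Y_def)
  have q: "q \<notin> range \<gamma>" and r: "r \<notin> range \<gamma>" using S by auto
  have "winding_number (closed_contour X) q = winding_number (closed_contour Y) q"
    by (rule winding_number_closed_contour_stable[OF X(1) Y(1) q X(2), symmetric])
  also have "\<dots> = winding_number (closed_contour Y) r"
  proof (rule winding_number_eq)
    show "path (closed_contour Y)" by (rule valid_path_imp_path[OF closed_contour_basics(1)[OF Y(4)]])
    show "pathfinish (closed_contour Y) = pathstart (closed_contour Y)" by (rule closed_contour_basics(2)[OF Y(4)])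
    show "connected (path_image g)" by (rule connected_path_image[OF g(1)])
    show "q \<in> path_image g" "r \<in> path_image g" using g(3,4) pathstart_in_path_image pathfinish_in_path_image by blast+
    have "s \<notin> path_image (closed_contour Y)" if s: "s \<in> path_image g" for s
    proof (rule closed_contour_basics(5)[OF Y(4)])
      show "s \<notin> range \<gamma>" using s g(2) S(3) by blast
      have "\<bar>Re s\<bar> \<le> B" using B[OF s] abs_Re_le_cmod[of s] by linarith
      thus "Re s \<noteq> - Y" using Y(3) by auto
    qed
    thus "path_image g \<inter> path_image (closed_contour Y) = {}" by blast
  qed
  also have "\<dots> = winding_number (closed_contour X') r"
    by (rule winding_number_closed_contour_stable[OF X'(1) Y(2) r X'(2)])
  finally show ?thesis .
qed

text \<open>Transport to a real point of U so far to the right that the winding number vanishes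
  there.\<close>

lemma winding_number_closed_contour_right:
  assumes U: "open U" "connected U" "U \<inter> range \<gamma> = {}" "\<And>x. x \<ge> N \<Longrightarrow> complex_of_real x \<in> U"
    and q: "q \<in> U" "far X" "Re q > - X"
  shows "winding_number (closed_contour X) q = 0"
proof -
  obtain B where B: "\<And>z. norm z \<ge> B \<Longrightarrow> winding_number (closed_contour X) z = 0"
    using winding_number_zero_at_infinity[OF valid_path_imp_path[OF closed_contour_basics(1)[OF q(2)]] closed_contour_basics(2)[OF q(2)]]
    by blast
  define r where "r = max (max N B) 0"
  have "winding_number (closed_contour X) q = winding_number (closed_contour X) (of_real r)"
    by (rule winding_number_closed_contour_connected[OF U(1-3) q(1) _ q(2,3) q(2)])
       (use U(4)[of r] farD(1)[OF q(2)] in \<open>auto simp: r_def\<close>)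
  also have "\<dots> = 0" by (rule B) (simp add: r_def)
  finally show ?thesis .
qed

text \<open>Choose an integer m > X and close at Y = m + 1. The point -m has winding number 0 about
  the contour closed at X and lies inside the quadrilateral between the two lines, so it has winding
  number 1 about the contour closed at Y. Both -m and -n belong to V, and the value is
  transported.\<close>

lemma winding_number_closed_contour_left:
  assumes V: "open V" "connected V" "V \<inter> range \<gamma> = {}" "\<And>n::nat. - complex_of_nat n \<in> V"
    and n: "far X" "real n < X"
  shows "winding_number (closed_contour X) (- of_nat n) = 1"
proof -
  obtain m :: nat where m: "real m > X" using reals_Archimedean2 by blast
  define Y where "Y = real m + 1"
  define z where "z = - complex_of_nat m"
  have XY: "X < Y" using m by (simp add: Y_def)
  have Y: "far Y" by (rule far_mono[OF n(1)]) (use XY in simp)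
  have z: "z \<notin> range \<gamma>" "Re z = - real m" "Im z = 0" using V(3,4) by (auto simp: z_def)
  define a b c d where "a = \<gamma> (left_hi X)" and "b = \<gamma> (left_hi Y)" and "c = \<gamma> (left_lo Y)" and "d = \<gamma> (left_lo X)"
  note FX = farD[OF n(1)] and FY = farD[OF Y]
  have h: "left_hi X < left_hi Y" "left_lo Y < left_lo X" using left_hi_strict_mono left_lo_strict_antimono XY by auto
  have ba: "b - a = of_real (left_hi Y - left_hi X) * cis \<theta>p"
    unfolding a_def b_def using FX(2) FY(2) by (simp add: ray_p algebra_simps)
  have dc: "d - c = of_real (left_lo X - left_lo Y) * (- cis \<theta>m)"
    unfolding c_def d_def using FX(4) FY(4) by (simp add: ray_m' algebra_simps)
  \<comment> \<open>The two sides differ by the imaginary part of |y - x|^2. For the edge from a to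
    b this gives access to the end a, whose real part -X and sign of the imaginary part are
    known.\<close>
  have Im_edge: "Im ((y - x) * cnj (y - z)) = Im ((y - x) * cnj (x - z))" for x y
    by (simp add: algebra_simps)
  have "winding_number (linepath a b) z + winding_number (linepath b c) z +
     winding_number (linepath c d) z + winding_number (linepath d a) z = 1"
  proof (rule winding_number_quadrilateral)
    have "Im ((b - a) * cnj (a - z)) = (left_hi Y - left_hi X) * (sin \<theta>p * (real m - X) - cos \<theta>p * Im a)"
      unfolding ba using FX(9) z by (simp add: a_def algebra_simps)
    also have "\<dots> > 0"
    proof -
      have "sin \<theta>p * (real m - X) > 0" using sin_p m by simp
      moreover have "cos \<theta>p * Im a < 0" using cos_p FX(7) unfolding a_def by (rule mult_neg_pos)
      ultimately show ?thesis using h(1) by (intro mult_pos_pos) auto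
    qed
    finally show "Im ((b - a) * cnj (b - z)) > 0" unfolding Im_edge[of b a] .
    have "Im ((c - b) * cnj (c - z)) = (Im b - Im c) * (Y - real m)"
      using FY(9,10) z by (simp add: b_def c_def algebra_simps)
    also have "\<dots> > 0" using FY(7,8) by (intro mult_pos_pos) (auto simp: b_def c_def Y_def)
    finally show "Im ((c - b) * cnj (c - z)) > 0" .
    have "Im ((d - c) * cnj (d - z)) = (left_lo X - left_lo Y) * (- sin \<theta>m * (real m - X) + cos \<theta>m * Im d)"
      unfolding dc using FX(10) z by (simp add: d_def algebra_simps)
    also have "\<dots> > 0"
    proof -
      have "- sin \<theta>m * (real m - X) > 0" using sin_m m by (intro mult_pos_pos) auto
      moreover have "cos \<theta>m * Im d > 0" using cos_m FX(8) unfolding d_def by (rule mult_neg_neg)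
      ultimately show ?thesis using h(2) by (intro mult_pos_pos) auto
    qed
    finally show "Im ((d - c) * cnj (d - z)) > 0" .
    have "Im ((a - d) * cnj (a - z)) = (Im a - Im d) * (real m - X)"
      using FX(9,10) z by (simp add: a_def d_def algebra_simps)
    also have "\<dots> > 0" using FX(7,8) m by (intro mult_pos_pos) (auto simp: a_def d_def)
    finally show "Im ((a - d) * cnj (a - z)) > 0" .
  qed
  \<comment> \<open>-m lies to the left of the line Re s = -X, and the closed contour lies in the
    half-plane to its right.\<close>
  moreover have "winding_number (closed_contour X) z = 0"
    by (rule winding_number_zero_outside[where s = "{s. Re s \<ge> - X}"])
       (use closed_contour_basics[OF n(1)] m z convex_halfspace_Re_ge[of "- X"] in \<open>auto simp: valid_path_imp_path\<close>)
  ultimately have 1: "winding_number (closed_contour Y) z = 1"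
    using winding_number_closed_contour_step[OF n(1) XY z(1)] m z(2) by (simp add: a_def b_def c_def d_def Y_def)
  have "winding_number (closed_contour X) (- of_nat n) = winding_number (closed_contour Y) z"
    by (rule winding_number_closed_contour_connected[OF V(1-3) V(4) _ n(1) _ Y])
       (use V(4) n z in \<open>auto simp: z_def Y_def\<close>)
  thus ?thesis using 1 by simp
qed

section \<open>The residue theorem and the limit of the closed contours\<close>

text \<open>Singularities in \<Lambda> lie in the right component and have winding number 0; the
  points -n with n > N lie to the left of the closing line; only -n with n \<le> N count, each
  once.\<close>

lemma contour_integral_closed_contour_residues:
  assumes U: "open U" "connected U" "U \<inter> range \<gamma> = {}" "\<And>x. x \<ge> N0 \<Longrightarrow> complex_of_real x \<in> U"
    and V: "open V" "connected V" "V \<inter> range \<gamma> = {}" "\<And>n::nat. - complex_of_nat n \<in> V"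
    and \<Lambda>: "\<Lambda> \<subseteq> U" "\<And>q. q \<in> \<Lambda> \<Longrightarrow> Re q > 0" "\<And>r. finite (\<Lambda> \<inter> ball 0 r)"
    and h: "h holomorphic_on - (range (\<lambda>n. - of_nat n) \<union> \<Lambda>)"
    and X: "far (real N + 1/2)"
  shows "contour_integral (closed_contour (real N + 1/2)) h = 2 * pi * \<i> * (\<Sum>n\<le>N. residue h (- of_nat n))"
proof -
  define X where "X = real N + 1/2"
  have fX: "far X" using X by (simp add: X_def)
  define p where "p = closed_contour X"
  note basics = closed_contour_basics[OF fX, folded p_def]
  define Z where "Z = range (\<lambda>n. - complex_of_nat n) \<union> \<Lambda>"
  obtain B where B: "path_image p \<subseteq> ball 0 B"
    using bounded_subset_ballD[OF bounded_path_image[OF valid_path_imp_path[OF basics(1)]], of 0] by blast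
  \<comment> \<open>The disc must contain the contour and also all the points that contribute, hence
    the second entry.\<close>
  define r where "r = max B (real N + 1)"
  have pr: "path_image p \<subseteq> ball 0 r" using B by (auto simp: r_def)
  define pts where "pts = Z \<inter> ball 0 r"
  have fin: "finite pts"
  proof -
    show ?thesis unfolding pts_def Z_def Int_Un_distrib2 using \<Lambda>(3) finite_nonpos_integers_ball by simp
  qed
  have avoid: "z \<notin> path_image p" if z: "z \<in> Z" for z
  proof (rule basics(5))
    have "z \<in> U \<union> V" using z \<Lambda>(1) V(4) by (auto simp: Z_def)
    thus "z \<notin> range \<gamma>" using U(3) V(3) by blast
    show "Re z \<noteq> - X"
    proof (cases "z \<in> \<Lambda>")
      case True
      hence "Re z > 0" by (rule \<Lambda>(2))
      thus ?thesis using farD(1)[OF fX] by linarith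
    next
      case False
      then obtain n where "z = - of_nat n" using z by (auto simp: Z_def)
      moreover have "real n \<noteq> real N + 1/2"
      proof
        assume "real n = real N + 1/2"
        hence "real (2 * n) = real (2 * N + 1)" by simp
        hence "2 * n = 2 * N + 1" by (subst (asm) of_nat_eq_iff)
        thus False by presburger
      qed
      ultimately show ?thesis by (simp add: X_def)
    qed
  qed
  have "contour_integral p h = 2 * pi * \<i> * (\<Sum>z\<in>pts. winding_number p z * residue h z)"
  proof (rule Residue_theorem[of "ball 0 r"])
    show "h holomorphic_on ball 0 r - pts" by (rule holomorphic_on_subset[OF h]) (auto simp: pts_def Z_def)
    show "path_image p \<subseteq> ball 0 r - pts" using pr avoid by (auto simp: pts_def)
    show "\<forall>z. z \<notin> ball 0 r \<longrightarrow> winding_number p z = 0"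
      using winding_number_zero_outside[OF valid_path_imp_path[OF basics(1)] convex_ball basics(2) _ pr] by blast
  qed (use fin basics(1,2) in auto)
  also have "(\<Sum>z\<in>pts. winding_number p z * residue h z) = (\<Sum>z\<in>(\<lambda>n. - of_nat n) ` {..N}. residue h z)"
  proof (rule sum.mono_neutral_cong_right[OF fin])
    show "(\<lambda>n. - of_nat n) ` {..N} \<subseteq> pts"
    proof
      fix z assume "z \<in> (\<lambda>n. - complex_of_nat n) ` {..N}"
      then obtain n where n: "n \<le> N" "z = - of_nat n" by auto
      hence "norm z < r" by (simp add: r_def)
      thus "z \<in> pts" using n by (simp add: pts_def Z_def)
    qed
    show "\<forall>z\<in>pts - (\<lambda>n. - of_nat n) ` {..N}. winding_number p z * residue h z = 0"
    proof
      fix z assume z: "z \<in> pts - (\<lambda>n. - of_nat n) ` {..N}"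
      have "winding_number p z = 0"
      proof (cases "z \<in> \<Lambda>")
        case True
        have "Re z > - X" using \<Lambda>(2)[OF True] farD(1)[OF fX] by simp
        thus ?thesis unfolding p_def using winding_number_closed_contour_right[OF U _ fX] True \<Lambda>(1) by blast
      next
        case False
        then obtain n where n: "z = - of_nat n" using z by (auto simp: pts_def Z_def)
        hence "n > N" using z by force
        hence "Re z < - X" using n by (simp add: X_def)
        thus ?thesis
          by (intro winding_number_zero_outside[where s = "{s. Re s \<ge> - X}"])
             (use basics convex_halfspace_Re_ge[of "- X"] in \<open>auto simp: valid_path_imp_path\<close>)
      qed
      thus "winding_number p z * residue h z = 0" by simp
    qed
    fix z assume "z \<in> (\<lambda>n. - complex_of_nat n) ` {..N}"
    then obtain n where n: "n \<le> N" "z = - of_nat n" by auto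
    have "winding_number p z = 1" unfolding p_def n
      by (rule winding_number_closed_contour_left[OF V fX]) (use n in \<open>simp add: X_def\<close>)
    thus "winding_number p z * residue h z = residue h z" by simp
  qed
  also have "\<dots> = (\<Sum>n\<le>N. residue h (- of_nat n))"
    by (subst sum.reindex) (auto simp: inj_on_def)
  finally show ?thesis by (simp add: p_def X_def)
qed

text \<open>The rays have fixed slopes, so they meet the line Re s = -X at distance O(X).
  Consequently the closing segments all lie in the sector -Re s \<ge> |s| / C, where the decay
  hypothesis applies.\<close>

lemma norm_contour_le:
  obtains C where "C \<ge> 1" "\<And>X. far X \<Longrightarrow> X \<ge> 1 \<Longrightarrow> norm (\<gamma> (left_hi X)) \<le> C * X \<and> norm (\<gamma> (left_lo X)) \<le> C * X"
proof -
  have aux: "norm c + (X + norm c) / (- k) \<le> (norm c + (1 + norm c) / (- k)) * X" if "X \<ge> 1" "k < 0" for X k :: real and c :: complex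
  proof -
    have "norm c * 1 \<le> norm c * X" using that by (intro mult_left_mono) auto
    hence "norm c \<le> norm c * X" "X + norm c \<le> (1 + norm c) * X" by (auto simp: ring_distribs)
    hence "norm c + (X + norm c) / (- k) \<le> norm c * X + (1 + norm c) * X / (- k)"
      using that(2) by (intro add_mono divide_right_mono) auto
    thus ?thesis by (simp add: ring_distribs)
  qed
  define Cp Cm where "Cp = norm cp + (1 + norm cp) / (- cos \<theta>p)" and "Cm = norm cm + (1 + norm cm) / (- cos \<theta>m)"
  have "norm (\<gamma> (left_hi X)) \<le> max 1 (max Cp Cm) * X \<and> norm (\<gamma> (left_lo X)) \<le> max 1 (max Cp Cm) * X" if X: "far X" "X \<ge> 1" for X
  proof -
    note F = farD[OF X(1)]
    have "norm (\<gamma> (left_hi X)) \<le> norm cp + left_hi X"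
      using norm_triangle_ineq[of cp "of_real (left_hi X) * cis \<theta>p"] F(3) by (simp add: ray_p[OF F(2)] norm_mult)
    also have "norm cp + left_hi X = norm cp + (X + Re cp) / (- cos \<theta>p)" unfolding left_hi_def using cos_p by (simp add: divide_simps)
    also have "norm cp + (X + Re cp) / (- cos \<theta>p) \<le> norm cp + (X + norm cp) / (- cos \<theta>p)"
      using cos_p complex_Re_le_cmod[of cp] by (intro add_mono divide_right_mono) auto
    also have "\<dots> \<le> Cp * X" unfolding Cp_def by (rule aux[OF X(2) cos_p])
    also have "\<dots> \<le> max 1 (max Cp Cm) * X" using X(2) by (intro mult_right_mono) auto
    finally have 1: "norm (\<gamma> (left_hi X)) \<le> max 1 (max Cp Cm) * X" .
    have "norm (\<gamma> (left_lo X)) \<le> norm cm + (- left_lo X)"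
      using norm_triangle_ineq[of cm "of_real (left_lo X) * - cis \<theta>m"] F(5) by (simp add: ray_m'[OF F(4)] norm_mult)
    also have "norm cm + (- left_lo X) = norm cm + (X + Re cm) / (- cos \<theta>m)" unfolding left_lo_def using cos_m by (simp add: divide_simps)
    also have "norm cm + (X + Re cm) / (- cos \<theta>m) \<le> norm cm + (X + norm cm) / (- cos \<theta>m)"
      using cos_m complex_Re_le_cmod[of cm] by (intro add_mono divide_right_mono) auto
    also have "\<dots> \<le> Cm * X" unfolding Cm_def by (rule aux[OF X(2) cos_m])
    also have "\<dots> \<le> max 1 (max Cp Cm) * X" using X(2) by (intro mult_right_mono) auto
    finally show ?thesis using 1 by blast
  qed
  thus thesis using that[of "max 1 (max Cp Cm)"] by auto
qed

text \<open>The closing segments contribute O(X exp (-X)), so the integrals over the pieces of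
  \<gamma> tend to the sum of the residues; the decay along the rays upgrades this limit along a
  sequence to an integral over the whole line.\<close>

theorem has_integral_left_contour:
  assumes U: "open U" "connected U" "U \<inter> range \<gamma> = {}" "\<And>x. x \<ge> N0 \<Longrightarrow> complex_of_real x \<in> U"
    and V: "open V" "connected V" "V \<inter> range \<gamma> = {}" "\<And>n::nat. - complex_of_nat n \<in> V"
    and \<Lambda>: "\<Lambda> \<subseteq> U" "\<And>q. q \<in> \<Lambda> \<Longrightarrow> Re q > 0" "\<And>r. finite (\<Lambda> \<inter> ball 0 r)"
    and h: "h holomorphic_on - (range (\<lambda>n. - of_nat n) \<union> \<Lambda>)" "closed (range (\<lambda>n. - complex_of_nat n) \<union> \<Lambda>)"
    and decay: "\<And>\<eta>. \<eta> > 0 \<Longrightarrow> \<exists>\<rho>. \<forall>s. norm s \<ge> \<rho> \<longrightarrow> - Re s \<ge> \<eta> * norm s \<longrightarrow> norm (sin (of_real pi * s)) \<ge> 1 \<longrightarrow> norm (h s) \<le> exp (- norm s)"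
    and sums: "(\<lambda>n. residue h (- of_nat n)) sums v"
  shows "((\<lambda>t. h (\<gamma> t) * vector_derivative \<gamma> (at t)) has_integral (2 * of_real pi * \<i> * v)) UNIV"
proof -
  define S where "S = - (range (\<lambda>n. - complex_of_nat n) \<union> \<Lambda>)"
  have S: "open S" "h holomorphic_on S" unfolding S_def by (rule open_Compl[OF h(2)] h(1))+
  have rS: "range \<gamma> \<subseteq> S" using U(3) V(3,4) \<Lambda>(1) unfolding S_def by blast
  define F where "F = (\<lambda>t. h (\<gamma> t) * vector_derivative \<gamma> (at t))"
  have int: "F integrable_on {a..b}" for a b
  proof (cases "a < b")
    case True
    thus ?thesis using has_integral_subpath_UNIV[OF C1 True S] rS unfolding F_def by blast
  next
    case False
    hence "{a..b} = {} \<or> {a..b} = {a}" by auto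
    thus ?thesis using integrable_on_refl[of F a] by (auto simp: cbox_interval)
  qed
  obtain Tp where Tp: "\<And>t. t \<ge> Tp \<Longrightarrow> norm (h (cp + of_real t * cis \<theta>p)) \<le> exp (norm cp) * exp (- t)"
    using ray_decay[OF cos_p _ decay, of cp] sin_p by force
  obtain Tm where Tm: "\<And>t. t \<ge> Tm \<Longrightarrow> norm (h (cm + of_real t * cis \<theta>m)) \<le> exp (norm cm) * exp (- t)"
    using ray_decay[OF cos_m _ decay, of cm] sin_m by force
  \<comment> \<open>The extra 1 puts t strictly inside the open half-line on which \<gamma> is
    linear, so that its derivative there has modulus 1.\<close>
  define T where "T = max (max Tp Tm) (\<bar>R\<bar> + 1)"
  have tail: "norm (F t) \<le> (exp (norm cp) + exp (norm cm)) * exp (- \<bar>t\<bar>)" if t: "\<bar>t\<bar> \<ge> T" for t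
  proof (cases "t \<ge> 0")
    case True
    hence "t > R" "t \<ge> Tp" using t by (auto simp: T_def)
    have "vector_derivative \<gamma> (at t) = cis \<theta>p"
    proof (rule vector_derivative_at, rule has_vector_derivative_transform_within_open)
      show "((\<lambda>t. cp + complex_of_real t * cis \<theta>p) has_vector_derivative cis \<theta>p) (at t)" by (rule line_has_vector_derivative)
    qed (use ray_p \<open>t > R\<close> in \<open>auto intro: open_greaterThan[of R]\<close>)
    hence "norm (F t) = norm (h (cp + of_real t * cis \<theta>p))" using ray_p[of t] \<open>t > R\<close> by (simp add: F_def norm_mult)
    also have "\<dots> \<le> exp (norm cp) * exp (- t)" by (rule Tp) fact
    also have "\<dots> \<le> (exp (norm cp) + exp (norm cm)) * exp (- \<bar>t\<bar>)" using True by (simp add: mult_right_mono)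
    finally show ?thesis .
  next
    case False
    hence "t < - R" "- t \<ge> Tm" using t by (auto simp: T_def)
    have "vector_derivative \<gamma> (at t) = - cis \<theta>m"
    proof (rule vector_derivative_at, rule has_vector_derivative_transform_within_open)
      show "((\<lambda>t. cm + complex_of_real t * (- cis \<theta>m)) has_vector_derivative - cis \<theta>m) (at t)" by (rule line_has_vector_derivative)
    qed (use ray_m' \<open>t < - R\<close> in \<open>auto intro: open_lessThan[of "- R"]\<close>)
    hence "norm (F t) = norm (h (cm + of_real (- t) * cis \<theta>m))" using ray_m'[of t] \<open>t < - R\<close> by (simp add: F_def norm_mult)
    also have "\<dots> \<le> exp (norm cm) * exp (- (- t))" by (rule Tm) fact
    also have "\<dots> \<le> (exp (norm cp) + exp (norm cm)) * exp (- \<bar>t\<bar>)" using False by (simp add: mult_right_mono)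
    finally show ?thesis .
  qed
  \<comment> \<open>Half-integers pass between consecutive poles of 1 / sin (\<pi> s) and make the
    sine at least 1 in modulus on the whole line.\<close>
  define X where "X = (\<lambda>n. real n + 1/2)"
  have Xlim: "filterlim X at_top sequentially"
    unfolding X_def using filterlim_tendsto_add_at_top[OF tendsto_const filterlim_real_sequentially, of "1/2"] by (simp add: add.commute)
  have evfar: "eventually (\<lambda>n. far (X n) \<and> X n \<ge> 1) sequentially"
    using filterlim_compose[OF _ Xlim, of _ at_top] eventually_compose_filterlim[OF eventually_far Xlim]
      eventually_compose_filterlim[OF eventually_ge_at_top[of 1] Xlim] by (auto intro: eventually_conj)
  obtain C where C: "C \<ge> 1" "\<And>X. far X \<Longrightarrow> X \<ge> 1 \<Longrightarrow> norm (\<gamma> (left_hi X)) \<le> C * X \<and> norm (\<gamma> (left_lo X)) \<le> C * X"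
    using norm_contour_le by metis
  obtain \<rho> where \<rho>: "\<And>s. norm s \<ge> \<rho> \<Longrightarrow> - Re s \<ge> 1 / C * norm s \<Longrightarrow> norm (sin (of_real pi * s)) \<ge> 1 \<Longrightarrow> norm (h s) \<le> exp (- norm s)"
    using decay[of "1 / C"] C(1) by force
  define seg where "seg = (\<lambda>n. contour_integral (linepath (\<gamma> (left_hi (X n))) (\<gamma> (left_lo (X n)))) h)"
  define J where "J = (\<lambda>n. integral {left_lo (X n)..left_hi (X n)} F)"
  have key: "norm (seg n) \<le> 2 * C * (X n ^ 1 / exp (X n)) \<and> J n = 2 * pi * \<i> * (\<Sum>k\<le>n. residue h (- of_nat k)) - seg n"
    if n: "far (X n)" "X n \<ge> 1" "X n \<ge> \<rho>" for n
  proof -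
    define a d where "a = \<gamma> (left_hi (X n))" and "d = \<gamma> (left_lo (X n))"
    have ad: "norm a \<le> C * X n" "norm d \<le> C * X n" using C(2)[OF n(1,2)] by (auto simp: a_def d_def)
    have Re_ad: "Re a = - X n" "Re d = - X n" using farD(9,10)[OF n(1)] by (auto simp: a_def d_def)
    have segD: "Re s = - X n \<and> norm s \<le> C * X n \<and> X n \<le> norm s \<and> norm (sin (of_real pi * s)) \<ge> 1" if s: "s \<in> closed_segment a d" for s
    proof -
      obtain u where u: "s = (1 - u) *\<^sub>R a + u *\<^sub>R d" using s unfolding closed_segment_def by blast
      have Re: "Re s = - X n" unfolding u using Re_ad by (simp add: algebra_simps)
      have "closed_segment a d \<subseteq> cball 0 (C * X n)" using ad by (intro closed_segment_subset convex_cball) auto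
      hence "norm s \<le> C * X n" using s by auto
      moreover have "X n \<le> norm s" using Re abs_Re_le_cmod[of s] n(2) by linarith
      moreover have "norm (sin (of_real pi * s)) \<ge> 1"
        by (rule norm_sin_pi_ge_1_half_integer[of _ n]) (simp add: Re X_def)
      ultimately show ?thesis using Re by blast
    qed
    have segS: "closed_segment a d \<subseteq> S"
    proof
      fix s assume s: "s \<in> closed_segment a d"
      have "s \<notin> range (\<lambda>n. - complex_of_nat n)"
      proof
        assume "s \<in> range (\<lambda>n. - complex_of_nat n)"
        then obtain m where m: "s = - of_nat m" by blast
        have "of_real pi * s = complex_of_real (- (real m * pi))" by (simp add: m)
        hence "sin (of_real pi * s) = 0" by (simp only: sin_of_real sin_minus sin_npi) simp
        thus False using segD[OF s] by simp
      qed
      moreover have "s \<notin> \<Lambda>" using \<Lambda>(2)[of s] segD[OF s] n(2) by auto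
      ultimately show "s \<in> S" by (simp add: S_def)
    qed
    have "h contour_integrable_on linepath a d"
      by (rule contour_integrable_holomorphic_simple[OF S(2,1)]) (use segS in auto)
    hence "norm (seg n) \<le> exp (- X n) * norm (d - a)"
      unfolding seg_def a_def [symmetric] d_def [symmetric]
    proof (rule contour_integral_bound_linepath)
      fix s assume s: "s \<in> closed_segment a d"
      note D = segD[OF s]
      have "1 / C * norm s \<le> 1 / C * (C * X n)" using D C(1) by (intro mult_left_mono) auto
      hence "- Re s \<ge> 1 / C * norm s" using D C(1) by simp
      hence "norm (h s) \<le> exp (- norm s)" using \<rho>[of s] D n(3) by force
      also have "\<dots> \<le> exp (- X n)" using D by simp
      finally show "norm (h s) \<le> exp (- X n)" .
    qed auto
    also have "norm (d - a) \<le> 2 * C * X n" using ad norm_triangle_ineq4[of d a] by simp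
    finally have "norm (seg n) \<le> exp (- X n) * (2 * C * X n)" by (simp add: mult_left_mono)
    hence 1: "norm (seg n) \<le> 2 * C * (X n ^ 1 / exp (X n))" by (simp add: exp_minus field_simps)
    have "contour_integral (closed_contour (X n)) h = J n + seg n"
      unfolding J_def F_def seg_def
      by (rule contour_integral_closed_contour[OF n(1) S rS]) (use segS in \<open>simp add: a_def d_def\<close>)
    moreover have "contour_integral (closed_contour (X n)) h = 2 * pi * \<i> * (\<Sum>k\<le>n. residue h (- of_nat k))"
      unfolding X_def by (rule contour_integral_closed_contour_residues[OF U V \<Lambda> h(1) n(1)[unfolded X_def]])
    ultimately show ?thesis using 1 by (simp add: algebra_simps)
  qed
  have evkey: "eventually (\<lambda>n. norm (seg n) \<le> 2 * C * (X n ^ 1 / exp (X n)) \<and> J n = 2 * pi * \<i> * (\<Sum>k\<le>n. residue h (- of_nat k)) - seg n) sequentially"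
    using evfar eventually_compose_filterlim[OF eventually_ge_at_top[of \<rho>] Xlim]
    by eventually_elim (use key in blast)
  have "(\<lambda>n. 2 * C * (X n ^ 1 / exp (X n))) \<longlonglongrightarrow> 2 * C * 0"
    by (intro tendsto_mult tendsto_const filterlim_compose[OF tendsto_power_div_exp_0 Xlim])
  hence "seg \<longlonglongrightarrow> 0"
    by (intro Lim_null_comparison[of seg]) (use evkey in \<open>auto elim: eventually_mono\<close>)
  moreover have "(\<lambda>n. \<Sum>k\<le>n. residue h (- of_nat k)) \<longlonglongrightarrow> v" using sums by (simp add: sums_def_le)
  ultimately have "(\<lambda>n. 2 * pi * \<i> * (\<Sum>k\<le>n. residue h (- of_nat k)) - seg n) \<longlonglongrightarrow> 2 * pi * \<i> * v - 0"
    by (intro tendsto_intros)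
  moreover have "eventually (\<lambda>n. 2 * pi * \<i> * (\<Sum>k\<le>n. residue h (- of_nat k)) - seg n = J n) sequentially"
    using evkey by eventually_elim simp
  ultimately have Jlim: "J \<longlonglongrightarrow> 2 * of_real pi * \<i> * v"
    by (simp add: Lim_transform_eventually)
  have "(F has_integral (2 * of_real pi * \<i> * v)) UNIV"
  proof (rule has_integral_UNIV_of_exponential_tails[OF int tail])
    show "filterlim (\<lambda>n. - left_lo (X n)) at_top sequentially" by (rule filterlim_compose[OF filterlim_left_lo Xlim])
    show "filterlim (\<lambda>n. left_hi (X n)) at_top sequentially" by (rule filterlim_compose[OF filterlim_left_hi Xlim])
    show "(\<lambda>n. integral {- (- left_lo (X n))..left_hi (X n)} F) \<longlonglongrightarrow> 2 * of_real pi * \<i> * v"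
      using Jlim unfolding J_def by simp
  qed
  thus ?thesis unfolding F_def .
qed

end

section \<open>The Kilbas-Saigo function\<close>

lemma prod_list_map_nth:
  fixes f :: "'a \<Rightarrow> complex"
  shows "(\<Prod>x\<leftarrow>xs. f x) = (\<Prod>j<length xs. f (xs ! j))"
  by (induction xs) (simp_all add: prod.lessThan_Suc_shift del: prod.lessThan_Suc)

lemma summable_of_superexponential_decay:
  fixes c :: "nat \<Rightarrow> complex"
  assumes "\<And>K. \<exists>N. \<forall>n\<ge>N. norm (c n) \<le> exp (- K * real n)"
  shows "summable (\<lambda>n. c n * z ^ n)"
proof -
  \<comment> \<open>The logarithm outweighs |z|^n, and the additional 1 leaves a geometric series of
    ratio exp (-1).\<close>
  define K where "K = ln (norm z + 1) + 1"
  obtain N where N: "\<And>n. n \<ge> N \<Longrightarrow> norm (c n) \<le> exp (- K * real n)" using assms by blast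
  have z1: "norm z + 1 > 0" by (intro add_nonneg_pos) auto
  have le: "norm (c n * z ^ n) \<le> exp (- 1) ^ n" if "n \<ge> N" for n
  proof -
    have "norm z ^ n \<le> (norm z + 1) ^ n" by (intro power_mono) auto
    also have "\<dots> = exp (real n * ln (norm z + 1))" using z1 by (simp add: exp_of_nat_mult)
    finally have "norm (c n) * norm z ^ n \<le> exp (- K * real n) * exp (real n * ln (norm z + 1))"
      using N[OF that] by (intro mult_mono) auto
    also have "\<dots> = exp (real n * (- 1))" unfolding exp_add [symmetric] K_def by (simp add: algebra_simps)
    also have "\<dots> = exp (- 1) ^ n" by (rule exp_of_nat_mult)
    finally show ?thesis by (simp add: norm_mult norm_power)
  qed
  have "summable (\<lambda>n. exp (- 1 :: real) ^ n)" by (rule summable_geometric) simp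
  thus ?thesis by (rule summable_comparison_test') (rule le)
qed

lemma holomorphic_of_entire_power_series:
  fixes c :: "nat \<Rightarrow> complex"
  assumes "\<And>z. summable (\<lambda>n. c n * z ^ n)"
  shows "(\<lambda>z. \<Sum>n. c n * z ^ n) holomorphic_on UNIV"
proof -
  have "(\<lambda>z. \<Sum>n. c n * z ^ n) holomorphic_on ball 0 r" for r
    by (rule power_series_holomorphic[where a = c]) (use assms in \<open>simp add: summable_sums\<close>)
  hence "(\<lambda>z. \<Sum>n. c n * z ^ n) holomorphic_on (\<Union>r\<in>UNIV. ball 0 r)"
    by (intro holomorphic_on_UN_open) auto
  moreover have "(\<Union>r\<in>UNIV. ball (0::complex) r) = UNIV"
    by (auto intro: gt_ex)
  ultimately show ?thesis by simp
qed

section \<open>An explicit admissible contour\<close>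

text \<open>The two rays at angles 3 \<pi>/4 and -3 \<pi>/4 from the real point c, parametrised with
  unit speed; as a set it is Re s = c - |Im s|. It witnesses that admissible contours exist.\<close>

definition wedge :: "real \<Rightarrow> real \<Rightarrow> complex" where
  "wedge c t = Complex (c - sqrt 2 / 2 * \<bar>t\<bar>) (sqrt 2 / 2 * t)"

lemma cis_three_quarters: "cis (3 * pi / 4) = Complex (- (sqrt 2 / 2)) (sqrt 2 / 2)"
proof -
  have "3 * pi / 4 = pi - pi / 4" by simp
  hence "cos (3 * pi / 4) = - cos (pi / 4)" "sin (3 * pi / 4) = sin (pi / 4)"
    by (simp_all only: cos_pi_minus sin_pi_minus)
  thus ?thesis by (simp add: cis.ctr cos_45 sin_45)
qed

lemma wedge_pos: "t \<ge> 0 \<Longrightarrow> wedge c t = of_real c + of_real t * cis (3 * pi / 4)"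
  unfolding wedge_def cis_three_quarters by (simp add: complex_eq_iff)

lemma wedge_neg: "t \<ge> 0 \<Longrightarrow> wedge c (- t) = of_real c + of_real t * cis (- (3 * pi / 4))"
  unfolding wedge_def cis_cnj [symmetric] cis_three_quarters by (simp add: complex_eq_iff)

lemma wedge_C1: "wedge c piecewise_C1_differentiable_on UNIV"
  unfolding piecewise_C1_differentiable_on_def
proof (intro conjI exI[of _ "{0}"])
  show "continuous_on UNIV (wedge c)"
  proof -
    have "wedge c = (\<lambda>t. of_real (c - sqrt 2 / 2 * \<bar>t\<bar>) + \<i> * of_real (sqrt 2 / 2 * t))"
      by (auto simp: wedge_def complex_eq_iff)
    thus ?thesis by (auto intro!: continuous_intros)
  qed
  define D where "D = (\<lambda>t. of_real (- (sqrt 2 / 2) * sgn t) + \<i> * of_real (sqrt 2 / 2))"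
  have "(wedge c has_vector_derivative D t) (at t)" if t: "t \<noteq> 0" for t
  proof (cases "t > 0")
    case True
    have "D t = cis (3 * pi / 4)" using True by (simp add: D_def cis_three_quarters complex_eq_iff)
    moreover have "(wedge c has_vector_derivative cis (3 * pi / 4)) (at t)"
      by (rule has_vector_derivative_transform_within_open[OF line_has_vector_derivative[of "of_real c"] open_greaterThan[of 0]])
         (use True in \<open>auto simp: wedge_pos\<close>)
    ultimately show ?thesis by simp
  next
    case False
    hence t: "t < 0" using t by simp
    have "D t = - cis (- (3 * pi / 4))" using t by (simp add: D_def cis_cnj [symmetric] cis_three_quarters complex_eq_iff)
    moreover have "(wedge c has_vector_derivative - cis (- (3 * pi / 4))) (at t)"
    proof (rule has_vector_derivative_transform_within_open[OF line_has_vector_derivative[of "of_real c"] open_lessThan[of 0]])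
      show "of_real c + of_real s * - cis (- (3 * pi / 4)) = wedge c s" if "s \<in> {..<0}" for s
        using wedge_neg[of "- s" c] that by simp
    qed (use t in auto)
    ultimately show ?thesis by simp
  qed
  moreover have "continuous_on (UNIV - {0}) D"
    unfolding D_def by (intro continuous_intros) auto
  ultimately show "wedge c C1_differentiable_on UNIV - {0}"
    unfolding C1_differentiable_on_def by (intro exI[of _ D]) auto
qed auto

text \<open>The complement splits according to the sign of Re s - c + |Im s|; on the real axis this
  is the sign of Re s - c, so real pole sets separated by c fall on the correct sides.\<close>

lemma wedge_K_contour:
  assumes "\<mu> < 0"
    and \<Lambda>p: "\<And>s. s \<in> \<Lambda>p \<Longrightarrow> s \<in> \<real> \<and> Re s > c" and \<Lambda>m: "\<And>s. s \<in> \<Lambda>m \<Longrightarrow> s \<in> \<real> \<and> Re s < c"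
  shows "K_contour \<Lambda>p \<Lambda>m (complex_of_real \<mu>) (wedge c)"
  unfolding K_contour_def
proof (intro conjI)
  show "wedge c piecewise_C1_differentiable_on UNIV" by (rule wedge_C1)
  show "inj (wedge c)" by (auto simp: inj_def wedge_def)
  have "\<mu> * - (sqrt 2 / 2) > 0" using assms(1) by (intro mult_neg_neg) auto
  hence re: "Re (complex_of_real \<mu> * cis (3 * pi / 4)) > 0" "Re (complex_of_real \<mu> * cis (- (3 * pi / 4))) > 0"
    unfolding cis_cnj [symmetric] cis_three_quarters by simp_all
  show "\<exists>\<theta>p \<theta>m cp cm R. 0 < \<theta>p \<and> \<theta>p < pi \<and> - pi < \<theta>m \<and> \<theta>m < 0 \<and>
        Re (complex_of_real \<mu> * cis \<theta>p) > 0 \<and> Re (complex_of_real \<mu> * cis \<theta>m) > 0 \<and>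
        (\<forall>t\<ge>R. wedge c t = cp + of_real t * cis \<theta>p) \<and>
        (\<forall>t\<ge>R. wedge c (- t) = cm + of_real t * cis \<theta>m)"
    by (rule exI[of _ "3 * pi / 4"], rule exI[of _ "- (3 * pi / 4)"], rule exI[of _ "of_real c"], rule exI[of _ "of_real c"], rule exI[of _ 0])
       (use re wedge_pos wedge_neg in auto)
  define U where "U = {s. Re s > c - \<bar>Im s\<bar>}"
  define V where "V = {s. Re s < c - \<bar>Im s\<bar>}"
  have op: "open U" "open V" unfolding U_def V_def by (intro open_Collect_less continuous_intros)+
  have seg: "\<exists>u. 0 \<le> u \<and> u \<le> 1 \<and> Re s = (1 - u) * x + u * Re y \<and> Im s = u * Im y"
    if "s \<in> closed_segment (of_real x) y" for s y x
    using that by (auto simp: closed_segment_def)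
  \<comment> \<open>The right side has a reflex angle and is not convex, but it is star-shaped about
    c + 1: on a segment starting at a real point |Im s| scales linearly.\<close>
  have "starlike U"
    unfolding starlike_def
  proof (intro bexI[of _ "of_real (c + 1)"] ballI subsetI)
    show "of_real (c + 1) \<in> U" by (simp add: U_def)
    fix y s assume y: "y \<in> U" and "s \<in> closed_segment (of_real (c + 1)) y"
    then obtain u where u: "0 \<le> u" "u \<le> 1" "Re s = (1 - u) * (c + 1) + u * Re y" "Im s = u * Im y" using seg by blast
    show "s \<in> U"
    proof (cases "u = 0")
      case False
      have "u * (c - \<bar>Im y\<bar>) < u * Re y" using y u False by (intro mult_strict_left_mono) (auto simp: U_def)
      thus ?thesis unfolding U_def using u by (simp add: abs_mult algebra_simps)
    qed (use u in \<open>simp add: U_def\<close>)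
  qed
  hence cU: "connected U" by (rule starlike_imp_connected)
  have "starlike V"
    unfolding starlike_def
  proof (intro bexI[of _ "of_real (c - 1)"] ballI subsetI)
    show "of_real (c - 1) \<in> V" by (simp add: V_def)
    fix y s assume y: "y \<in> V" and "s \<in> closed_segment (of_real (c - 1)) y"
    then obtain u where u: "0 \<le> u" "u \<le> 1" "Re s = (1 - u) * (c - 1) + u * Re y" "Im s = u * Im y" using seg by blast
    show "s \<in> V"
    proof (cases "u = 0")
      case False
      have "u * Re y < u * (c - \<bar>Im y\<bar>)" using y u False by (intro mult_strict_left_mono) (auto simp: V_def)
      thus ?thesis unfolding V_def using u by (simp add: abs_mult algebra_simps)
    qed (use u in \<open>simp add: V_def\<close>)
  qed
  hence cV: "connected V" by (rule starlike_imp_connected)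
  have range: "U \<union> V = - range (wedge c)"
  proof -
    have "s \<in> range (wedge c) \<longleftrightarrow> Re s = c - \<bar>Im s\<bar>" for s
    proof
      assume "s \<in> range (wedge c)"
      thus "Re s = c - \<bar>Im s\<bar>" by (auto simp: wedge_def abs_mult)
    next
      assume "Re s = c - \<bar>Im s\<bar>"
      hence "s = wedge c (Im s / (sqrt 2 / 2))" by (simp add: wedge_def complex_eq_iff abs_mult abs_divide)
      thus "s \<in> range (wedge c)" by (rule range_eqI)
    qed
    note range_iff = this
    show ?thesis
    proof (rule set_eqI)
      fix s
      show "s \<in> U \<union> V \<longleftrightarrow> s \<in> - range (wedge c)"
        unfolding Compl_iff range_iff by (auto simp: U_def V_def)
    qed
  qed
  have sub: "\<Lambda>p \<subseteq> U" "\<Lambda>m \<subseteq> V"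
  proof -
    have real: "Im s = 0" if "s \<in> \<real>" for s using that by (auto elim: Reals_cases)
    show "\<Lambda>p \<subseteq> U"
    proof
      fix s assume "s \<in> \<Lambda>p"
      thus "s \<in> U" using \<Lambda>p[of s] real[of s] by (simp add: U_def)
    qed
    show "\<Lambda>m \<subseteq> V"
    proof
      fix s assume "s \<in> \<Lambda>m"
      thus "s \<in> V" using \<Lambda>m[of s] real[of s] by (simp add: V_def)
    qed
  qed
  have "of_real x \<in> U" if "x \<ge> c + 1" for x using that by (simp add: U_def)
  hence right: "\<exists>N::real. \<forall>x\<ge>N. of_real x \<in> U" by (intro exI[of _ "c + 1"]) simp
  have "of_real (c + 1) \<in> U" "of_real (c - 1) \<in> V" by (auto simp: U_def V_def)
  hence ne: "U \<noteq> {}" "V \<noteq> {}" by blast+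
  have disj: "U \<inter> V = {}" by (auto simp: U_def V_def)
  show "\<exists>U V. open U \<and> connected U \<and> U \<noteq> {} \<and> open V \<and> connected V \<and> V \<noteq> {} \<and>
        U \<inter> V = {} \<and> U \<union> V = - range (wedge c) \<and>
        \<Lambda>p \<subseteq> U \<and> (\<exists>N::real. \<forall>x\<ge>N. of_real x \<in> U) \<and> \<Lambda>m \<subseteq> V"
    by (intro exI[of _ U] exI[of _ V] conjI op cU cV ne disj range sub right)
qed

section \<open>The parameters of the Kilbas-Saigo function\<close>

locale kilbas_saigo_params = barnes_double_gamma \<tau> for \<tau> :: real +
  fixes p :: nat and a b :: "real list"
  assumes la: "length a = p" and lb: "length b = p"
    and a: "\<And>j k l. j < p \<Longrightarrow> a ! j \<noteq> - real k * \<tau> - real l"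
    and b: "\<And>j. j < p \<Longrightarrow> b ! j > 0"
    and pos: "0 < (\<Sum>j<p. b ! j - a ! j)"
begin

abbreviation "aa \<equiv> map complex_of_real a"
abbreviation "bb \<equiv> map complex_of_real b"
abbreviation "Aup \<equiv> 1 # 1 # bb"
abbreviation "Blo \<equiv> aa @ [1 + T, 1 + T]"

definition Q :: "complex \<Rightarrow> complex" where
  "Q z = (\<Prod>j<p. barnes_G T (of_real (a ! j) + z) / barnes_G T (of_real (b ! j) + z))"

lemma Ga_nz: "j < p \<Longrightarrow> barnes_G T (of_real (a ! j) + of_nat n) \<noteq> 0"
proof
  assume j: "j < p" and "barnes_G T (of_real (a ! j) + of_nat n) = 0"
  then obtain k l where "of_real (a ! j) + of_nat n = - complex_of_real (lat (k, l))"
    using barnes_G_eq_0_iff by (metis surj_pair)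
  hence e: "of_real (a ! j) + of_nat n = - complex_of_real (lat (k, l))" .
  have "complex_of_real (a ! j) = (of_real (a ! j) + of_nat n) - of_nat n" by simp
  also have "\<dots> = of_real (- real k * \<tau> - real (l + n))" unfolding e by (simp add: barnes_lattice_def)
  finally have "complex_of_real (a ! j) = of_real (- real k * \<tau> - real (l + n))" .
  hence "a ! j = - real k * \<tau> - real (l + n)" by (simp only: of_real_eq_iff)
  thus False using a[OF j] by blast
qed

lemma Gb_nz: "j < p \<Longrightarrow> Re z > - (b ! j) \<Longrightarrow> barnes_G T (of_real (b ! j) + z) \<noteq> 0"
proof
  assume j: "j < p" and z: "Re z > - (b ! j)" and "barnes_G T (of_real (b ! j) + z) = 0"
  then obtain i where "of_real (b ! j) + z = - complex_of_real (lat i)"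
    using barnes_G_eq_0_iff by blast
  hence "Re (of_real (b ! j) + z) = Re (- complex_of_real (lat i))" by (rule arg_cong)
  thus False using z barnes_lattice_nonneg[of i] by simp
qed

text \<open>a_j + n again avoids the zeros of G, since subtracting n from -k \<tau> - l gives a
  number of the same form. Nonvanishing is used to divide by \<open>Q 0\<close>, and to know that -n
  is a genuine simple pole of the kernel.\<close>

lemma Q_nz: "Q (of_nat n) \<noteq> 0"
proof -
  have "barnes_G T (of_real (a ! j) + of_nat n) / barnes_G T (of_real (b ! j) + of_nat n) \<noteq> 0" if j: "j < p" for j
  proof -
    have "Re (of_nat n) > - (b ! j)" using b[OF j] by simp
    thus ?thesis using Ga_nz[OF j, of n] Gb_nz[OF j] by simp
  qed
  thus ?thesis unfolding Q_def by simp
qed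

lemma kilbas_saigo_coeff_eq:
  "kilbas_saigo_coeff T aa bb n = Q (of_nat n) / Q 0"
  by (simp add: kilbas_saigo_coeff_def barnes_pochhammers_def barnes_pochhammer_def prod_list_map_nth la lb Q_def prod_dividef o_def)

lemma Q_decay:
  assumes \<eta>: "\<eta> > 0"
  shows "\<exists>\<rho>. \<forall>z. norm z \<ge> \<rho> \<longrightarrow> Re z \<ge> \<eta> * norm z \<longrightarrow> norm (Q z) \<le> exp (- K * norm z)"
proof -
  obtain \<rho> where "\<And>z. norm z \<ge> \<rho> \<Longrightarrow> Re z \<ge> \<eta> * norm z \<Longrightarrow>
    norm (\<Prod>j\<in>{..<p}. barnes_G T (of_real (a ! j) + z) / barnes_G T (of_real (b ! j) + z)) \<le> exp (- K * norm z)"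
    by (rule barnes_quotient_decay[OF finite_lessThan pos \<eta>, of K]) blast
  thus ?thesis unfolding Q_def by blast
qed

lemma summable_Q: "summable (\<lambda>n. Q (of_nat n) * z ^ n)"
proof (rule summable_of_superexponential_decay)
  fix K :: real
  obtain \<rho> where \<rho>: "\<forall>z. norm z \<ge> \<rho> \<longrightarrow> Re z \<ge> 1 * norm z \<longrightarrow> norm (Q z) \<le> exp (- K * norm z)"
    using Q_decay[of 1 K] by auto
  have "norm (Q (of_nat n)) \<le> exp (- K * real n)" if "n \<ge> nat \<lceil>\<rho>\<rceil>" for n
  proof -
    have "real n \<ge> \<rho>" using that by linarith
    thus ?thesis using \<rho>[rule_format, of "of_nat n"] by simp
  qed
  thus "\<exists>N. \<forall>n\<ge>N. norm (Q (of_nat n)) \<le> exp (- K * real n)" by blast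
qed

lemma kilbas_saigo_coeff_mult_power: "kilbas_saigo_coeff T aa bb n * z ^ n = inverse (Q 0) * (Q (of_nat n) * z ^ n)"
  unfolding kilbas_saigo_coeff_eq by (simp add: divide_inverse)

lemma summable_kilbas_saigo: "summable (\<lambda>n. kilbas_saigo_coeff T aa bb n * z ^ n)"
  unfolding kilbas_saigo_coeff_mult_power by (intro summable_mult summable_Q)

lemma holomorphic_kilbas_saigo: "kilbas_saigo T aa bb holomorphic_on UNIV"
  using holomorphic_of_entire_power_series[OF summable_kilbas_saigo] by (simp add: kilbas_saigo_def[abs_def])

lemma kilbas_saigo_sums: "(\<lambda>n. Q (of_nat n) * z ^ n) sums (Q 0 * kilbas_saigo T aa bb z)"
proof -
  have "kilbas_saigo T aa bb z = inverse (Q 0) * (\<Sum>n. Q (of_nat n) * z ^ n)"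
    unfolding kilbas_saigo_def kilbas_saigo_coeff_mult_power by (rule suminf_mult[OF summable_Q])
  hence "Q 0 * kilbas_saigo T aa bb z = (\<Sum>n. Q (of_nat n) * z ^ n)"
    using Q_nz[of 0] by (simp add: field_simps)
  thus ?thesis using summable_sums[OF summable_Q] by simp
qed

lemma take_drop_params:
  "take (p + 1) Blo = aa @ [1 + T]" "drop (p + 1) Blo = [1 + T]" "take 1 Aup = [1]" "drop 1 Aup = 1 # bb"
  by (simp_all add: la)

text \<open>The first upper parameter 1 and the first lower 1 + \<tau> supply G (\<tau> + s) and G
  (1 + \<tau> - s); the other lower 1 + \<tau> and the other upper 1 put G s and G (1 - s) into the
  denominator. The assumptions permit their cancellation.\<close>

lemma K_integrand_eq:
  assumes "barnes_G T s \<noteq> 0" "barnes_G T (1 - s) \<noteq> 0"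
  shows "K_integrand T (p + 1) 1 Aup Blo s = of_real (2 * pi) powr (T - 1) * (of_real pi / sin (of_real pi * s)) * Q (- s)"
proof -
  define PA where "PA = (\<Prod>j<p. barnes_G T (of_real (a ! j) - s))"
  define PB where "PB = (\<Prod>j<p. barnes_G T (of_real (b ! j) - s))"
  have "K_integrand T (p + 1) 1 Aup Blo s =
     PA * (barnes_G T (T + s) * barnes_G T (1 + T - s)) / (barnes_G T s * barnes_G T (1 - s) * PB)"
    unfolding K_integrand_def take_drop_params PA_def PB_def
    by (simp add: prod_list_map_nth la lb mult_ac)
  also have "barnes_G T (T + s) * barnes_G T (1 + T - s) =
     of_real (2 * pi) powr (T - 1) * (of_real pi / sin (of_real pi * s)) * (barnes_G T s * barnes_G T (1 - s))"
    by (rule barnes_G_reflection[OF assms])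
  also have "PA * (of_real (2 * pi) powr (T - 1) * (of_real pi / sin (of_real pi * s)) * (barnes_G T s * barnes_G T (1 - s))) /
      (barnes_G T s * barnes_G T (1 - s) * PB) = of_real (2 * pi) powr (T - 1) * (of_real pi / sin (of_real pi * s)) * (PA / PB)"
    using assms by (simp add: mult.commute mult.left_commute)
  also have "PA / PB = Q (- s)" by (simp add: PA_def PB_def Q_def prod_dividef)
  finally show ?thesis .
qed

abbreviation "\<Lambda>p \<equiv> K_poles_plus T 1 Aup"
abbreviation "\<Lambda>m \<equiv> K_poles_minus T (p + 1) Blo"

lemma poles_plus_iff: "s \<in> \<Lambda>p \<longleftrightarrow> (\<exists>c i. (c = 1 \<or> (\<exists>j<p. c = b ! j)) \<and> s = of_real (c + lat i))"
proof -
  have seteq: "set (drop 1 Aup) = complex_of_real ` ({1} \<union> {b ! j | j. j < p})"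
  proof -
    have "set b = {b ! j | j. j < p}" by (auto simp: set_conv_nth lb)
    thus ?thesis unfolding take_drop_params by simp
  qed
  have "s \<in> \<Lambda>p \<longleftrightarrow> (\<exists>z\<in>set (drop 1 Aup). \<exists>l k. s = z + of_nat l * T + of_nat k)"
    unfolding K_poles_plus_def by blast
  also have "\<dots> \<longleftrightarrow> (\<exists>c\<in>{1} \<union> {b ! j | j. j < p}. \<exists>l k. s = of_real c + of_nat l * T + of_nat k)"
    unfolding seteq by (simp only: bex_simps)
  also have "\<dots> \<longleftrightarrow> (\<exists>c i. c \<in> {1} \<union> {b ! j | j. j < p} \<and> s = of_real (c + lat i))"
    by (simp add: barnes_lattice_def split_paired_Ex add.assoc Bex_def)
  finally show ?thesis by auto
qed

text \<open>The parameter 1 + \<tau> exactly offsets the conditions l \<ge> 1 and k \<ge> 1, so the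
  set is the zero set of G and contains all integers -n.\<close>

lemma poles_minus_iff: "s \<in> \<Lambda>m \<longleftrightarrow> (\<exists>i. s = - of_real (lat i))"
proof
  assume "s \<in> \<Lambda>m"
  then obtain l k :: nat where lk: "1 \<le> l" "1 \<le> k" "s = 1 + T - of_nat l * T - of_nat k"
    unfolding K_poles_minus_def take_drop_params by auto
  then obtain l' k' where "l = Suc l'" "k = Suc k'" by (metis Suc_le_D One_nat_def)
  hence "s = - of_real (lat (l', k'))" using lk by (simp add: barnes_lattice_def algebra_simps)
  thus "\<exists>i. s = - of_real (lat i)" by blast
next
  assume "\<exists>i. s = - of_real (lat i)"
  then obtain l k where lk: "s = - of_real (lat (l, k))" by (metis surj_pair)
  have "s = (1 + T) - of_nat (Suc l) * T - of_nat (Suc k)" unfolding lk by (simp add: barnes_lattice_def algebra_simps)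
  moreover have "1 + T \<in> set (drop (p + 1) Blo)" unfolding take_drop_params by simp
  moreover have "1 \<le> Suc l" "1 \<le> Suc k" by auto
  ultimately show "s \<in> \<Lambda>m" unfolding K_poles_minus_def by blast
qed

text \<open>A real number strictly between the two pole sets, which are contained in the half-lines
  up to 0 and above \<beta>. It also bounds a half-plane free of zeros of the denominator of
  \<open>Q (- s)\<close>.\<close>

lemma b_lower_bound: obtains \<beta> where "\<beta> > 0" "\<beta> < 1" "\<And>j. j < p \<Longrightarrow> \<beta> < b ! j"
proof -
  define m where "m = Min (insert 1 ((!) b ` {..<p}))"
  have m: "m > 0" unfolding m_def using b by (subst Min_gr_iff) auto
  have le: "m \<le> 1" "\<And>j. j < p \<Longrightarrow> m \<le> b ! j" unfolding m_def by (auto intro: Min_le)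
  show thesis
  proof (rule that[of "m / 2"])
    fix j assume "j < p"
    thus "m / 2 < b ! j" using le(2)[of j] m by (simp add: field_simps)
  qed (use m le in auto)
qed

lemma poles_plus_gt:
  assumes "s \<in> \<Lambda>p" "\<beta> < 1" "\<And>j. j < p \<Longrightarrow> \<beta> < b ! j"
  shows "s \<in> \<real> \<and> Re s > \<beta>"
proof -
  obtain c i where c: "c = 1 \<or> (\<exists>j<p. c = b ! j)" "s = of_real (c + lat i)"
    using assms(1) unfolding poles_plus_iff by blast
  have "c > \<beta>" using c(1) assms by auto
  hence "c + lat i > \<beta>" using barnes_lattice_nonneg[of i] by linarith
  thus ?thesis unfolding c(2) by (simp only: Re_complex_of_real Reals_of_real simp_thms)
qed

lemma poles_minus_le:
  assumes "s \<in> \<Lambda>m"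
  shows "s \<in> \<real> \<and> Re s \<le> 0"
  using assms barnes_lattice_nonneg unfolding poles_minus_iff by auto

lemma finite_poles_plus: "finite (\<Lambda>p \<inter> ball 0 r)"
proof (rule finite_subset)
  show "\<Lambda>p \<inter> ball 0 r \<subseteq> (\<lambda>(c, i). of_real (c + lat i)) ` (({1} \<union> (!) b ` {..<p}) \<times> {i. lat i \<le> r})"
  proof
    fix s assume "s \<in> \<Lambda>p \<inter> ball 0 r"
    hence s: "s \<in> \<Lambda>p" "norm s < r" by auto
    from s(1) obtain c i where c: "c = 1 \<or> (\<exists>j<p. c = b ! j)" "s = of_real (c + lat i)"
      unfolding poles_plus_iff by blast
    have c0: "c > 0" using c(1) b by auto
    have "\<bar>c + lat i\<bar> < r" using s(2) unfolding c(2) by (simp only: norm_of_real)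
    hence "lat i \<le> r" using c0 by linarith
    moreover have "c \<in> {1} \<union> (!) b ` {..<p}" using c(1) by auto
    ultimately have "(c, i) \<in> ({1} \<union> (!) b ` {..<p}) \<times> {i. lat i \<le> r}" by simp
    thus "s \<in> (\<lambda>(c, i). of_real (c + lat i)) ` (({1} \<union> (!) b ` {..<p}) \<times> {i. lat i \<le> r})"
      unfolding c(2) by force
  qed
  show "finite ((\<lambda>(c, i). complex_of_real (c + lat i)) ` (({1} \<union> (!) b ` {..<p}) \<times> {i. lat i \<le> r}))"
    by (intro finite_imageI finite_cartesian_product finite_barnes_lattice_le) auto
qed

lemma K_mu_eq: "K_mu (p + 1) 1 Aup Blo = of_real (- (\<Sum>j<p. b ! j - a ! j))"
proof -
  have s: "sum_list (map complex_of_real xs) = of_real (\<Sum>j<length xs. xs ! j)" for xs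
    by (simp add: sum_list_sum_nth atLeast0LessThan)
  show ?thesis unfolding K_mu_def take_drop_params
    by (simp add: s la lb sum_subtractf)
qed

section \<open>The kernel, its residues and its decay\<close>

text \<open>The integrand with its removable singularities removed. At the zeros of G s or G (1 - s)
  the quotient in \<open>K_integrand\<close> has a vanishing denominator and hence the default value
  0, while the kernel is regular at every point of \<open>\<Lambda>m\<close> that is not an
  integer.\<close>

definition kernel :: "real \<Rightarrow> complex \<Rightarrow> complex" where
  "kernel x s = of_real (2 * pi) powr (T - 1) * of_real pi * Q (- s) * of_real x powr (- s) / sin (of_real pi * s)"

lemma holomorphic_kernel:
  assumes x: "x > 0"
  shows "kernel x holomorphic_on - (range (\<lambda>n. - of_nat n) \<union> \<Lambda>p)"
proof -
  have bnz: "barnes_G T (of_real (b ! j) + - s) \<noteq> 0" if s: "s \<in> - (range (\<lambda>n. - of_nat n) \<union> \<Lambda>p)" and j: "j < p" for s j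
  proof
    assume "barnes_G T (of_real (b ! j) + - s) = 0"
    then obtain i where "of_real (b ! j) + - s = - complex_of_real (lat i)" using barnes_G_eq_0_iff by blast
    hence "s = of_real (b ! j + lat i)" by (simp add: algebra_simps)
    hence "s \<in> \<Lambda>p" unfolding poles_plus_iff using j by blast
    thus False using s by blast
  qed
  have snz: "sin (of_real pi * s) \<noteq> 0" if s: "s \<in> - (range (\<lambda>n. - of_nat n) \<union> \<Lambda>p)" for s
  proof
    assume "sin (of_real pi * s) = 0"
    then obtain n :: int where "of_real pi * s = of_real (n * pi)" unfolding sin_eq_0 by blast
    hence n: "s = of_int n" by simp
    show False
    proof (cases "n \<le> 0")
      case True
      hence "s = - of_nat (nat (- n))" using n by simp
      thus False using s by blast
    next
      \<comment> \<open>Positive integers are zeros of the sine too; they belong to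
        \<open>\<Lambda>p\<close> thanks to the second upper parameter 1.\<close>
      case False
      hence "s = of_real (1 + lat (0, nat (n - 1)))" using n by (simp add: barnes_lattice_def)
      hence "s \<in> \<Lambda>p" unfolding poles_plus_iff by blast
      thus False using s by blast
    qed
  qed
  show ?thesis unfolding kernel_def[abs_def] Q_def
    by (intro holomorphic_intros holomorphic_barnes_G_compose) (use bnz snz x in auto)
qed

text \<open>The derivative of sin (\<pi> s) at -n is \<pi> (-1)^n; this sign is what turns x^n into
  (-x)^n.\<close>

lemma residue_kernel:
  assumes x: "x > 0"
  shows "residue (kernel x) (- of_nat n) = of_real (2 * pi) powr (T - 1) * (Q (of_nat n) * (- of_real x) ^ n)"
proof -
  obtain \<beta> where \<beta>: "\<beta> > 0" "\<And>j. j < p \<Longrightarrow> \<beta> < b ! j" by (rule b_lower_bound) blast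
  define f where "f = (\<lambda>s. of_real (2 * pi) powr (T - 1) * of_real pi * Q (- s) * of_real x powr (- s))"
  have f: "f holomorphic_on {s. Re s < \<beta>}"
    unfolding f_def Q_def
  proof (intro holomorphic_intros holomorphic_barnes_G_compose)
    fix s j assume "s \<in> {s. Re s < \<beta>}" "j \<in> {..<p}"
    thus "barnes_G T (of_real (b ! j) + - s) \<noteq> 0" using \<beta>(2)[of j] by (intro Gb_nz) auto
  qed
  have g: "((\<lambda>s::complex. sin (of_real pi * s)) has_field_derivative of_real pi * (- 1) ^ n) (at (- of_nat n))"
  proof -
    have "cos (of_real pi * (- complex_of_nat n)) = of_real (cos (real n * pi))"
    proof -
      have "of_real pi * (- complex_of_nat n) = of_real (- (real n * pi))" by simp
      thus ?thesis by (simp only: cos_of_real cos_minus)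
    qed
    also have "\<dots> = (- 1) ^ n" by (simp add: cos_npi)
    finally have "cos (of_real pi * (- complex_of_nat n)) = (- 1) ^ n" .
    thus ?thesis by (auto intro!: derivative_eq_intros)
  qed
  have pw: "complex_of_real x powr (of_nat n) = of_real x ^ n" using x by (simp add: powr_nat')
  have fn: "f (- of_nat n) = of_real (2 * pi) powr (T - 1) * of_real pi * Q (of_nat n) * of_real x ^ n"
    unfolding f_def minus_minus pw ..
  have "residue (\<lambda>s. f s / sin (of_real pi * s)) (- of_nat n) = f (- of_nat n) / (of_real pi * (- 1) ^ n)"
  proof (rule residue_simple_pole_deriv[OF f])
    show "f (- of_nat n) \<noteq> 0" unfolding fn using Q_nz[of n] x by simp
    have "of_real pi * (- complex_of_nat n) = of_real (- (real n * pi))" by simp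
    thus "sin (of_real pi * (- complex_of_nat n)) = 0" by (simp only: sin_of_real sin_minus sin_npi) simp
    show "connected {s. Re s < \<beta>}" by (intro convex_connected convex_halfspace_Re_lt)
  qed (use g \<beta>(1) in \<open>auto simp: open_halfspace_Re_lt intro!: holomorphic_intros\<close>)
  also have "\<dots> = of_real (2 * pi) powr (T - 1) * (Q (of_nat n) * (- of_real x) ^ n)"
    unfolding fn by (cases "even n") (auto simp: field_simps)
  finally show ?thesis unfolding kernel_def[abs_def] f_def .
qed

lemma kernel_decay:
  assumes x: "x > 0" and \<eta>: "\<eta> > 0"
  shows "\<exists>\<rho>. \<forall>s. norm s \<ge> \<rho> \<longrightarrow> - Re s \<ge> \<eta> * norm s \<longrightarrow> norm (sin (of_real pi * s)) \<ge> 1 \<longrightarrow> norm (kernel x s) \<le> exp (- norm s)"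
proof -
  define c where "c = norm (of_real (2 * pi) powr (T - 1) * of_real pi)"
  obtain \<rho> where \<rho>: "\<forall>z. norm z \<ge> \<rho> \<longrightarrow> Re z \<ge> \<eta> * norm z \<longrightarrow> norm (Q z) \<le> exp (- (\<bar>ln x\<bar> + 2) * norm z)"
    \<comment> \<open>The rate |ln x| + 2 is spent as follows: |ln x| on the power of x, 1 on the
      constant c, and the remaining 1 is the decay claimed.\<close>
    using Q_decay[OF \<eta>] by blast
  have "norm (kernel x s) \<le> exp (- norm s)"
    if s: "norm s \<ge> max \<rho> (ln (c + 1))" "- Re s \<ge> \<eta> * norm s" "norm (sin (of_real pi * s)) \<ge> 1" for s
  proof -
    have c1: "c + 1 > 0" unfolding c_def by (intro add_nonneg_pos) auto
    have "c + 1 = exp (ln (c + 1))" using c1 by simp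
    also have "\<dots> \<le> exp (norm s)" using s(1) by simp
    finally have cs: "c \<le> exp (norm s)" by linarith
    have q: "norm (Q (- s)) \<le> exp (- (\<bar>ln x\<bar> + 2) * norm s)" using \<rho>[rule_format, of "- s"] s by simp
    have "norm (of_real x powr (- s)) = exp (- Re s * ln x)" using norm_powr_real[of "of_real x" "- s"] x by simp
    also have "\<dots> \<le> exp (norm s * \<bar>ln x\<bar>)"
    proof -
      have "- Re s * ln x \<le> \<bar>Re s\<bar> * \<bar>ln x\<bar>" by (metis abs_ge_self abs_minus_cancel abs_mult)
      also have "\<dots> \<le> norm s * \<bar>ln x\<bar>" by (intro mult_right_mono abs_Re_le_cmod) auto
      finally show ?thesis by simp
    qed
    finally have pw: "norm (of_real x powr (- s)) \<le> exp (norm s * \<bar>ln x\<bar>)" .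
    have "norm (kernel x s) = c * norm (Q (- s)) * norm (of_real x powr (- s)) / norm (sin (of_real pi * s))"
      by (simp only: kernel_def c_def norm_mult norm_divide)
    also have "\<dots> \<le> c * norm (Q (- s)) * norm (of_real x powr (- s)) / 1"
      using s(3) by (intro divide_left_mono) (auto simp: c_def)
    also have "\<dots> \<le> exp (norm s) * exp (- (\<bar>ln x\<bar> + 2) * norm s) * exp (norm s * \<bar>ln x\<bar>) / 1"
      by (intro divide_right_mono mult_mono cs q pw) (auto simp: c_def)
    also have "\<dots> = exp (- norm s)" unfolding exp_add [symmetric] by (simp add: algebra_simps)
    finally show ?thesis .
  qed
  thus ?thesis by blast
qed

lemma has_integral_K_integrand:
  assumes x: "x > 0" and K: "K_contour \<Lambda>p \<Lambda>m (K_mu (p + 1) 1 Aup Blo) \<gamma>"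
  shows "((\<lambda>t. K_integrand T (p + 1) 1 Aup Blo (\<gamma> t) * of_real x powr (- \<gamma> t) * vector_derivative \<gamma> (at t))
     has_integral (2 * of_real pi * \<i> * (of_real (2 * pi) powr (T - 1) * (Q 0 * kilbas_saigo T aa bb (- of_real x))))) UNIV"
proof -
  have Kc: "\<gamma> piecewise_C1_differentiable_on UNIV"
    "\<exists>\<theta>p \<theta>m cp cm R. 0 < \<theta>p \<and> \<theta>p < pi \<and> - pi < \<theta>m \<and> \<theta>m < 0 \<and>
        Re (K_mu (p + 1) 1 Aup Blo * cis \<theta>p) > 0 \<and> Re (K_mu (p + 1) 1 Aup Blo * cis \<theta>m) > 0 \<and>
        (\<forall>t\<ge>R. \<gamma> t = cp + of_real t * cis \<theta>p) \<and> (\<forall>t\<ge>R. \<gamma> (- t) = cm + of_real t * cis \<theta>m)"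
    "\<exists>U V. open U \<and> connected U \<and> U \<noteq> {} \<and> open V \<and> connected V \<and> V \<noteq> {} \<and>
        U \<inter> V = {} \<and> U \<union> V = - range \<gamma> \<and>
        \<Lambda>p \<subseteq> U \<and> (\<exists>N::real. \<forall>x\<ge>N. of_real x \<in> U) \<and> \<Lambda>m \<subseteq> V"
    using K unfolding K_contour_def by - (elim conjE, assumption)+
  from Kc(2) obtain \<theta>p \<theta>m cp cm R where ang': "0 < \<theta>p \<and> \<theta>p < pi \<and> - pi < \<theta>m \<and> \<theta>m < 0 \<and>
        Re (K_mu (p + 1) 1 Aup Blo * cis \<theta>p) > 0 \<and> Re (K_mu (p + 1) 1 Aup Blo * cis \<theta>m) > 0 \<and>
        (\<forall>t\<ge>R. \<gamma> t = cp + of_real t * cis \<theta>p) \<and> (\<forall>t\<ge>R. \<gamma> (- t) = cm + of_real t * cis \<theta>m)"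
    by (elim exE) (rule that)
  hence ang: "0 < \<theta>p" "\<theta>p < pi" "- pi < \<theta>m" "\<theta>m < 0"
      "Re (K_mu (p + 1) 1 Aup Blo * cis \<theta>p) > 0" "Re (K_mu (p + 1) 1 Aup Blo * cis \<theta>m) > 0"
      "\<forall>t\<ge>R. \<gamma> t = cp + of_real t * cis \<theta>p" "\<forall>t\<ge>R. \<gamma> (- t) = cm + of_real t * cis \<theta>m"
    by - (elim conjE, assumption)+
  from Kc(3) obtain U V where UV': "open U \<and> connected U \<and> U \<noteq> {} \<and> open V \<and> connected V \<and> V \<noteq> {} \<and>
        U \<inter> V = {} \<and> U \<union> V = - range \<gamma> \<and>
        \<Lambda>p \<subseteq> U \<and> (\<exists>N::real. \<forall>x\<ge>N. of_real x \<in> U) \<and> \<Lambda>m \<subseteq> V"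
    by (elim exE) (rule that)
  hence U: "open U" "connected U" and V: "open V" "connected V"
    and UV: "U \<inter> V = {}" "U \<union> V = - range \<gamma>"
    and sub: "\<Lambda>p \<subseteq> U" "\<exists>N::real. \<forall>x\<ge>N. complex_of_real x \<in> U" "\<Lambda>m \<subseteq> V"
    by - (elim conjE, assumption)+
  from sub(2) obtain N0 :: real where N0: "\<forall>x\<ge>N0. complex_of_real x \<in> U" by (elim exE) (rule that)
  \<comment> \<open>\<open>K_mu\<close> is a negative real number, so the admissible directions are
    exactly those with negative cosine.\<close>
  have cosneg: "cos \<theta> < 0" if "Re (K_mu (p + 1) 1 Aup Blo * cis \<theta>) > 0" for \<theta>
  proof -
    have "- (\<Sum>j<p. b ! j - a ! j) * cos \<theta> > 0"
      using that unfolding K_mu_eq by (simp only: times_complex.simps Re_complex_of_real Im_complex_of_real cis.simps mult_zero_left diff_zero)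
    thus ?thesis using pos by (simp add: mult_less_0_iff)
  qed
  interpret left_contour \<gamma> cp cm \<theta>p \<theta>m R
  proof
    show "\<gamma> piecewise_C1_differentiable_on UNIV" by (rule Kc(1))
    show "cos \<theta>p < 0" "cos \<theta>m < 0" using cosneg ang by auto
    show "sin \<theta>p > 0" using ang by (intro sin_gt_zero)
    show "sin \<theta>m < 0" using sin_gt_zero[of "- \<theta>m"] ang by simp
  qed (use ang in auto)
  have disj: "U \<inter> range \<gamma> = {}" "V \<inter> range \<gamma> = {}" using UV by blast+
  have negint: "- complex_of_nat n \<in> V" for n
  proof -
    have "- complex_of_nat n = - of_real (lat (0, n))" by (simp add: barnes_lattice_def)
    hence "- complex_of_nat n \<in> \<Lambda>m" unfolding poles_minus_iff by blast
    thus ?thesis using sub(3) by blast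
  qed
  obtain \<beta> where \<beta>: "\<beta> > 0" "\<beta> < 1" "\<And>j. j < p \<Longrightarrow> \<beta> < b ! j" by (rule b_lower_bound) blast
  have Repos: "Re q > 0" if "q \<in> \<Lambda>p" for q using poles_plus_gt[OF that \<beta>(2,3)] \<beta>(1) by linarith
  have cl: "closed (range (\<lambda>n. - complex_of_nat n) \<union> \<Lambda>p)"
  proof (rule closed_of_locally_finite)
    show "finite ((range (\<lambda>n. - complex_of_nat n) \<union> \<Lambda>p) \<inter> ball 0 r)" for r
      unfolding Int_Un_distrib2 using finite_nonpos_integers_ball finite_poles_plus by blast
  qed
  have "(\<lambda>n. residue (kernel x) (- of_nat n)) sums (of_real (2 * pi) powr (T - 1) * (Q 0 * kilbas_saigo T aa bb (- of_real x)))"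
    unfolding residue_kernel[OF x] by (rule sums_mult[OF kilbas_saigo_sums])
  from has_integral_left_contour[OF U disj(1) _ V disj(2) negint sub(1) Repos finite_poles_plus holomorphic_kernel[OF x] cl kernel_decay[OF x] this, of N0]
  have I: "((\<lambda>t. kernel x (\<gamma> t) * vector_derivative \<gamma> (at t)) has_integral
     (2 * of_real pi * \<i> * (of_real (2 * pi) powr (T - 1) * (Q 0 * kilbas_saigo T aa bb (- of_real x))))) UNIV"
    using N0 by blast
  \<comment> \<open>The contour avoids \<open>\<Lambda>m\<close>, the zeros of G s, and
    \<open>\<Lambda>p\<close>, which contains the zeros of G (1 - s); along it the kernel and the
    integrand therefore coincide.\<close>
  have keq: "kernel x (\<gamma> t) = K_integrand T (p + 1) 1 Aup Blo (\<gamma> t) * of_real x powr (- \<gamma> t)" for t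
  proof -
    have out: "\<gamma> t \<notin> \<Lambda>p" "\<gamma> t \<notin> \<Lambda>m" using sub disj by blast+
    have "barnes_G T (\<gamma> t) \<noteq> 0"
      using out(2) unfolding poles_minus_iff barnes_G_eq_0_iff .
    moreover have "barnes_G T (1 - \<gamma> t) \<noteq> 0"
    proof
      assume "barnes_G T (1 - \<gamma> t) = 0"
      then obtain i where "1 - \<gamma> t = - complex_of_real (lat i)" using barnes_G_eq_0_iff by blast
      hence "\<gamma> t = of_real (1 + lat i)" by (simp add: algebra_simps)
      thus False using out(1) unfolding poles_plus_iff by blast
    qed
    ultimately show ?thesis unfolding kernel_def by (subst K_integrand_eq) simp_all
  qed
  from I show ?thesis unfolding keq .
qed

lemma has_K_value_kilbas_saigo:
  assumes x: "x > 0"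
  shows "has_K_value T (p + 1) 1 Aup Blo x (of_real (2 * pi) powr (T - 1) * (Q 0 * kilbas_saigo T aa bb (- of_real x)))"
  unfolding has_K_value_def
proof (intro conjI)
  show "length Blo = length Aup" "p + 1 + 1 = length Aup" by (simp_all add: la lb)
  obtain \<beta> where \<beta>: "\<beta> > 0" "\<beta> < 1" "\<And>j. j < p \<Longrightarrow> \<beta> < b ! j" by (rule b_lower_bound) blast
  have plus: "s \<in> \<real> \<and> Re s > \<beta>" if "s \<in> \<Lambda>p" for s by (rule poles_plus_gt[OF that \<beta>(2,3)])
  have minus: "s \<in> \<real> \<and> Re s < \<beta>" if "s \<in> \<Lambda>m" for s using poles_minus_le[OF that] \<beta>(1) by linarith
  show "\<Lambda>p \<inter> \<Lambda>m = {}"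
  proof (rule ccontr)
    assume "\<Lambda>p \<inter> \<Lambda>m \<noteq> {}"
    then obtain s where "s \<in> \<Lambda>p" "s \<in> \<Lambda>m" by blast
    thus False using plus[of s] minus[of s] by linarith
  qed
  show "Re (K_mu (p + 1) 1 Aup Blo) \<noteq> 0" unfolding K_mu_eq using pos by (simp only: Re_complex_of_real)
  show "\<exists>\<gamma>. K_contour \<Lambda>p \<Lambda>m (K_mu (p + 1) 1 Aup Blo) \<gamma>"
    unfolding K_mu_eq
    by (rule exI, rule wedge_K_contour[OF _ plus minus]) (use pos in simp)
  show "\<forall>\<gamma>. K_contour \<Lambda>p \<Lambda>m (K_mu (p + 1) 1 Aup Blo) \<gamma> \<longrightarrow>
        ((\<lambda>t. K_integrand T (p + 1) 1 Aup Blo (\<gamma> t) * of_real x powr (- \<gamma> t) * vector_derivative \<gamma> (at t))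
           has_integral (2 * of_real pi * \<i> * (of_real (2 * pi) powr (T - 1) * (Q 0 * kilbas_saigo T aa bb (- of_real x))))) UNIV"
    using has_integral_K_integrand[OF x] by blast
qed

lemma K_function_eq:
  assumes x: "x > 0"
  shows "K_function T (p + 1) 1 Aup Blo x = of_real (2 * pi) powr (T - 1) * (Q 0 * kilbas_saigo T aa bb (- of_real x))"
  unfolding K_function_def
proof (rule the_equality, rule has_K_value_kilbas_saigo[OF x])
  fix v assume v: "has_K_value T (p + 1) 1 Aup Blo x v"
  then obtain \<gamma> where \<gamma>: "K_contour \<Lambda>p \<Lambda>m (K_mu (p + 1) 1 Aup Blo) \<gamma>" unfolding has_K_value_def by blast
  have "((\<lambda>t. K_integrand T (p + 1) 1 Aup Blo (\<gamma> t) * of_real x powr (- \<gamma> t) * vector_derivative \<gamma> (at t))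
           has_integral (2 * of_real pi * \<i> * v)) UNIV"
    using v \<gamma> unfolding has_K_value_def by blast
  from has_integral_unique[OF this has_integral_K_integrand[OF x \<gamma>]]
  show "v = of_real (2 * pi) powr (T - 1) * (Q 0 * kilbas_saigo T aa bb (- of_real x))" by simp
qed

lemma kilbas_saigo_eq_K_function:
  assumes x: "x > 0"
  shows "kilbas_saigo T aa bb (- of_real x) =
     (of_real (2 * pi) powr (1 - T) * (\<Prod>j<p. barnes_G T (bb ! j) / barnes_G T (aa ! j))) * K_function T (p + 1) 1 Aup Blo x"
proof -
  have pw: "of_real (2 * pi) powr (1 - T) * of_real (2 * pi) powr (T - 1) = (1 :: complex)"
    unfolding powr_add [symmetric] by simp
  have "(\<Prod>j<p. barnes_G T (bb ! j) / barnes_G T (aa ! j)) * Q 0 =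
     (\<Prod>j<p. (barnes_G T (bb ! j) / barnes_G T (aa ! j)) * (barnes_G T (of_real (a ! j) + 0) / barnes_G T (of_real (b ! j) + 0)))"
    unfolding Q_def prod.distrib ..
  also have "\<dots> = (\<Prod>j<p. 1)"
  proof (rule prod.cong)
    fix j assume "j \<in> {..<p}"
    hence j: "j < p" by simp
    have "barnes_G T (of_real (a ! j)) \<noteq> 0" using Ga_nz[OF j, of 0] by simp
    moreover have "barnes_G T (of_real (b ! j)) \<noteq> 0" using Gb_nz[OF j, of 0] b[OF j] by simp
    ultimately show "(barnes_G T (bb ! j) / barnes_G T (aa ! j)) * (barnes_G T (of_real (a ! j) + 0) / barnes_G T (of_real (b ! j) + 0)) = 1"
      using j by (simp add: la lb)
  qed auto
  finally have Q0: "(\<Prod>j<p. barnes_G T (bb ! j) / barnes_G T (aa ! j)) * Q 0 = 1" by simp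
  have "(of_real (2 * pi) powr (1 - T) * (\<Prod>j<p. barnes_G T (bb ! j) / barnes_G T (aa ! j))) * K_function T (p + 1) 1 Aup Blo x =
     (of_real (2 * pi) powr (1 - T) * of_real (2 * pi) powr (T - 1)) * ((\<Prod>j<p. barnes_G T (bb ! j) / barnes_G T (aa ! j)) * Q 0) *
       kilbas_saigo T aa bb (- of_real x)"
    unfolding K_function_eq[OF x] by (simp only: mult_ac)
  thus ?thesis unfolding pw Q0 by simp
qed

end

text \<open>Summability for every z and the existence of a value v accompany the identity so that
  neither the infinite sum nor the \<open>THE\<close> in \<open>K_function\<close> is an unspecified
  value.\<close>

theorem proposition5:
  fixes \<tau> :: real and p :: nat and a b :: "real list"
  assumes "\<tau> > 0" and "p \<ge> 1" and "length a = p" and "length b = p"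
    and "\<forall>j<p. \<forall>k l::nat. a ! j \<noteq> - real k * \<tau> - real l"
    and "\<forall>j<p. b ! j > 0"
    and "0 < (\<Sum>j<p. b ! j - a ! j)" and "(\<Sum>j<p. b ! j - a ! j) < 2 * \<tau>"
  defines "T \<equiv> complex_of_real \<tau>"
    and "a' \<equiv> map complex_of_real a" and "b' \<equiv> map complex_of_real b"
  shows "(\<forall>z. summable (\<lambda>n. kilbas_saigo_coeff T a' b' n * z ^ n)) \<and>
    kilbas_saigo T a' b' holomorphic_on UNIV \<and>
    (\<forall>x::real. x > 0 \<longrightarrow>
       (\<exists>v. has_K_value T (p + 1) 1 (1 # 1 # b') (a' @ [1 + T, 1 + T]) x v) \<and>
       kilbas_saigo T a' b' (- of_real x) =
         (of_real (2 * pi) powr (1 - T) * (\<Prod>j<p. barnes_G T (b' ! j) / barnes_G T (a' ! j)))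
         * K_function T (p + 1) 1 (1 # 1 # b') (a' @ [1 + T, 1 + T]) x)"
proof -
  interpret kilbas_saigo_params \<tau> p a b
    by unfold_locales (use assms in auto)
  show ?thesis unfolding T_def a'_def b'_def
  proof (intro conjI allI impI)
    show "summable (\<lambda>n. kilbas_saigo_coeff (complex_of_real \<tau>) aa bb n * z ^ n)" for z by (rule summable_kilbas_saigo)
    show "kilbas_saigo (complex_of_real \<tau>) aa bb holomorphic_on UNIV" by (rule holomorphic_kilbas_saigo)
    fix x :: real assume x: "x > 0"
    show "\<exists>v. has_K_value (complex_of_real \<tau>) (p + 1) 1 Aup Blo x v" by (rule exI, rule has_K_value_kilbas_saigo[OF x])
    show "kilbas_saigo (complex_of_real \<tau>) aa bb (- of_real x) =
        (of_real (2 * pi) powr (1 - complex_of_real \<tau>) * (\<Prod>j<p. barnes_G (complex_of_real \<tau>) (bb ! j) / barnes_G (complex_of_real \<tau>) (aa ! j))) * K_function (complex_of_real \<tau>) (p + 1) 1 Aup Blo x"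
      by (rule kilbas_saigo_eq_K_function[OF x])
  qed
qed

end
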